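(* Let $H$ be a quaternion algebra over a number field $K$ with orthogonal involution $\ddagger$. Let $\mathcal{O}_1, \mathcal{O}_2$ be maximal $\ddagger$-orders of $H$. Let $K'$ be a field extension of $K$ containing the splitting fields of $X^2 = \mathrm{nrm}(x)$ for all $x \in H$. Then the following are equivalent. (1) There exists $\gamma \in SL^\ddagger(2,H\otimes_K K')$ such that $\gamma\, SL^\ddagger(2,\mathcal{O}_1)\, \gamma^{-1} = SL^\ddagger(2,\mathcal{O}_2)$ and $\gamma\, SL(2,K)\, \gamma^{-1} = SL(2,K)$. (2) $(\mathcal{O}_1,\ddagger) \cong (\mathcal{O}_2,\ddagger)$.
   Context: Let $\mathfrak{o}_K$ be the ring of integers of $K$ and $\mathrm{nrm}(x) = x\overline{x}$ the reduced norm on $H$. An orthogonal involution $\ddagger$ on $H$ is a $K$-linear map $x\mapsto x^\ddagger$ with $(xy)^\ddagger = y^\ddagger x^\ddagger$ and $(x^\ddagger)^\ddagger = x$, different from the standard involution $x\mapsto\overline{x}$; it extends $K'$-linearly to $H\otimes_K K'$. Set $H^+ = \{x \in H : x^\ddagger = x\}$. Define the group $$SL^\ddagger(2,H) = \left\{\begin{pmatrix} a & b \\ c & d \end{pmatrix} \in \mathrm{Mat}(2,H) : ab^\ddagger \in H^+,\ cd^\ddagger \in H^+,\ ad^\ddagger - bc^\ddagger = 1\right\}$$ under matrix multiplication, and likewise $SL^\ddagger(2,H\otimes_K K')$. A $\ddagger$-order of $H$ is an order of $H$ (a subring with $1$ that is a finitely generated $\mathfrak{o}_K$-module spanning $H$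 over $K$) closed under $\ddagger$; a maximal $\ddagger$-order is a $\ddagger$-order not contained in any strictly larger $\ddagger$-order. Set $SL^\ddagger(2,\mathcal{O}) = SL^\ddagger(2,H)\cap \mathrm{Mat}(2,\mathcal{O})$. The notation $(\mathcal{O}_1,\ddagger)\cong(\mathcal{O}_2,\ddagger)$ means isomorphic as algebras with involution: there is an $\mathfrak{o}_K$-algebra isomorphism $f:\mathcal{O}_1\to\mathcal{O}_2$ with $f(x^\ddagger) = f(x)^\ddagger$ for all $x$. *)

theory Defs
  imports "HOL-Analysis.Analysis" "HOL-Computational_Algebra.Polynomial" "HOL-Library.Poly_Mapping"
begin

section \<open>Fields\<close>

definition number_field :: "'k::field_char_0 itself \<Rightarrow> bool" where
  "number_field _ \<longleftrightarrow>
     (\<exists>B :: 'k set. finite B \<and> module.span (\<lambda>(q::rat) x. of_rat q * x) B = UNIV)"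

text \<open>A field extension \<open>K'\<close> of \<open>K\<close> is given by an embedding \<open>K \<rightarrow> K'\<close>.\<close>

definition field_embedding :: "('k::field \<Rightarrow> 'l::field) \<Rightarrow> bool" where
  "field_embedding emb \<longleftrightarrow> emb 1 = 1 \<and>
     (\<forall>x y. emb (x + y) = emb x + emb y) \<and> (\<forall>x y. emb (x * y) = emb x * emb y)"

text \<open>A field contains a splitting field of a polynomial iff the polynomial is a product of linear
  factors over it.\<close>

definition splits :: "'l::field poly \<Rightarrow> bool" where
  "splits p \<longleftrightarrow> (\<exists>R. p = smult (lead_coeff p) (\<Prod>r\<in>#R. [:- r, 1:]))"

section \<open>Quaternion algebras\<close>

locale algebra_over = vector_space sc for sc :: "'k::field \<Rightarrow> 'h::ring_1 \<Rightarrow> 'h" +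
  assumes scale_mult_left: "sc c x * y = sc c (x * y)"
    and scale_mult_right: "x * sc c y = sc c (x * y)"

definition quaternion_basis ::
    "('k::field \<Rightarrow> 'h::ring_1 \<Rightarrow> 'h) \<Rightarrow> 'k \<Rightarrow> 'k \<Rightarrow> 'h \<Rightarrow> 'h \<Rightarrow> bool" where
  "quaternion_basis sc a b i j \<longleftrightarrow>
     a \<noteq> 0 \<and> b \<noteq> 0 \<and> i * i = sc a 1 \<and> j * j = sc b 1 \<and> j * i = - (i * j) \<and>
     distinct [1, i, j, i * j] \<and>
     \<not> module.dependent sc {1, i, j, i * j} \<and> module.span sc {1, i, j, i * j} = UNIV"

locale quaternion_algebra = algebra_over sc
  for sc :: "'k::field_char_0 \<Rightarrow> 'h::ring_1 \<Rightarrow> 'h" +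
  assumes ex_quaternion_basis: "\<exists>a b i j. quaternion_basis sc a b i j"

definition qcomb ::
    "('k::field \<Rightarrow> 'h::ring_1 \<Rightarrow> 'h) \<Rightarrow> 'h \<Rightarrow> 'h \<Rightarrow> 'k \<Rightarrow> 'k \<Rightarrow> 'k \<Rightarrow> 'k \<Rightarrow> 'h" where
  "qcomb sc i j t u v w = sc t 1 + sc u i + sc v j + sc w (i * j)"

text \<open>The standard involution does not depend on the chosen quaternion basis; see
  \<open>qconj_qcomb\<close> below.\<close>

definition qconj :: "('k::field \<Rightarrow> 'h::ring_1 \<Rightarrow> 'h) \<Rightarrow> 'h \<Rightarrow> 'h" where
  "qconj sc x = (THE y. \<exists>a b i j t u v w. quaternion_basis sc a b i j \<and>
     x = qcomb sc i j t u v w \<and> y = qcomb sc i j t (- u) (- v) (- w))"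

text \<open>The reduced norm, as an element of \<open>K\<close> rather than of \<open>K \<cdot> 1 \<subseteq> H\<close>.\<close>

definition nrm :: "('k::field \<Rightarrow> 'h::ring_1 \<Rightarrow> 'h) \<Rightarrow> 'h \<Rightarrow> 'k" where
  "nrm sc x = (THE c. sc c 1 = x * qconj sc x)"

definition orthogonal_involution ::
    "('k::field \<Rightarrow> 'h::ring_1 \<Rightarrow> 'h) \<Rightarrow> ('h \<Rightarrow> 'h) \<Rightarrow> bool" where
  "orthogonal_involution sc star \<longleftrightarrow> Vector_Spaces.linear sc sc star \<and>
     (\<forall>x y. star (x * y) = star y * star x) \<and> (\<forall>x. star (star x) = x) \<and> star \<noteq> qconj sc"

section \<open>Orders\<close>

definition ok_span :: "('k::field \<Rightarrow> 'h::ring_1 \<Rightarrow> 'h) \<Rightarrow> 'h set \<Rightarrow> 'h set" where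
  "ok_span sc B = {\<Sum>x\<in>B. sc (c x) x | c. \<forall>x\<in>B. algebraic_int (c x)}"

definition is_order :: "('k::field \<Rightarrow> 'h::ring_1 \<Rightarrow> 'h) \<Rightarrow> 'h set \<Rightarrow> bool" where
  "is_order sc R \<longleftrightarrow> 1 \<in> R \<and> (\<forall>x\<in>R. \<forall>y\<in>R. x - y \<in> R) \<and> (\<forall>x\<in>R. \<forall>y\<in>R. x * y \<in> R) \<and>
     (\<exists>B. finite B \<and> R = ok_span sc B) \<and> module.span sc R = UNIV"

definition star_order ::
    "('k::field \<Rightarrow> 'h::ring_1 \<Rightarrow> 'h) \<Rightarrow> ('h \<Rightarrow> 'h) \<Rightarrow> 'h set \<Rightarrow> bool" where
  "star_order sc star R \<longleftrightarrow> is_order sc R \<and> (\<forall>x\<in>R. star x \<in> R)"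

definition maximal_star_order ::
    "('k::field \<Rightarrow> 'h::ring_1 \<Rightarrow> 'h) \<Rightarrow> ('h \<Rightarrow> 'h) \<Rightarrow> 'h set \<Rightarrow> bool" where
  "maximal_star_order sc star R \<longleftrightarrow> star_order sc star R \<and>
     \<not> (\<exists>R'. star_order sc star R' \<and> R \<subset> R')"

definition star_orders_iso ::
    "('k::field \<Rightarrow> 'h::ring_1 \<Rightarrow> 'h) \<Rightarrow> ('h \<Rightarrow> 'h) \<Rightarrow> 'h set \<Rightarrow> 'h set \<Rightarrow> bool" where
  "star_orders_iso sc star R1 R2 \<longleftrightarrow> (\<exists>f. bij_betw f R1 R2 \<and> f 1 = 1 \<and>
     (\<forall>x\<in>R1. \<forall>y\<in>R1. f (x + y) = f x + f y) \<and>
     (\<forall>x\<in>R1. \<forall>y\<in>R1. f (x * y) = f x * f y) \<and>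
     (\<forall>c. \<forall>x\<in>R1. algebraic_int c \<longrightarrow> f (sc c x) = sc c (f x)) \<and>
     (\<forall>x\<in>R1. f (star x) = star (f x)))"

section \<open>Extension of scalars\<close>

text \<open>The tensor product \<open>H \<otimes>\<^sub>K K'\<close> is the quotient of the free abelian group on \<open>H \<times> K'\<close> by the
  subgroup \<open>tensor_relations\<close>. A \<open>K'\<close>-algebra \<open>T\<close> together with a ring homomorphism
  \<open>incl : H \<rightarrow> T\<close> (playing the role of \<open>x \<mapsto> x \<otimes> 1\<close>) is a model of \<open>H \<otimes>\<^sub>K K'\<close> iff
  \<open>x \<otimes> s \<mapsto> s \<cdot> incl x\<close> induces a bijection from that quotient onto \<open>T\<close>.\<close>

inductive_set tensor_relations :: "('k::field \<Rightarrow> 'h::ring_1 \<Rightarrow> 'h) \<Rightarrow> ('k \<Rightarrow> 'l::field) \<Rightarrow>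
    (('h \<times> 'l) \<Rightarrow>\<^sub>0 int) set"
  for sc emb where
  zero: "0 \<in> tensor_relations sc emb"
| diff: "r \<in> tensor_relations sc emb \<Longrightarrow> r' \<in> tensor_relations sc emb \<Longrightarrow>
    r - r' \<in> tensor_relations sc emb"
| add_left: "frag_of (x + y, s) - frag_of (x, s) - frag_of (y, s) \<in> tensor_relations sc emb"
| add_right: "frag_of (x, s + t) - frag_of (x, s) - frag_of (x, t) \<in> tensor_relations sc emb"
| balanced: "frag_of (sc c x, s) - frag_of (x, emb c * s) \<in> tensor_relations sc emb"

definition tensor_eval :: "('l::field \<Rightarrow> 't::ring_1 \<Rightarrow> 't) \<Rightarrow> ('h \<Rightarrow> 't) \<Rightarrow>
    (('h \<times> 'l) \<Rightarrow>\<^sub>0 int) \<Rightarrow> 't" where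
  "tensor_eval scT incl r =
     (\<Sum>p\<in>Poly_Mapping.keys r. of_int (Poly_Mapping.lookup r p) * scT (snd p) (incl (fst p)))"

locale scalar_extension = algebra_over scT
  for scT :: "'l::field \<Rightarrow> 't::ring_1 \<Rightarrow> 't" +
  fixes sc :: "'k::field \<Rightarrow> 'h::ring_1 \<Rightarrow> 'h" and emb :: "'k \<Rightarrow> 'l" and incl :: "'h \<Rightarrow> 't"
  assumes incl_one: "incl 1 = 1"
    and incl_add: "incl (x + y) = incl x + incl y"
    and incl_mult: "incl (x * y) = incl x * incl y"
    and tensor_surj: "range (tensor_eval scT incl) = UNIV"
    and tensor_kernel: "tensor_eval scT incl r = 0 \<longleftrightarrow> r \<in> tensor_relations sc emb"

definition linear_extension :: "('l::field \<Rightarrow> 't::ring_1 \<Rightarrow> 't) \<Rightarrow> ('h \<Rightarrow> 't) \<Rightarrow>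
    ('h \<Rightarrow> 'h) \<Rightarrow> ('t \<Rightarrow> 't) \<Rightarrow> bool" where
  "linear_extension scT incl f g \<longleftrightarrow>
     Vector_Spaces.linear scT scT g \<and> (\<forall>x. g (incl x) = incl (f x))"

section \<open>Matrix groups\<close>

definition sym_elems :: "('a \<Rightarrow> 'a) \<Rightarrow> 'a set" where
  "sym_elems star = {x. star x = x}"

definition SL_star :: "('a::ring_1 \<Rightarrow> 'a) \<Rightarrow> ('a^2^2) set" where
  "SL_star star = {M. M$1$1 * star (M$1$2) \<in> sym_elems star \<and>
     M$2$1 * star (M$2$2) \<in> sym_elems star \<and>
     M$1$1 * star (M$2$2) - M$1$2 * star (M$2$1) = 1}"

definition SL_star_over :: "('a::ring_1 \<Rightarrow> 'a) \<Rightarrow> 'a set \<Rightarrow> ('a^2^2) set" where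
  "SL_star_over star R = SL_star star \<inter> {M. \<forall>i j. M$i$j \<in> R}"

definition SL2 :: "('k::field^2^2) set" where
  "SL2 = {M. det M = 1}"

definition conj_set :: "'a::ring_1^2^2 \<Rightarrow> ('a^2^2) set \<Rightarrow> ('a^2^2) set" where
  "conj_set g S = (\<lambda>M. g ** M ** matrix_inv g) ` S"

section \<open>The standard involution and the reduced norm in coordinates\<close>

context algebra_over
begin

lemma qbasis_mult:
  assumes "quaternion_basis sc a b i j"
  shows "i * i = sc a 1" "j * j = sc b 1" "j * i = - (i * j)"
    "i * (i * j) = sc a j" "j * (i * j) = - sc b i" "i * j * i = - sc a j" "i * j * j = sc b i"
    "i * j * (i * j) = - sc (a * b) 1"
proof -
  show 1: "i * i = sc a 1" and 2: "j * j = sc b 1" and 3: "j * i = - (i * j)"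
    using assms by (auto simp: quaternion_basis_def)
  show 4: "i * (i * j) = sc a j"
    by (simp add: mult.assoc[symmetric] 1 scale_mult_left)
  have "j * (i * j) = - (i * (j * j))"
    by (simp add: mult.assoc[symmetric] 3)
  then show 5: "j * (i * j) = - sc b i"
    by (simp add: 2 scale_mult_right)
  show 6: "i * j * i = - sc a j"
    by (simp add: mult.assoc 3 4)
  show 7: "i * j * j = sc b i"
    by (simp add: mult.assoc 2 scale_mult_right)
  have "i * j * (i * j) = i * (j * (i * j))" by (simp add: mult.assoc)
  then show "i * j * (i * j) = - sc (a * b) 1"
    by (simp add: 5 scale_mult_right 1 mult.commute)
qed

lemma qcomb_conj_mult:
  assumes "quaternion_basis sc a b i j"
  shows "qcomb sc i j t u v w * qcomb sc i j t (- u) (- v) (- w) =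
    sc (t^2 - a * u^2 - b * v^2 + a * b * w^2) 1"
  unfolding qcomb_def
  by (simp add: algebra_simps scale_mult_left scale_mult_right qbasis_mult[OF assms]
      power2_eq_square scale_left_diff_distrib scale_left_distrib)


lemma qcomb_exists:
  assumes "quaternion_basis sc a b i j"
  shows "\<exists>t u v w. x = qcomb sc i j t u v w"
proof -
  have "x \<in> span {1, i, j, i * j}"
    using assms by (simp add: quaternion_basis_def)
  then obtain f where f: "x = (\<Sum>y\<in>{1, i, j, i * j}. sc (f y) y)"
    by (auto simp: span_finite)
  have "distinct [1, i, j, i * j]"
    using assms by (simp add: quaternion_basis_def)
  then have "x = qcomb sc i j (f 1) (f i) (f j) (f (i * j))"
    unfolding f qcomb_def by (auto simp: add.assoc)
  then show ?thesis by blast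
qed

lemma qcomb_eq_0:
  assumes "quaternion_basis sc a b i j" "qcomb sc i j t u v w = 0"
  shows "t = 0 \<and> u = 0 \<and> v = 0 \<and> w = 0"
proof -
  have d: "distinct [1, i, j, i * j]" and ind: "independent {1, i, j, i * j}"
    using assms(1) by (auto simp: quaternion_basis_def)
  define f where "f = (\<lambda>y. if y = 1 then t else if y = i then u else if y = j then v else w)"
  have f: "f 1 = t" "f i = u" "f j = v" "f (i * j) = w"
    using d unfolding f_def by auto
  have "(\<Sum>y\<in>{1, i, j, i * j}. sc (f y) y) = qcomb sc i j (f 1) (f i) (f j) (f (i * j))"
    unfolding qcomb_def using d by (auto simp: add.assoc)
  then have "(\<Sum>y\<in>{1, i, j, i * j}. sc (f y) y) = 0"
    by (simp add: f assms(2))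
  then have "f y = 0" if "y \<in> {1, i, j, i * j}" for y
    by (intro independentD[OF ind _ subset_refl _ that]) auto
  then show ?thesis using f by auto
qed

lemma qcomb_diff:
  "qcomb sc i j t u v w - qcomb sc i j t' u' v' w' = qcomb sc i j (t - t') (u - u') (v - v') (w - w')"
  by (simp add: qcomb_def scale_left_diff_distrib)

lemma qcomb_pure_square:
  assumes "quaternion_basis sc a b i j"
  shows "qcomb sc i j 0 u v w * qcomb sc i j 0 u v w =
    sc (a * u^2 + b * v^2 - a * b * w^2) 1"
  unfolding qcomb_def
  by (simp add: algebra_simps scale_mult_left scale_mult_right qbasis_mult[OF assms]
      power2_eq_square scale_left_diff_distrib scale_left_distrib)

lemma qcomb_scalar:
  assumes "quaternion_basis sc a b i j" "qcomb sc i j t u v w = sc c 1"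
  shows "t = c \<and> u = 0 \<and> v = 0 \<and> w = 0"
proof -
  have "qcomb sc i j (t - c) u v w = 0"
    using assms(2) by (simp add: qcomb_def scale_left_diff_distrib algebra_simps)
  from qcomb_eq_0[OF assms(1) this] show ?thesis by simp
qed

end

context quaternion_algebra
begin

lemma qcomb_conj_unique:
  assumes B: "quaternion_basis sc a b i j" and B': "quaternion_basis sc a' b' i' j'"
    and eq: "qcomb sc i j t u v w = qcomb sc i' j' t' u' v' w'"
  shows "qcomb sc i j t (- u) (- v) (- w) = qcomb sc i' j' t' (- u') (- v') (- w')"
proof -
  define p where "p = qcomb sc i j 0 u v w"
  define p' where "p' = qcomb sc i' j' 0 u' v' w'"
  define s where "s = t - t'"
  have x: "qcomb sc i j t u v w = sc t 1 + p" "qcomb sc i' j' t' u' v' w' = sc t' 1 + p'"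
    by (simp_all add: p_def p'_def qcomb_def algebra_simps)
  have y: "qcomb sc i j t (- u) (- v) (- w) = sc t 1 - p"
    "qcomb sc i' j' t' (- u') (- v') (- w') = sc t' 1 - p'"
    by (simp_all add: p_def p'_def qcomb_def algebra_simps)
  have p': "p' = sc s 1 + p"
    using eq unfolding x s_def by (simp add: scale_left_diff_distrib algebra_simps)
  obtain m m' where m: "p * p = sc m 1" and m': "p' * p' = sc m' 1"
    using qcomb_pure_square[OF B] qcomb_pure_square[OF B'] p_def p'_def by metis
  have "p' * p' = sc (s * s) 1 + (sc s p + sc s p) + p * p"
    unfolding p' by (simp add: distrib_left distrib_right scale_mult_left scale_mult_right
        scale_right_distrib add.assoc)
  also have "sc s p + sc s p = sc (2 * s) p"
    by (simp only: scale_left_distrib[symmetric] mult_2)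
  finally have "p' * p' = sc (s * s) 1 + sc (2 * s) p + p * p" .
  then have "sc (2 * s) p = sc (m' - s * s - m) 1"
    unfolding m m' by (simp add: scale_left_diff_distrib algebra_simps)
  moreover have "sc (2 * s) p = qcomb sc i j 0 (2 * s * u) (2 * s * v) (2 * s * w)"
    by (simp add: p_def qcomb_def scale_right_distrib)
  ultimately have z: "2 * s * u = 0 \<and> 2 * s * v = 0 \<and> 2 * s * w = 0"
    using qcomb_scalar[OF B] by metis
  have "s = 0"
  proof (rule ccontr)
    assume "s \<noteq> 0"
    with z have "p = 0" by (simp add: p_def qcomb_def)
    then have "qcomb sc i' j' 0 u' v' w' = sc s 1"
      using p' by (simp add: p'_def)
    from qcomb_scalar[OF B' this] \<open>s \<noteq> 0\<close> show False by simp
  qed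
  then show ?thesis using p' unfolding y s_def by simp
qed

lemma qconj_qcomb:
  assumes "quaternion_basis sc a b i j"
  shows "qconj sc (qcomb sc i j t u v w) = qcomb sc i j t (- u) (- v) (- w)"
  unfolding qconj_def using assms qcomb_conj_unique[OF _ assms]
  by (intro the_equality) (blast, metis)

lemma nrm_qcomb:
  assumes "quaternion_basis sc a b i j"
  shows "nrm sc (qcomb sc i j t u v w) = t^2 - a * u^2 - b * v^2 + a * b * w^2"
  unfolding nrm_def qconj_qcomb[OF assms] qcomb_conj_mult[OF assms]
  by (intro the_equality) (auto simp: scale_right_imp_eq)

lemma scale_nrm: "sc (nrm sc x) 1 = x * qconj sc x"
proof -
  obtain a b i j where B: "quaternion_basis sc a b i j"
    using ex_quaternion_basis by blast
  obtain t u v w where x: "x = qcomb sc i j t u v w"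
    using qcomb_exists[OF B] by blast
  show ?thesis
    unfolding x nrm_qcomb[OF B] qconj_qcomb[OF B] qcomb_conj_mult[OF B] ..
qed

end

end

theory Submission
  imports Defs "Jordan_Normal_Form.Char_Poly"
begin

text \<open>
An isomorphism of the orders gives a conjugation as follows. It extends to a \<open>K\<close>-algebra
automorphism of \<open>H\<close> commuting with the involution (\<open>star_orders_iso_extends\<close>),
which by Skolem-Noether is \<open>x \<mapsto> v x v\<^sup>-\<^sup>1\<close>. Commuting with the involution
makes \<open>v * star v\<close> equal to \<open>r * nrm v\<close> with a sign \<open>r\<close>
(\<open>star_automorphism_inner\<close>). With a square root \<open>m\<close> of \<open>nrm v\<close> in the
larger field, the diagonal matrix with entries \<open>v / m\<close> and \<open>r v / m\<close> lies in the
group and induces the automorphism up to the conjugation by \<open>diag(1, r)\<close>, which preserves all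
groups concerned (\<open>iso_imp_conjugate\<close>).

Conversely, the scalar matrices form the centralizer of \<open>SL(2,K)\<close>, so conjugation by a matrix
normalizing \<open>SL(2,K)\<close> sends \<open>x I\<close> to \<open>\<psi>(x) I\<close> for a ring
automorphism \<open>\<psi>\<close>. It commutes with the involution because the inverse of a matrix of the
group is its adjoint. For symmetric \<open>h\<close> in the first order the unipotent matrices with entry
\<open>h\<close> belong to the group, and they generate \<open>h I\<close> as a ring; hence
\<open>\<psi>\<close> maps the symmetric elements of the first order onto those of the second
(\<open>\<psi>_symmetric\<close>). As symmetric elements generate \<open>H\<close>, this yields an
automorphism of \<open>H\<close> with involution, and it remains to show that a maximal order with
involution is determined by its symmetric elements (\<open>maximal_star_order_unique\<close>), which is the
heart of the proof.

That statement is local. Let \<open>M\<close> be the localization of an order at a maximal ideal with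
uniformizer \<open>\<pi>\<close>, let \<open>\<Lambda>\<close> be the module of its symmetric elements and
\<open>L = \<Lambda> + \<pi> M\<close>. Since the skew elements form a line, any element of \<open>M\<close>
outside \<open>L\<close> generates \<open>M\<close> over \<open>L\<close>. Let \<open>M'\<close> be a second
order with the same \<open>\<Lambda>\<close>. If \<open>M = L\<close>, or if \<open>M\<close> and
\<open>M'\<close> share an element outside \<open>L\<close>, then \<open>M \<subseteq> M'\<close> by
Nakayama's lemma. Suppose that neither order contains the other. Then \<open>\<Lambda> \<Lambda> \<subseteq>
L\<close>, so \<open>\<Lambda>\<close> is commutative modulo \<open>\<pi>\<close>. A dimension count, using
that squaring is onto in the residue field when its characteristic is 2, shows that modulo
\<open>\<pi>\<close> the module \<open>\<Lambda>\<close> consists of scalars plus the set \<open>V\<close>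
of elements whose square is divisible by \<open>\<pi>\<close> (\<open>\<Lambda>_decomp\<close>), that
products of two elements of \<open>V\<close> are divisible by \<open>\<pi>\<close> (\<open>V_mult\<close>),
and that \<open>J = V + \<pi> M\<close> is a two-sided ideal. As \<open>V\<close> depends on
\<open>\<Lambda>\<close> only, the quotients of these products by \<open>\<pi>\<close> lie in both orders,
hence in \<open>L\<close>, and then \<open>J J \<subseteq> \<pi> J\<close> (\<open>J_square\<close>). Now
\<open>M + \<pi>\<^sup>-\<^sup>1 J\<close> is a strictly larger order, which descends to a larger global
order and contradicts maximality (\<open>enlargeable_not_maximal\<close>). So the localizations of two
maximal orders with the same symmetric elements are always comparable; consequently the sum of the two
orders is a ring, and both orders equal this sum.
\<close>

section \<open>Algebraic integers form a ring\<close>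

text \<open>The determinant trick: a number acting on finitely many numbers by an integer matrix is an
  eigenvalue of it, so it is a root of the monic integral characteristic polynomial.\<close>

lemma algebraic_int_eigenvalue:
  fixes x :: "'a::field_char_0"
  assumes eq: "\<And>i. i < n \<Longrightarrow> x * b i = (\<Sum>j<n. of_int (C i j) * b j)"
    and nz: "i0 < (n::nat)" "b i0 \<noteq> 0"
  shows "algebraic_int x"
proof -
  define A0 :: "int mat" where "A0 = Matrix.mat n n (\<lambda>(i, j). C i j)"
  define A :: "'a mat" where "A = map_mat of_int A0"
  have A0: "A0 \<in> carrier_mat n n" by (simp add: A0_def)
  have A: "A \<in> carrier_mat n n" by (simp add: A_def A0)
  have "eigenvector A (Matrix.vec n b) x"
    unfolding eigenvector_def
  proof (intro conjI)
    show "Matrix.vec n b \<in> carrier_vec (dim_row A)" using A by simp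
    show "Matrix.vec n b \<noteq> 0\<^sub>v (dim_row A)"
      using nz A by (metis carrier_matD(1) index_vec index_zero_vec(1))
    show "A *\<^sub>v Matrix.vec n b = x \<cdot>\<^sub>v Matrix.vec n b"
    proof (rule eq_vecI)
      fix i assume "i < dim_vec (x \<cdot>\<^sub>v Matrix.vec n b)"
      then have i: "i < n" by simp
      have "vec_index (A *\<^sub>v Matrix.vec n b) i = (\<Sum>j<n. of_int (C i j) * b j)"
        using i by (simp add: A_def A0_def scalar_prod_def lessThan_atLeast0)
      then show "vec_index (A *\<^sub>v Matrix.vec n b) i = vec_index (x \<cdot>\<^sub>v Matrix.vec n b) i"
        using i eq[OF i] by simp
    qed (use A in simp)
  qed
  then have "eigenvalue A x" unfolding eigenvalue_def by blast
  then have root: "poly (char_poly A) x = 0"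
    using eigenvalue_root_char_poly[OF A] by simp
  have cp: "char_poly A = map_poly of_int (char_poly A0)"
    unfolding A_def by (rule of_int_hom.char_poly_hom[OF A0])
  show ?thesis
    unfolding algebraic_int_altdef_ipoly
  proof (intro exI conjI)
    show "poly (map_poly of_int (char_poly A0)) x = 0" using root cp by simp
    show "lead_coeff (char_poly A0) = 1" using degree_monic_char_poly[OF A0] by simp
  qed
qed

interpretation zmod: Modules.module "\<lambda>(n::int) (x::'a::field_char_0). of_int n * x"
  by unfold_locales (simp_all add: algebra_simps)

lemma algebraic_int_stable:
  fixes x :: "'a::field_char_0"
  assumes fin: "finite B" and one: "1 \<in> B" and st: "\<And>b. b \<in> B \<Longrightarrow> x * b \<in> zmod.span B"
  shows "algebraic_int x"
proof -
  obtain b n where b: "B = b ` {i::nat. i < n}" "inj_on b {i. i < n}"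
    using finite_imp_nat_seg_image_inj_on[OF fin] by blast
  have "\<exists>C. \<forall>i<n. x * b i = (\<Sum>j<n. of_int (C i j) * b j)"
  proof -
    have "\<exists>c. x * b i = (\<Sum>j<n. of_int (c j) * b j)" if "i < n" for i
    proof -
      have "x * b i \<in> zmod.span B" using st b that by auto
      then obtain u where "x * b i = (\<Sum>v\<in>B. of_int (u v) * v)"
        unfolding zmod.span_finite[OF fin] by auto
      also have "\<dots> = (\<Sum>j<n. of_int (u (b j)) * b j)"
        unfolding b(1) lessThan_def by (rule sum.reindex_cong[OF b(2)]) auto
      finally show ?thesis by (rule exI[of _ "\<lambda>j. u (b j)"])
    qed
    then show ?thesis by metis
  qed
  then obtain C where C: "\<And>i. i < n \<Longrightarrow> x * b i = (\<Sum>j<n. of_int (C i j) * b j)" by blast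
  obtain i0 where "i0 < n" "b i0 = 1" using one b by auto
  then show ?thesis using algebraic_int_eigenvalue[OF C] by force
qed

lemma zspan_mult_left:
  fixes x :: "'a::field_char_0"
  assumes st: "\<And>b. b \<in> B \<Longrightarrow> x * b \<in> zmod.span C" and y: "y \<in> zmod.span B"
  shows "x * y \<in> zmod.span C"
  using y
proof (induction rule: zmod.span_induct_alt)
  case base then show ?case by (simp add: zmod.span_zero)
next
  case (step c b y)
  have "of_int c * (x * b) \<in> zmod.span C" using st step by (blast intro: zmod.span_scale)
  then have "of_int c * (x * b) + x * y \<in> zmod.span C" using step by (blast intro: zmod.span_add)
  then show ?case by (simp add: algebra_simps)
qed

lemma algebraic_int_power_span:
  fixes x :: "'a::field_char_0"
  assumes "algebraic_int x"
  shows "\<exists>n>0. x ^ n \<in> zmod.span ((\<lambda>i. x ^ i) ` {..<n})"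
proof -
  obtain p :: "int poly" where p: "poly (map_poly of_int p) x = 0" "lead_coeff p = 1"
    using assms unfolding algebraic_int_altdef_ipoly by blast
  define n where "n = degree p"
  have eq: "(\<Sum>i\<le>n. of_int (coeff p i) * x ^ i) = 0"
    using p(1) by (simp add: poly_altdef n_def coeff_map_poly degree_map_poly)
  have n0: "n > 0"
  proof (rule ccontr)
    assume "\<not> n > 0"
    then have "n = 0" by simp
    then show False using eq p(2) by (simp add: n_def)
  qed
  have "x ^ n = (\<Sum>i<n. of_int (- coeff p i) * x ^ i)"
    using eq p(2) by (simp add: n_def lessThan_Suc_atMost[symmetric] sum_negf eq_neg_iff_add_eq_0 add.commute)
  also have "\<dots> \<in> zmod.span ((\<lambda>i. x ^ i) ` {..<n})"
    by (intro zmod.span_sum zmod.span_scale zmod.span_base) auto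
  finally show ?thesis using n0 by blast
qed

text \<open>The products of small powers of \<open>x\<close> and \<open>y\<close> span a finitely generated
  group stable under both numbers, hence under their sum and product.\<close>

lemma algebraic_int_add_mult:
  fixes x y :: "'a::field_char_0"
  assumes x: "algebraic_int x" and y: "algebraic_int y"
  shows "algebraic_int (x + y) \<and> algebraic_int (x * y)"
proof -
  obtain n where n: "n > 0" "x ^ n \<in> zmod.span ((\<lambda>i. x ^ i) ` {..<n})"
    using algebraic_int_power_span[OF x] by blast
  obtain m where m: "m > 0" "y ^ m \<in> zmod.span ((\<lambda>i. y ^ i) ` {..<m})"
    using algebraic_int_power_span[OF y] by blast
  define B where "B = (\<lambda>(i, j). x ^ i * y ^ j) ` ({..<n} \<times> {..<m})"
  have fin: "finite B" by (simp add: B_def)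
  have one: "1 \<in> B" unfolding B_def using n m by (force intro!: image_eqI[of _ _ "(0, 0)"])
  have xB: "x * b \<in> zmod.span B" if b: "b \<in> B" for b
  proof -
    obtain i j where ij: "b = x ^ i * y ^ j" "i < n" "j < m" using b by (auto simp: B_def)
    have mem: "x ^ k * y ^ j \<in> B" if "k < n" for k
      unfolding B_def using that ij by force
    show ?thesis
    proof (cases "Suc i < n")
      case True
      then show ?thesis using mem[of "Suc i"] ij by (simp add: zmod.span_base mult.assoc)
    next
      case False
      then have "Suc i = n" using ij by simp
      then have "x * b = y ^ j * x ^ n" using ij by (auto simp: algebra_simps)
      also have "\<dots> \<in> zmod.span B"
        by (rule zspan_mult_left[OF _ n(2)]) (use mem in \<open>auto simp: mult.commute[of "y ^ j"] intro: zmod.span_base\<close>)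
      finally show ?thesis .
    qed
  qed
  have yB: "y * b \<in> zmod.span B" if b: "b \<in> B" for b
  proof -
    obtain i j where ij: "b = x ^ i * y ^ j" "i < n" "j < m" using b by (auto simp: B_def)
    have mem: "x ^ i * y ^ k \<in> B" if "k < m" for k
      unfolding B_def using that ij by force
    show ?thesis
    proof (cases "Suc j < m")
      case True
      then show ?thesis using zmod.span_base[OF mem[of "Suc j"]] ij by (simp add: mult.left_commute[of y])
    next
      case False
      then have "Suc j = m" using ij by simp
      then have "y * b = x ^ i * y ^ m" using ij by (auto simp: algebra_simps)
      also have "\<dots> \<in> zmod.span B"
        by (rule zspan_mult_left[OF _ m(2)]) (use mem in \<open>auto intro: zmod.span_base\<close>)
      finally show ?thesis .
    qed
  qed
  have "algebraic_int (x + y)"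
    by (rule algebraic_int_stable[OF fin one])
       (simp add: distrib_right zmod.span_add xB yB)
  moreover have "algebraic_int (x * y)"
    by (rule algebraic_int_stable[OF fin one])
       (simp add: mult.assoc zspan_mult_left[OF xB yB])
  ultimately show ?thesis by blast
qed

lemma algebraic_int_add: "algebraic_int x \<Longrightarrow> algebraic_int y \<Longrightarrow> algebraic_int (x + y :: 'a::field_char_0)"
  and algebraic_int_mult: "algebraic_int x \<Longrightarrow> algebraic_int y \<Longrightarrow> algebraic_int (x * y :: 'a::field_char_0)"
  using algebraic_int_add_mult by blast+

lemma algebraic_int_diff:
  "algebraic_int x \<Longrightarrow> algebraic_int y \<Longrightarrow> algebraic_int (x - y :: 'a::field_char_0)"
  using algebraic_int_add[of x "- y"] by simp

lemma algebraic_int_of_int: "algebraic_int (of_int z :: 'a::field_char_0)"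
  by (rule int_imp_algebraic_int) simp

text \<open>The intermediate values of Horner's scheme at a root of an integer polynomial, which need not be
  monic, are algebraic integers: by the relation itself, they map the group spanned by the powers of
  \<open>x\<close> below \<open>n\<close> to itself. They supply the denominators in
  \<open>valuation\<close>.\<close>

lemma algebraic_int_horner:
  fixes x :: "'a::field_char_0" and a :: "nat \<Rightarrow> int"
  assumes rel: "(\<Sum>m\<le>n. of_int (a m) * x ^ m) = 0" and i: "0 < i" "i \<le> n"
  shows "algebraic_int (\<Sum>m=i..n. of_int (a m) * x ^ (m - i))"
proof -
  define d where "d = (\<Sum>m=i..n. of_int (a m) * x ^ (m - i))"
  define B where "B = (\<lambda>j. x ^ j) ` {..<n}"
  have "d * b \<in> zmod.span B" if b: "b \<in> B" for b
  proof -
    obtain j where j: "b = x ^ j" "j < n" using b by (auto simp: B_def)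
    show ?thesis
    proof (cases "j < i")
      case True
      have "d * b = (\<Sum>m=i..n. of_int (a m) * x ^ (m - i + j))"
        unfolding d_def j sum_distrib_right by (rule sum.cong) (simp_all only: power_add mult.assoc)
      also have "\<dots> \<in> zmod.span B"
        by (intro zmod.span_sum zmod.span_scale zmod.span_base) (use True i in \<open>auto simp: B_def\<close>)
      finally show ?thesis .
    next
      case False
      have split: "{..n} = {..<i} \<union> {i..n}" using i by auto
      have "d * x ^ i = (\<Sum>m=i..n. of_int (a m) * x ^ m)"
        unfolding d_def sum_distrib_right
        by (rule sum.cong) (auto simp: mult.assoc power_add[symmetric])
      also have "\<dots> = (\<Sum>m\<le>n. of_int (a m) * x ^ m) - (\<Sum>m<i. of_int (a m) * x ^ m)"
        unfolding split by (subst sum.union_disjoint) auto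
      finally have di: "d * x ^ i = - (\<Sum>m<i. of_int (a m) * x ^ m)" using rel by simp
      have "d * b = d * x ^ i * x ^ (j - i)"
        using False by (simp add: j mult.assoc power_add[symmetric])
      also have "\<dots> = - (\<Sum>m<i. of_int (a m) * x ^ (m + (j - i)))"
        by (simp add: di sum_distrib_right power_add mult.assoc)
      also have "\<dots> \<in> zmod.span B"
        by (intro zmod.span_neg zmod.span_sum zmod.span_scale zmod.span_base)
           (use False j in \<open>auto simp: B_def\<close>)
      finally show ?thesis .
    qed
  qed
  moreover have "1 \<in> B" using i by (force simp: B_def intro: image_eqI[of _ _ 0])
  ultimately show ?thesis unfolding d_def[symmetric]
    by (intro algebraic_int_stable[of B]) (auto simp: B_def)
qed

section \<open>Maximal ideals of the ring of integers\<close>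

lemma (in vector_space) finite_relation:
  assumes fin: "finite B" and sp: "span B = UNIV"
  shows "\<exists>c. (\<exists>i\<le>card B. c i \<noteq> 0) \<and> (\<Sum>i\<le>card B. scale (c i) (f i)) = 0"
proof (cases "inj_on f {..card B}")
  case False
  then obtain i j where ij: "i \<le> card B" "j \<le> card B" "i \<noteq> j" "f i = f j"
    by (auto simp: inj_on_def)
  define c where "c = (\<lambda>k. if k = i then 1 else if k = j then - 1 else (0::'a))"
  have "(\<Sum>k\<le>card B. scale (c k) (f k)) = (\<Sum>k\<in>{i, j}. scale (c k) (f k))"
    by (rule sum.mono_neutral_right) (use ij in \<open>auto simp: c_def\<close>)
  also have "\<dots> = 0" using ij by (simp add: c_def)
  finally show ?thesis using ij by (intro exI[of _ c]) (auto simp: c_def)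
next
  case True
  have "dependent (f ` {..card B})"
  proof (rule ccontr)
    assume "independent (f ` {..card B})"
    from independent_span_bound[OF fin this] have "card (f ` {..card B}) \<le> card B"
      using sp by auto
    then show False by (simp add: card_image[OF True])
  qed
  then obtain u where u: "\<exists>v\<in>f ` {..card B}. u v \<noteq> 0"
    "(\<Sum>v\<in>f ` {..card B}. scale (u v) v) = 0"
    by (subst (asm) dependent_finite) auto
  show ?thesis
  proof (intro exI[of _ "\<lambda>i. u (f i)"] conjI)
    show "\<exists>i\<le>card B. u (f i) \<noteq> 0" using u(1) by auto
    show "(\<Sum>i\<le>card B. scale (u (f i)) (f i)) = 0"
      using u(2) by (simp add: sum.reindex[OF True] o_def)
  qed
qed

lemma common_denominator:
  assumes "finite I"
  shows "\<exists>N::int. N > 0 \<and> (\<forall>i\<in>I. \<exists>z::int. of_int N * (q i :: rat) = of_int z)"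
  using assms
proof (induction I rule: finite_induct)
  case empty
  show ?case by (intro exI[of _ 1]) auto
next
  case (insert j I)
  then obtain N where N: "N > 0" "\<And>i. i \<in> I \<Longrightarrow> \<exists>z::int. of_int N * q i = of_int z" by blast
  obtain a b where ab: "quotient_of (q j) = (a, b)" by fastforce
  then have b: "b > 0" "q j = of_int a / of_int b"
    by (simp_all add: quotient_of_denom_pos quotient_of_div)
  have "\<exists>z::int. of_int (b * N) * q i = of_int z" if i: "i \<in> insert j I" for i
  proof (cases "i = j")
    case True
    then show ?thesis using b by (intro exI[of _ "N * a"]) (simp add: field_simps)
  next
    case False
    then obtain z :: int where "of_int N * q i = of_int z" using N(2) i False by blast
    then show ?thesis by (intro exI[of _ "b * z"]) (simp add: mult.assoc)
  qed
  moreover have "b * N > 0" using N(1) b(1) by simp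
  ultimately show ?case by blast
qed

lemma integer_relation_normalize:
  fixes f :: "nat \<Rightarrow> 'a::field_char_0" and a :: "nat \<Rightarrow> int" and l :: int
  assumes l: "prime l" and rel: "(\<Sum>i\<le>n. of_int (a i) * f i) = 0" and nz: "i0 \<le> n" "a i0 \<noteq> 0"
  shows "\<exists>b. (\<Sum>i\<le>n. of_int (b i) * f i) = 0 \<and> (\<exists>i\<le>n. \<not> l dvd b i)"
  using rel nz
proof (induction "nat \<bar>a i0\<bar>" arbitrary: a rule: less_induct)
  case less
  show ?case
  proof (cases "\<exists>i\<le>n. \<not> l dvd a i")
    case True
    then show ?thesis using less.prems by blast
  next
    case False
    define b where "b i = a i div l" for i
    have b: "a i = l * b i" if "i \<le> n" for i
      using False that by (simp add: b_def)
    have l2: "l \<ge> 2" using l by (simp add: prime_ge_2_int)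
    have "of_int l * (\<Sum>i\<le>n. of_int (b i) * f i) = (\<Sum>i\<le>n. of_int (a i) * f i)"
      unfolding sum_distrib_left by (rule sum.cong) (simp_all add: b)
    then have "of_int l * (\<Sum>i\<le>n. of_int (b i) * f i) = 0" using less.prems(1) by (rule trans)
    then have rel: "(\<Sum>i\<le>n. of_int (b i) * f i) = 0" using l2 by simp
    have b0: "b i0 \<noteq> 0" using b[OF less.prems(2)] less.prems(3) by auto
    have "\<bar>a i0\<bar> = l * \<bar>b i0\<bar>" unfolding b[OF less.prems(2)] using l2 by (simp add: abs_mult)
    moreover have "l * \<bar>b i0\<bar> \<ge> 2 * \<bar>b i0\<bar>" using l2 by (intro mult_right_mono) auto
    ultimately have "nat \<bar>b i0\<bar> < nat \<bar>a i0\<bar>" using b0 by linarith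
    then show ?thesis using less.hyps[OF _ rel less.prems(2) b0] by blast
  qed
qed

text \<open>Linear dependence over the rationals, cleared of denominators and of common factors
  \<open>l\<close>. The bound \<open>n\<close> is uniform in \<open>f\<close> and \<open>l\<close>. Applied
  to powers it gives the valuation property of localizations, and applied to arbitrary algebraic integers it
  gives finiteness of residue rings.\<close>

lemma number_field_relation:
  assumes "number_field TYPE('k::field_char_0)"
  shows "\<exists>n. \<forall>(f :: nat \<Rightarrow> 'k) l. prime l \<longrightarrow>
    (\<exists>a::nat \<Rightarrow> int. (\<Sum>i\<le>n. of_int (a i) * f i) = 0 \<and> (\<exists>i\<le>n. \<not> l dvd a i))"
proof -
  interpret V: vector_space "\<lambda>(q::rat) (x::'k). of_rat q * x"
    by unfold_locales (simp_all add: algebra_simps of_rat_add of_rat_mult)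
  obtain B :: "'k set" where B: "finite B" "V.span B = UNIV"
    using assms unfolding number_field_def by blast
  have "\<exists>a::nat \<Rightarrow> int. (\<Sum>i\<le>card B. of_int (a i) * f i) = 0 \<and> (\<exists>i\<le>card B. \<not> l dvd a i)"
    if l: "prime l" for f :: "nat \<Rightarrow> 'k" and l
  proof -
    obtain c where c: "\<exists>i\<le>card B. c i \<noteq> 0" "(\<Sum>i\<le>card B. of_rat (c i) * f i) = 0"
      using V.finite_relation[OF B] by blast
    obtain N :: int where N: "N > 0" "\<forall>i\<in>{..card B}. \<exists>z::int. of_int N * c i = of_int z"
      using common_denominator[of "{..card B}" c] by blast
    then obtain z :: "nat \<Rightarrow> int" where z: "\<And>i. i \<le> card B \<Longrightarrow> of_int N * c i = of_int (z i)"
      by (metis atMost_iff)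
    have "of_int (z i) = of_int N * (of_rat (c i) :: 'k)" if "i \<le> card B" for i
      using z[OF that] by (metis of_rat_mult of_rat_of_int_eq)
    then have "(\<Sum>i\<le>card B. of_int (z i) * f i) = of_int N * (\<Sum>i\<le>card B. of_rat (c i) * f i)"
      by (simp add: sum_distrib_left mult.assoc)
    then have rel: "(\<Sum>i\<le>card B. of_int (z i) * f i) = 0" using c by simp
    obtain i0 where "i0 \<le> card B" "c i0 \<noteq> 0" using c by blast
    then have "z i0 \<noteq> 0" using z[of i0] N(1) by auto
    then show ?thesis using integer_relation_normalize[OF l rel \<open>i0 \<le> card B\<close>] by blast
  qed
  then show ?thesis by blast
qed

definition int_ideal :: "'k::field_char_0 set \<Rightarrow> bool" where
  "int_ideal I \<longleftrightarrow> I \<subseteq> Collect algebraic_int \<and> 0 \<in> I \<and> (\<forall>a\<in>I. \<forall>b\<in>I. a + b \<in> I) \<and>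
     (\<forall>r a. algebraic_int r \<longrightarrow> a \<in> I \<longrightarrow> r * a \<in> I)"

definition max_ideal :: "'k::field_char_0 set \<Rightarrow> bool" where
  "max_ideal P \<longleftrightarrow> int_ideal P \<and> 1 \<notin> P \<and> (\<forall>a. algebraic_int a \<longrightarrow> a \<notin> P \<longrightarrow>
     (\<exists>b. algebraic_int b \<and> 1 - a * b \<in> P))"

lemma ex_max_ideal:
  fixes I :: "'k::field_char_0 set"
  assumes I: "int_ideal I" "1 \<notin> I"
  shows "\<exists>P. max_ideal P \<and> I \<subseteq> P"
proof -
  define F where "F = {J. int_ideal J \<and> 1 \<notin> J \<and> I \<subseteq> J}"
  have "\<exists>P\<in>F. \<forall>J\<in>F. P \<subseteq> J \<longrightarrow> J = P"
  proof (rule subset_Zorn_nonempty)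
    show "F \<noteq> {}" using I by (auto simp: F_def)
    fix C assume C: "C \<noteq> {}" "subset.chain F C"
    have CF: "\<And>J. J \<in> C \<Longrightarrow> J \<in> F" and tot: "\<And>J J'. J \<in> C \<Longrightarrow> J' \<in> C \<Longrightarrow> J \<subseteq> J' \<or> J' \<subseteq> J"
      using C(2) by (auto simp: subset_chain_def)
    have id: "int_ideal J" "1 \<notin> J" "I \<subseteq> J" if "J \<in> C" for J
      using CF[OF that] by (simp_all add: F_def)
    obtain J0 where J0: "J0 \<in> C" using C(1) by blast
    have "int_ideal (\<Union>C)"
      unfolding int_ideal_def
    proof (intro conjI ballI allI impI)
      show "\<Union>C \<subseteq> Collect algebraic_int" using id(1) unfolding int_ideal_def by blast
      show "0 \<in> \<Union>C" using id(1)[OF J0] J0 unfolding int_ideal_def by blast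
    next
      fix r a :: 'k assume "algebraic_int r" "a \<in> \<Union>C"
      then show "r * a \<in> \<Union>C" using id(1) unfolding int_ideal_def by blast
    next
      fix a b assume "a \<in> \<Union>C" "b \<in> \<Union>C"
      then obtain J J' where J: "a \<in> J" "b \<in> J'" "J \<in> C" "J' \<in> C" by blast
      then obtain J'' where "a \<in> J''" "b \<in> J''" "J'' \<in> C" using tot[OF J(3,4)] by blast
      then show "a + b \<in> \<Union>C" using id(1)[of J''] unfolding int_ideal_def by blast
    qed
    moreover have "1 \<notin> \<Union>C" "I \<subseteq> \<Union>C" using id(2,3) J0 by blast+
    ultimately show "\<Union>C \<in> F" unfolding F_def by simp
  qed
  then obtain P where P: "int_ideal P" "1 \<notin> P" "I \<subseteq> P" and max: "\<And>J. J \<in> F \<Longrightarrow> P \<subseteq> J \<Longrightarrow> J = P"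
    by (auto simp: F_def)
  have "\<exists>b. algebraic_int b \<and> 1 - a * b \<in> P" if a: "algebraic_int a" "a \<notin> P" for a
  proof -
    define J where "J = {x. \<exists>q b. x = q + a * b \<and> q \<in> P \<and> algebraic_int b}"
    have JI: "x \<in> J" if "x = q + a * b" "q \<in> P" "algebraic_int b" for x q b
      unfolding J_def using that by blast
    have JE: "\<exists>q b. x = q + a * b \<and> q \<in> P \<and> algebraic_int b" if "x \<in> J" for x
      using that unfolding J_def by blast
    have Pi: "q \<in> P \<Longrightarrow> algebraic_int q" "0 \<in> P" "q \<in> P \<Longrightarrow> q' \<in> P \<Longrightarrow> q + q' \<in> P"
      "algebraic_int r \<Longrightarrow> q \<in> P \<Longrightarrow> r * q \<in> P" for q q' r
      using P(1) unfolding int_ideal_def by auto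
    have id: "int_ideal J"
      unfolding int_ideal_def
    proof (intro conjI ballI allI impI subsetI)
      fix x assume "x \<in> J"
      then obtain q b where x: "x = q + a * b" "q \<in> P" "algebraic_int b" using JE by blast
      then have "algebraic_int x" using Pi(1) a(1) by (simp add: algebraic_int_add algebraic_int_mult)
      then show "x \<in> Collect algebraic_int" by simp
    next
      show "0 \<in> J" by (rule JI[of _ 0 0]) (simp_all add: Pi)
    next
      fix x y assume "x \<in> J" "y \<in> J"
      then obtain q b q' b' where x: "x = q + a * b" "q \<in> P" "algebraic_int b"
        and y: "y = q' + a * b'" "q' \<in> P" "algebraic_int b'" using JE by meson
      show "x + y \<in> J"
        by (rule JI[of _ "q + q'" "b + b'"]) (simp_all add: x y Pi algebraic_int_add algebra_simps)
    next
      fix r x :: 'k assume r: "algebraic_int r" and "x \<in> J"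
      then obtain q b where x: "x = q + a * b" "q \<in> P" "algebraic_int b" using JE by blast
      show "r * x \<in> J"
        by (rule JI[of _ "r * q" "r * b"]) (simp_all add: x r Pi(4) algebraic_int_mult distrib_left mult.left_commute)
    qed
    have "P \<subseteq> J"
    proof
      fix q assume "q \<in> P"
      then show "q \<in> J" by (intro JI[of _ q 0]) simp_all
    qed
    moreover have "a \<in> J" by (rule JI[of _ 0 1]) (simp_all add: Pi)
    ultimately have "J \<noteq> P" "I \<subseteq> J" "P \<subseteq> J" using a P(3) by auto
    then have "1 \<in> J" using max[of J] id unfolding F_def by blast
    then obtain q b where b: "1 = q + a * b" "q \<in> P" "algebraic_int b" using JE by blast
    have "1 - a * b = q" unfolding b(1) by simp
    then have "algebraic_int b" "1 - a * b \<in> P" using b by simp_all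
    then show ?thesis by blast
  qed
  then have "max_ideal P" unfolding max_ideal_def using P by simp
  then show ?thesis using P(3) by blast
qed

locale number_field_prime =
  fixes P :: "'k::field_char_0 set"
  assumes nf: "number_field TYPE('k)" and mx: "max_ideal P"
begin

lemma ideal: "int_ideal P"
  using mx by (simp add: max_ideal_def)

lemma P_int: "a \<in> P \<Longrightarrow> algebraic_int a"
  using ideal by (auto simp: int_ideal_def)

lemma P_0: "0 \<in> P"
  using ideal by (simp add: int_ideal_def)

lemma P_1: "1 \<notin> P"
  using mx by (simp add: max_ideal_def)

lemma P_add: "a \<in> P \<Longrightarrow> b \<in> P \<Longrightarrow> a + b \<in> P"
  using ideal by (simp add: int_ideal_def)

lemma P_mult: "algebraic_int r \<Longrightarrow> a \<in> P \<Longrightarrow> r * a \<in> P"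
  using ideal by (simp add: int_ideal_def)

lemma P_inverse: "algebraic_int a \<Longrightarrow> a \<notin> P \<Longrightarrow> \<exists>b. algebraic_int b \<and> 1 - a * b \<in> P"
  using mx by (simp add: max_ideal_def)

lemma P_diff: "a \<in> P \<Longrightarrow> b \<in> P \<Longrightarrow> a - b \<in> P"
  using P_add[of a "- b"] P_mult[of "-1" b] by simp

lemma P_prime:
  assumes "algebraic_int a" "algebraic_int b" "a * b \<in> P"
  shows "a \<in> P \<or> b \<in> P"
proof (rule ccontr)
  assume notin: "\<not> ?thesis"
  then obtain c where c: "algebraic_int c" "1 - a * c \<in> P" using P_inverse[of a] assms(1) by auto
  have "b * (1 - a * c) + c * (a * b) \<in> P"
    by (intro P_add P_mult assms c)
  also have "b * (1 - a * c) + c * (a * b) = b" by (simp add: algebra_simps)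
  finally have "b \<in> P" .
  then show False using notin by blast
qed

lemma P_nonzero: "\<exists>a\<in>P. a \<noteq> 0"
proof (rule ccontr)
  assume zero: "\<not> ?thesis"
  then have "2 \<notin> P" by (metis zero_neq_numeral)
  then obtain b :: 'k where b: "algebraic_int b" "1 - 2 * b \<in> P" using P_inverse[of 2] by auto
  then have b1: "1 - 2 * b = 0" using zero by blast
  then have "b = 1 / 2" by (simp add: field_simps)
  then have b2: "b = of_rat (1 / 2)" by (simp add: of_rat_divide)
  then have "b \<in> \<rat>" by simp
  then have "b \<in> \<int>" using b(1) rational_algebraic_int_is_int by blast
  then obtain z where "b = of_int z" by (auto simp: Ints_def)
  then have "(of_int (2 * z) :: 'k) = of_int 1" using b1 by simp
  then have "2 * z = 1" by (simp only: of_int_eq_iff)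
  then show False by presburger
qed

lemma ex_integer: "\<exists>z::int. z \<noteq> 0 \<and> of_int z \<in> P"
proof -
  obtain a where a: "a \<in> P" "a \<noteq> 0" using P_nonzero by blast
  obtain p :: "int poly" where p: "poly (map_poly of_int p) a = 0" "p \<noteq> 0"
    using P_int[OF a(1)] unfolding algebraic_int_altdef_ipoly by force
  have "\<exists>z::int. z \<noteq> 0 \<and> of_int z \<in> P"
    if "poly (map_poly of_int p) a = 0" "p \<noteq> 0" for p :: "int poly"
    using that
  proof (induction p rule: pCons_induct)
    case 0 then show ?case by simp
  next
    case (pCons c p)
    have eq: "of_int c + a * poly (map_poly of_int p) a = 0"
      using pCons.prems by (simp add: map_poly_pCons)
    show ?case
    proof (cases "c = 0")
      case True
      then show ?thesis using eq a pCons by auto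
    next
      case False
      have "algebraic_int (poly (map_poly of_int p) a)"
        using P_int[OF a(1)]
        by (induction p) (auto simp: map_poly_pCons int_imp_algebraic_int intro!: algebraic_int_add algebraic_int_mult)
      then have "- poly (map_poly of_int p) a * a \<in> P"
        using a(1) by (intro P_mult) auto
      also have "- poly (map_poly of_int p) a * a = of_int c"
        using eq by (simp only: eq_neg_iff_add_eq_0[symmetric] mult_minus_left mult.commute[of a])
      finally show ?thesis using False by blast
    qed
  qed
  then show ?thesis using p by blast
qed

text \<open>The integers in a maximal ideal form a prime ideal, which is nonzero since the ideal contains a
  nonzero algebraic integer and hence the constant term of its equation.\<close>

lemma ex_prime: "\<exists>l::int. prime l \<and> (\<forall>z. of_int z \<in> P \<longleftrightarrow> l dvd z)"
proof -
  obtain z :: int where z: "z \<noteq> 0" "of_int z \<in> P" using ex_integer by blast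
  have "\<exists>l. prime l \<and> of_int l \<in> P"
    using z
  proof (induction z rule: prime_divisors_induct)
    case zero then show ?case by simp
  next
    case (unit x)
    then have "x = 1 \<or> x = -1" by (simp, arith)
    then have "of_int x = (1::'k) \<or> of_int x = (-1::'k)" by force
    moreover have "-1 \<notin> P" using P_mult[of "-1" "-1"] P_1 by auto
    ultimately show ?case using unit(3) P_1 by metis
  next
    case (factor p x)
    then have "of_int p * of_int x \<in> P" by simp
    then have "of_int p \<in> P \<or> of_int x \<in> P"
      by (rule P_prime[rotated 2]) (simp_all add: int_imp_algebraic_int)
    then show ?case
    proof
      assume "of_int p \<in> P"
      then show ?thesis using factor.hyps by blast
    next
      assume "of_int x \<in> P"
      then show ?thesis using factor.IH factor.prems by simp
    qed
  qed
  then obtain l where l: "prime l" "of_int l \<in> P" by blast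
  have "of_int z \<in> P \<longleftrightarrow> l dvd z" for z
  proof
    assume "l dvd z"
    then obtain k where "z = l * k" by (rule dvdE)
    then show "of_int z \<in> P" using l(2) P_mult[of "of_int k" "of_int l"]
      by (simp add: int_imp_algebraic_int mult.commute)
  next
    assume z: "of_int z \<in> P"
    show "l dvd z"
    proof (rule ccontr)
      assume "\<not> l dvd z"
      then have "coprime l z" using l(1) by (simp add: prime_imp_coprime)
      then obtain u v where uv: "u * l + v * z = 1"
        using bezout_int[of l z] by (auto simp: coprime_iff_gcd_eq_1)
      have "of_int u * of_int l + of_int v * of_int z \<in> P"
        by (intro P_add P_mult l z int_imp_algebraic_int) auto
      also have "of_int u * of_int l + of_int v * of_int z = (of_int (u * l + v * z) :: 'k)" by simp
      finally show False using P_1 uv by simp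
    qed
  qed
  then show ?thesis using l by (intro exI[of _ l]) simp
qed

text \<open>Localizations of the ring of integers are valuation rings. Let \<open>d i\<close> be the Horner
  values for an integer relation among the powers of \<open>x\<close> with some coefficient \<open>a
  i0\<close> outside \<open>P\<close>. Both \<open>d (Suc i0)\<close> and \<open>x * d (Suc i0)\<close> are
  integral. If one of them is outside \<open>P\<close> it serves as the denominator \<open>s\<close>; if
  not, then \<open>d i0\<close> is outside \<open>P\<close> by the recursion \<open>d i0 = a i0 + x * d (Suc
  i0)\<close>, and \<open>x * d i0\<close> is integral as well.\<close>

lemma valuation:
  "\<exists>s. algebraic_int s \<and> s \<notin> P \<and> (algebraic_int (s * x) \<or> algebraic_int (s / x))"
proof -
  obtain l :: int where l: "prime l" "\<forall>z. of_int z \<in> P \<longleftrightarrow> l dvd z" using ex_prime by (elim exE conjE)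
  obtain n where n: "\<forall>(f :: nat \<Rightarrow> 'k) l. prime l \<longrightarrow>
    (\<exists>a::nat \<Rightarrow> int. (\<Sum>i\<le>n. of_int (a i) * f i) = 0 \<and> (\<exists>i\<le>n. \<not> l dvd a i))"
    using number_field_relation[OF nf] by (elim exE)
  obtain a i0 where a: "(\<Sum>i\<le>n. of_int (a i) * x ^ i) = 0" "i0 \<le> n" "\<not> l dvd a i0"
    using n[rule_format, OF l(1), of "\<lambda>i. x ^ i"] by (elim exE conjE)
  define d where "d i = (\<Sum>m=i..n. of_int (a m) * x ^ (m - i))" for i
  have d0: "d 0 = 0" using a(1) by (simp add: d_def atLeast0AtMost)
  have d_int: "algebraic_int (d i)" for i
  proof -
    consider "i = 0" | "0 < i \<and> i \<le> n" | "i > n" by linarith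
    then show ?thesis
    proof cases
      case 1 then show ?thesis by (simp add: d0)
    next
      case 2 then show ?thesis unfolding d_def using algebraic_int_horner[OF a(1)] by blast
    next
      case 3 then show ?thesis by (simp add: d_def)
    qed
  qed
  have rec: "d i = of_int (a i) + x * d (Suc i)" if "i \<le> n" for i
  proof -
    have "d i = of_int (a i) + (\<Sum>m=Suc i..n. of_int (a m) * x ^ (m - i))"
      unfolding d_def using that by (subst sum.atLeast_Suc_atMost) auto
    also have "(\<Sum>m=Suc i..n. of_int (a m) * x ^ (m - i)) = x * d (Suc i)"
      unfolding d_def sum_distrib_left
    proof (rule sum.cong[OF refl])
      fix m assume "m \<in> {Suc i..n}"
      then have "m - i = Suc (m - Suc i)" by auto
      then show "of_int (a m) * x ^ (m - i) = x * (of_int (a m) * x ^ (m - Suc i))" by simp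
    qed
    finally show ?thesis .
  qed
  have xd: "algebraic_int (x * d (Suc i))" if "i \<le> n" for i
  proof -
    have "x * d (Suc i) = d i - of_int (a i)" using rec[OF that] by simp
    then show ?thesis using d_int by (simp add: algebraic_int_diff int_imp_algebraic_int)
  qed
  have a0: "of_int (a i0) \<notin> P" using a l by simp
  consider "d (Suc i0) \<notin> P" | "x * d (Suc i0) \<notin> P" | "d (Suc i0) \<in> P" "x * d (Suc i0) \<in> P" by blast
  then show ?thesis
  proof cases
    case 1
    then show ?thesis using d_int xd[OF a(2)] by (metis mult.commute)
  next
    case 2
    then have "x \<noteq> 0" using P_0 by auto
    then show ?thesis using 2 d_int[of "Suc i0"] xd[OF a(2)]
      by (intro exI[of _ "x * d (Suc i0)"]) auto
  next
    case 3
    then have dP: "d i0 \<notin> P" using rec[OF a(2)] a0 P_diff[of "d i0" "x * d (Suc i0)"] by auto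
    then obtain j where j: "i0 = Suc j" using d0 P_0 by (cases i0) auto
    then show ?thesis using xd[of j] a(2) dP d_int by (metis Suc_leD mult.commute)
  qed
qed

end

section \<open>Finiteness of the residue rings\<close>

text \<open>A set of algebraic integers that is linearly independent modulo \<open>l\<close> has bounded size by
  \<open>number_field_relation\<close>. A largest one generates the ring of integers modulo
  \<open>l\<close>, and its coefficients matter only modulo \<open>l\<close>.\<close>

lemma finite_int_quotient:
  assumes nf: "number_field TYPE('k::field_char_0)" and l: "prime (l::int)"
  shows "\<exists>F::'k set. finite F \<and> F \<subseteq> Collect algebraic_int \<and>
    (\<forall>x. algebraic_int x \<longrightarrow> (\<exists>y\<in>F. \<exists>z. algebraic_int z \<and> x = y + of_int l * z))"
proof -
  define indep where "indep E \<longleftrightarrow> finite E \<and> E \<subseteq> Collect algebraic_int \<and>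
    (\<forall>a::'k \<Rightarrow> int. (\<exists>z. algebraic_int z \<and> (\<Sum>e\<in>E. of_int (a e) * e) = of_int l * z) \<longrightarrow>
       (\<forall>e\<in>E. l dvd a e))" for E :: "'k set"
  obtain n where n: "\<forall>(f :: nat \<Rightarrow> 'k) l. prime l \<longrightarrow>
    (\<exists>a::nat \<Rightarrow> int. (\<Sum>i\<le>n. of_int (a i) * f i) = 0 \<and> (\<exists>i\<le>n. \<not> l dvd a i))"
    using number_field_relation[OF nf] by (elim exE)
  have bound: "card E \<le> n" if E: "indep E" for E
  proof (rule ccontr)
    assume "\<not> card E \<le> n"
    then obtain E' where E': "E' \<subseteq> E" "card E' = Suc n"
      by (metis not_less_eq_eq obtain_subset_with_card_n)
    have fin: "finite E" "finite E'" using E E' by (auto simp: indep_def intro: finite_subset)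
    then obtain f where f: "bij_betw f {..<Suc n} E'"
      using E'(2) by (metis bij_betw_from_nat_into_finite card_eq_0_iff ex_bij_betw_nat_finite lessThan_atLeast0)
    obtain a i0 where a: "(\<Sum>i\<le>n. of_int (a i) * f i) = 0" "i0 \<le> n" "\<not> l dvd a i0"
      using n[rule_format, OF l, of f] by (elim exE conjE)
    define g where "g = the_inv_into {..<Suc n} f"
    have g: "g (f i) = i" if "i \<le> n" for i
      unfolding g_def using f that by (intro the_inv_into_f_f) (auto simp: bij_betw_def)
    define b where "b e = (if e \<in> E' then a (g e) else 0)" for e
    have fE: "f i \<in> E'" if "i \<le> n" for i using f that by (auto simp: bij_betw_def)
    have "(\<Sum>e\<in>E. of_int (b e) * e) = (\<Sum>e\<in>E'. of_int (b e) * e)"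
      by (rule sum.mono_neutral_right) (use fin E' in \<open>auto simp: b_def\<close>)
    also have "\<dots> = (\<Sum>i<Suc n. of_int (b (f i)) * f i)"
      by (rule sum.reindex_bij_betw[OF f, symmetric])
    also have "\<dots> = (\<Sum>i\<le>n. of_int (a i) * f i)"
      unfolding lessThan_Suc_atMost by (rule sum.cong) (auto simp: b_def fE g)
    finally have "(\<Sum>e\<in>E. of_int (b e) * e) = of_int l * 0" using a(1) by simp
    then have "\<forall>e\<in>E. l dvd b e" using E algebraic_int_0 unfolding indep_def by metis
    then have "l dvd b (f i0)" using fE[OF a(2)] E'(1) by blast
    then show False using a by (simp add: b_def fE g)
  qed
  have "indep {}" by (simp add: indep_def)
  then obtain E where E: "indep E" and max: "\<And>E'. indep E' \<Longrightarrow> card E' \<le> card E"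
    using bound ex_has_greatest_nat[of indep "{}" card "Suc n"] by (metis less_Suc_eq_le)
  have finE: "finite E" and Eint: "\<And>e. e \<in> E \<Longrightarrow> algebraic_int e" using E by (auto simp: indep_def)
  have int_sum: "algebraic_int (\<Sum>e\<in>E. of_int (c e) * e)" for c :: "'k \<Rightarrow> int"
    using finE Eint by (induction E rule: finite_induct)
      (auto intro!: algebraic_int_add algebraic_int_mult algebraic_int_of_int)
  have gen: "\<exists>c::'k \<Rightarrow> int. \<exists>z. algebraic_int z \<and> x = (\<Sum>e\<in>E. of_int (c e) * e) + of_int l * z"
    if x: "algebraic_int x" for x
  proof (cases "x \<in> E")
    case True
    have "(\<Sum>e\<in>E. of_int (if e = x then 1 else 0) * e) = x"
      using True finE by (simp add: if_distrib[of "\<lambda>c. c * _"] if_distrib[of of_int] cong: if_cong)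
    then show ?thesis
      by (intro exI[of _ "\<lambda>e. if e = x then 1 else 0"] exI[of _ 0]) simp
  next
    case False
    have "\<not> indep (insert x E)" using max[of "insert x E"] False finE by auto
    then obtain a z where az: "algebraic_int z" "(\<Sum>e\<in>insert x E. of_int (a e) * e) = of_int l * z"
      "\<exists>e\<in>insert x E. \<not> l dvd a e"
      using finE Eint x unfolding indep_def by auto
    have eq: "of_int (a x) * x + (\<Sum>e\<in>E. of_int (a e) * e) = of_int l * z"
      using az(2) finE False by simp
    have "\<not> l dvd a x"
    proof
      assume "l dvd a x"
      then obtain k where k: "a x = l * k" by (rule dvdE)
      have "(\<Sum>e\<in>E. of_int (a e) * e) = of_int l * (z - of_int k * x)"
        using eq by (simp add: k algebra_simps)
      moreover have "algebraic_int (z - of_int k * x)"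
        using az x by (intro algebraic_int_diff algebraic_int_mult algebraic_int_of_int) auto
      ultimately have "\<forall>e\<in>E. l dvd a e" using E unfolding indep_def by blast
      then show False using az(3) \<open>l dvd a x\<close> by blast
    qed
    then have "coprime (a x) l" using l by (simp add: prime_imp_coprime coprime_commute)
    then obtain u v where uv: "u * a x + v * l = 1"
      using bezout_int[of "a x" l] by (auto simp: coprime_iff_gcd_eq_1)
    have "x = of_int (u * a x + v * l) * x" unfolding uv by simp
    also have "\<dots> = of_int u * (of_int (a x) * x) + of_int (v * l) * x"
      by (simp add: algebra_simps)
    also have "of_int (a x) * x = of_int l * z - (\<Sum>e\<in>E. of_int (a e) * e)"
      using eq by (simp only: eq_diff_eq)
    also have "of_int u * (of_int l * z - (\<Sum>e\<in>E. of_int (a e) * e)) + of_int (v * l) * x = (\<Sum>e\<in>E. of_int (- u * a e) * e) + of_int l * (of_int u * z + of_int v * x)"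
      by (simp add: algebra_simps sum_distrib_left sum_negf)
    finally show ?thesis using az(1) x
      by (intro exI[of _ "\<lambda>e. - u * a e"] exI[of _ "of_int u * z + of_int v * x"] conjI)
         (assumption | auto intro!: algebraic_int_add algebraic_int_mult algebraic_int_of_int)
  qed
  define F where "F = (\<lambda>c. \<Sum>e\<in>E. of_int (c e) * e) ` (E \<rightarrow>\<^sub>E {0..<l})"
  show ?thesis
  proof (intro exI[of _ F] conjI allI impI)
    show "finite F" unfolding F_def by (intro finite_imageI finite_PiE finE) auto
    show "F \<subseteq> Collect algebraic_int" unfolding F_def using int_sum by auto
    fix x :: 'k assume "algebraic_int x"
    then obtain c z where cz: "algebraic_int z" "x = (\<Sum>e\<in>E. of_int (c e) * e) + of_int l * z"
      using gen by blast
    define y where "y = (\<Sum>e\<in>E. of_int (restrict (\<lambda>e. c e mod l) E e) * e)"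
    have l0: "l > 0" using l by (simp add: prime_gt_0_int)
    have "y \<in> F" unfolding y_def F_def by (rule imageI) (use l0 in auto)
    moreover have "(\<Sum>e\<in>E. of_int (c e) * e) = y + of_int l * (\<Sum>e\<in>E. of_int (c e div l) * e)"
    proof -
      have "(\<Sum>e\<in>E. of_int (c e) * e) = (\<Sum>e\<in>E. of_int (c e mod l + l * (c e div l)) * e)" by simp
      also have "\<dots> = y + of_int l * (\<Sum>e\<in>E. of_int (c e div l) * e)"
        unfolding y_def sum_distrib_left sum.distrib[symmetric]
        by (rule sum.cong[OF refl], simp only: of_int_add of_int_mult, simp add: algebra_simps del: mod_mult_div_eq mult_div_mod_eq)
      finally show ?thesis .
    qed
    then have "x = y + of_int l * ((\<Sum>e\<in>E. of_int (c e div l) * e) + z)"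
      using cz(2) by (simp add: algebra_simps)
    moreover have "algebraic_int ((\<Sum>e\<in>E. of_int (c e div l) * e) + z)"
      by (intro algebraic_int_add int_sum cz)
    ultimately show "\<exists>y\<in>F. \<exists>z. algebraic_int z \<and> x = y + of_int l * z" by blast
  qed
qed

section \<open>Localization at a maximal ideal\<close>

definition subring_set :: "'k::comm_ring_1 set \<Rightarrow> bool" where
  "subring_set A \<longleftrightarrow> 1 \<in> A \<and> (\<forall>x\<in>A. \<forall>y\<in>A. x - y \<in> A \<and> x * y \<in> A)"

lemma subring_setD:
  assumes "subring_set A"
  shows "1 \<in> A" "0 \<in> A" "x \<in> A \<Longrightarrow> y \<in> A \<Longrightarrow> x - y \<in> A" "x \<in> A \<Longrightarrow> y \<in> A \<Longrightarrow> x * y \<in> A"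
    "x \<in> A \<Longrightarrow> - x \<in> A" "x \<in> A \<Longrightarrow> y \<in> A \<Longrightarrow> x + y \<in> A"
proof -
  show 1: "1 \<in> A" and m: "\<And>x y. x \<in> A \<Longrightarrow> y \<in> A \<Longrightarrow> x * y \<in> A"
    and d: "\<And>x y. x \<in> A \<Longrightarrow> y \<in> A \<Longrightarrow> x - y \<in> A"
    using assms by (auto simp: subring_set_def)
  show 0: "0 \<in> A" using d[OF 1 1] by simp
  show n: "- x \<in> A" if "x \<in> A" for x using d[OF 0 that] by simp
  show "x \<in> A \<Longrightarrow> y \<in> A \<Longrightarrow> x + y \<in> A" using d[OF _ n[of y], of x] by simp
qed

lemma subring_algebraic_int: "subring_set (Collect algebraic_int :: 'k::field_char_0 set)"
  by (simp add: subring_set_def algebraic_int_diff algebraic_int_mult)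

lemma ex_minimal_valuation:
  fixes A :: "'k::field set"
  assumes A: "subring_set A" and val: "\<And>x. x \<in> A \<or> inverse x \<in> A"
    and "finite G" "G \<noteq> {}" "0 \<notin> G"
  shows "\<exists>p\<in>G. \<forall>g\<in>G. g / p \<in> A"
  using assms(3-5)
proof (induction G rule: finite_ne_induct)
  case (singleton x)
  then show ?case by (simp add: subring_setD[OF A])
next
  case (insert x G)
  then obtain p where p: "p \<in> G" "\<And>g. g \<in> G \<Longrightarrow> g / p \<in> A" by auto
  have nz: "x \<noteq> 0" "p \<noteq> 0" using insert.prems p by auto
  show ?case
  proof (cases "x / p \<in> A")
    case True
    then show ?thesis using p by auto
  next
    case False
    then have px: "p / x \<in> A" using val[of "x / p"] by simp
    have "g / x \<in> A" if "g \<in> G" for g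
      using subring_setD(4)[OF A p(2)[OF that] px] nz by simp
    then show ?thesis using nz subring_setD(1)[OF A] by auto
  qed
qed

text \<open>What is used of the localization of the ring of integers at a maximal ideal: it is a valuation ring
  whose nonunits are the multiples of \<open>\<pi>\<close>, and if its residue field has characteristic 2
  then every residue is a square.\<close>

locale local_ring =
  fixes A :: "'k::field_char_0 set" and \<pi> :: 'k
  assumes A_ring: "subring_set A"
    and pi_A: "\<pi> \<in> A" and pi_nz: "\<pi> \<noteq> 0" and pi_nonunit: "1 / \<pi> \<notin> A"
    and unit_or: "x \<in> A \<Longrightarrow> x / \<pi> \<notin> A \<Longrightarrow> inverse x \<in> A"
    and A_val: "x \<in> A \<or> inverse x \<in> A"
    and A_sqrt: "2 / \<pi> \<in> A \<Longrightarrow> a \<in> A \<Longrightarrow> \<exists>b\<in>A. (a - b * b) / \<pi> \<in> A"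

context number_field_prime
begin

definition A :: "'k set" where
  "A = {x. \<exists>s. algebraic_int s \<and> s \<notin> P \<and> algebraic_int (s * x)}"

lemma AI: "algebraic_int s \<Longrightarrow> s \<notin> P \<Longrightarrow> algebraic_int (s * x) \<Longrightarrow> x \<in> A"
  unfolding A_def by blast

lemma AE:
  assumes "x \<in> A"
  obtains s where "algebraic_int s" "s \<notin> P" "algebraic_int (s * x)"
  using assms unfolding A_def by blast

lemma notP_mult: "algebraic_int a \<Longrightarrow> algebraic_int b \<Longrightarrow> a \<notin> P \<Longrightarrow> b \<notin> P \<Longrightarrow> a * b \<notin> P"
  using P_prime by blast

lemma A_int: "algebraic_int x \<Longrightarrow> x \<in> A"
  using AI[of 1 x] P_1 by simp

lemma A_subring: "subring_set A"
  unfolding subring_set_def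
proof (intro conjI ballI)
  show "1 \<in> A" by (simp add: A_int)
  fix x y assume "x \<in> A" "y \<in> A"
  then obtain s t where s: "algebraic_int s" "s \<notin> P" "algebraic_int (s * x)"
    and t: "algebraic_int t" "t \<notin> P" "algebraic_int (t * y)" by (meson AE)
  have st: "algebraic_int (s * t)" "s * t \<notin> P" using s t by (simp_all add: algebraic_int_mult notP_mult)
  have "s * t * (x - y) = t * (s * x) - s * (t * y)" by (simp add: algebra_simps)
  then show "x - y \<in> A"
    using AI[OF st, of "x - y"] s t by (simp add: algebraic_int_diff algebraic_int_mult)
  have eq: "s * t * (x * y) = (s * x) * (t * y)" by (simp add: algebra_simps)
  show "x * y \<in> A"
    by (rule AI[OF st]) (unfold eq, intro algebraic_int_mult s t)
qed

lemmas A_closed = subring_setD[OF A_subring]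

lemma inverse_A:
  assumes "algebraic_int s" "s \<notin> P"
  shows "inverse s \<in> A"
proof -
  have "s \<noteq> 0" using assms P_0 by auto
  then show ?thesis using AI[OF assms, of "inverse s"] by simp
qed

lemma A_valuation: "x \<in> A \<or> inverse x \<in> A"
  using valuation[of x] AI by (auto simp: divide_inverse)

lemma A_common_denominator:
  assumes "finite S" "S \<subseteq> A"
  shows "\<exists>s. algebraic_int s \<and> s \<notin> P \<and> (\<forall>x\<in>S. algebraic_int (s * x))"
  using assms
proof (induction S rule: finite_induct)
  case empty
  show ?case using P_1 by (intro exI[of _ 1]) simp
next
  case (insert x S)
  obtain s where s: "algebraic_int s" "s \<notin> P" "\<forall>x\<in>S. algebraic_int (s * x)"
    using insert by auto
  obtain t where t: "algebraic_int t" "t \<notin> P" "algebraic_int (t * x)"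
    using insert.prems by (auto elim: AE)
  have "algebraic_int (s * t * y)" if "y \<in> insert x S" for y
  proof (cases "y = x")
    case True
    then show ?thesis using s t by (simp add: mult.assoc algebraic_int_mult)
  next
    case False
    then have "algebraic_int (t * (s * y))" using s(3) t that by (simp add: algebraic_int_mult)
    then show ?thesis by (simp add: ac_simps)
  qed
  then show ?case using s t by (intro exI[of _ "s * t"]) (simp add: algebraic_int_mult notP_mult)
qed

text \<open>The ideal is generated by \<open>l\<close> and finitely many representatives modulo
  \<open>l\<close>. The generator of least valuation divides the others in the localization, and
  \<open>s\<close> is a common denominator of the quotients. The fraction \<open>s / p\<close> will play the
  role of an element of the inverse ideal that is not integral.\<close>

lemma ex_uniformizer:
  "\<exists>p s. p \<in> P \<and> p \<noteq> 0 \<and> algebraic_int s \<and> s \<notin> P \<and> (\<forall>q\<in>P. algebraic_int (s * q / p))"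
proof -
  obtain l :: int where l: "prime l" "\<forall>z. of_int z \<in> P \<longleftrightarrow> l dvd z"
    using ex_prime by (elim exE conjE)
  obtain F :: "'k set" where F: "finite F" "F \<subseteq> Collect algebraic_int"
    "\<forall>x. algebraic_int x \<longrightarrow> (\<exists>y\<in>F. \<exists>z. algebraic_int z \<and> x = y + of_int l * z)"
    using finite_int_quotient[OF nf l(1)] by (elim exE conjE)
  have lP: "of_int l \<in> P" using l(2) by simp
  have l0: "(of_int l :: 'k) \<noteq> 0" using l(1) by auto
  define G where "G = insert (of_int l) (F \<inter> P) - {0}"
  have "\<exists>p\<in>G. \<forall>g\<in>G. g / p \<in> A"
    by (rule ex_minimal_valuation[OF A_subring A_valuation]) (use F(1) l0 in \<open>auto simp: G_def\<close>)
  then obtain p where p: "p \<in> G" "\<forall>g\<in>G. g / p \<in> A" by blast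
  have "\<exists>s. algebraic_int s \<and> s \<notin> P \<and> (\<forall>x\<in>(\<lambda>g. g / p) ` G. algebraic_int (s * x))"
    by (rule A_common_denominator) (use F(1) p in \<open>auto simp: G_def\<close>)
  then obtain s where s: "algebraic_int s" "s \<notin> P" "\<forall>x\<in>(\<lambda>g. g / p) ` G. algebraic_int (s * x)"
    by (elim exE conjE)
  have sg: "algebraic_int (s * g / p)" if "g \<in> insert (of_int l) (F \<inter> P)" for g
    using s(3) that by (cases "g = 0") (auto simp: G_def)
  have "algebraic_int (s * q / p)" if q: "q \<in> P" for q
  proof -
    obtain y z where yz: "y \<in> F" "algebraic_int z" "q = y + of_int l * z"
      using F(3) P_int[OF q] by auto
    have "y = q - z * of_int l" using yz(3) by (simp add: mult.commute)
    also have "\<dots> \<in> P" by (intro P_diff P_mult q yz lP)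
    finally have "algebraic_int (s * y / p + s * of_int l / p * z)"
      by (intro algebraic_int_add algebraic_int_mult sg yz) (use yz(1) in auto)
    also have "s * y / p + s * of_int l / p * z = s * q / p"
      unfolding yz(3) by (simp add: algebra_simps add_divide_distrib)
    finally show ?thesis .
  qed
  moreover have "p \<in> P" "p \<noteq> 0" using p(1) lP by (auto simp: G_def)
  ultimately show ?thesis using s(1,2) by blast
qed

text \<open>Frobenius is injective since \<open>(x - y)\<^sup>2\<close> and \<open>x\<^sup>2 - y\<^sup>2\<close>
  differ by a multiple of 2.\<close>

lemma frobenius_inj:
  assumes two: "2 \<in> P" and int: "algebraic_int x" "algebraic_int y" and eq: "x ^ 2 ^ i - y ^ 2 ^ i \<in> P"
  shows "x - y \<in> P"
  using int eq
proof (induction i arbitrary: x y)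
  case 0
  then show ?case by simp
next
  case (Suc i)
  have int2: "algebraic_int (x\<^sup>2)" "algebraic_int (y\<^sup>2)"
    using Suc.prems by (simp_all add: power2_eq_square algebraic_int_mult)
  have "x\<^sup>2 - y\<^sup>2 \<in> P"
    by (rule Suc.IH[OF int2]) (use Suc.prems(3) in \<open>simp add: power_mult[symmetric]\<close>)
  moreover have "y * (x - y) * 2 \<in> P"
    by (intro P_mult two algebraic_int_mult algebraic_int_diff Suc.prems)
  ultimately have "x\<^sup>2 - y\<^sup>2 - y * (x - y) * 2 \<in> P" by (rule P_diff)
  also have "x\<^sup>2 - y\<^sup>2 - y * (x - y) * 2 = (x - y) * (x - y)"
    by (simp add: power2_eq_square algebra_simps)
  finally show ?case using P_prime[of "x - y" "x - y"] Suc.prems by (auto simp: algebraic_int_diff)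
qed

lemma algebraic_int_power: "algebraic_int x \<Longrightarrow> algebraic_int (x ^ n :: 'k)"
  by (induction n) (simp_all add: algebraic_int_mult)

text \<open>Two of the iterated squares \<open>a ^ 2 ^ n\<close> agree in the finite residue field, so
  injectivity of Frobenius makes \<open>a\<close> itself an iterated square.\<close>

lemma sqrt_mod_P:
  assumes two: "2 \<in> P" and a: "algebraic_int a"
  shows "\<exists>b. algebraic_int b \<and> a - b * b \<in> P"
proof -
  obtain l :: int where l: "prime l" "\<forall>z. of_int z \<in> P \<longleftrightarrow> l dvd z"
    using ex_prime by (elim exE conjE)
  obtain F :: "'k set" where F: "finite F" "F \<subseteq> Collect algebraic_int"
    "\<forall>x. algebraic_int x \<longrightarrow> (\<exists>y\<in>F. \<exists>z. algebraic_int z \<and> x = y + of_int l * z)"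
    using finite_int_quotient[OF nf l(1)] by (elim exE conjE)
  have lP: "of_int l \<in> P" using l(2) by simp
  have "\<exists>y\<in>F. x - y \<in> P" if x: "algebraic_int x" for x
  proof -
    obtain y z where yz: "y \<in> F" "algebraic_int z" "x = y + of_int l * z"
      using F(3) x by auto
    then have "x - y = z * of_int l" by (simp add: mult.commute)
    also have "\<dots> \<in> P" using yz lP by (intro P_mult)
    finally show ?thesis using yz(1) by blast
  qed
  then have "\<forall>n. \<exists>y\<in>F. a ^ 2 ^ n - y \<in> P" using a by (simp add: algebraic_int_power)
  then obtain r where r: "\<And>n. r n \<in> F" "\<And>n. a ^ 2 ^ n - r n \<in> P" by metis
  have "\<not> inj r"
    using F(1) r(1) by (meson finite_subset image_subsetI infinite_UNIV_nat finite_imageD)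
  then obtain i j where ij: "i \<noteq> j" "r i = r j" by (auto simp: inj_on_def)
  obtain i j where ij: "i < j" "r i = r j"
    using ij by (metis linorder_neqE_nat)
  have "a ^ 2 ^ i - a ^ 2 ^ j \<in> P"
    using P_diff[OF r(2)[of i] r(2)[of j]] ij(2) by simp
  moreover have "a ^ 2 ^ j = (a ^ 2 ^ (j - i)) ^ 2 ^ i"
    using ij(1) by (simp add: power_mult[symmetric] power_add[symmetric])
  ultimately have eq: "a - a ^ 2 ^ (j - i) \<in> P"
    using frobenius_inj[OF two a, of "a ^ 2 ^ (j - i)" i] a by (simp add: algebraic_int_power)
  obtain k where k: "j - i = Suc k" using ij(1) by (metis Suc_diff_Suc)
  have "a ^ 2 ^ (j - i) = a ^ 2 ^ k * a ^ 2 ^ k"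
    unfolding k by (simp add: power_add[symmetric] mult_2)
  then show ?thesis using eq a by (metis algebraic_int_power)
qed

lemma local_ring:
  assumes p: "p \<in> P" "p \<noteq> 0" and s: "algebraic_int s" "s \<notin> P" "\<forall>q\<in>P. algebraic_int (s * q / p)"
  shows "local_ring A p"
proof
  show "subring_set A" by (rule A_subring)
  show "p \<in> A" by (rule A_int[OF P_int[OF p(1)]])
  show "p \<noteq> 0" by fact
  show nonunit: "1 / p \<notin> A"
  proof
    assume "1 / p \<in> A"
    then obtain t where t: "algebraic_int t" "t \<notin> P" "algebraic_int (t * (1 / p))" by (rule AE)
    have "t * (1 / p) * p \<in> P" using t p by (intro P_mult)
    then show False using t p by simp
  qed
  have qp: "q / p \<in> A" if "q \<in> P" for q
    using AI[OF s(1,2), of "q / p"] s(3) that by simp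
  show "inverse x \<in> A" if x: "x \<in> A" "x / p \<notin> A" for x
  proof -
    obtain t where t: "algebraic_int t" "t \<notin> P" "algebraic_int (t * x)" using x(1) by (rule AE)
    have t0: "t \<noteq> 0" using t P_0 by auto
    have "t * x \<notin> P"
    proof
      assume "t * x \<in> P"
      then have "inverse t * (t * x / p) \<in> A" by (intro A_closed inverse_A t qp)
      moreover have "inverse t * (t * x / p) = x / p" using t0 by (simp add: mult.assoc[symmetric])
      ultimately show False using x(2) by (simp only:)
    qed
    moreover from this have "x \<noteq> 0" using P_0 by auto
    ultimately show ?thesis using AI[OF t(3), of "inverse x"] t(1) by (simp add: mult.assoc)
  qed
  show "x \<in> A \<or> inverse x \<in> A" for x by (rule A_valuation)
  show "\<exists>b\<in>A. (a - b * b) / p \<in> A" if two: "2 / p \<in> A" and a: "a \<in> A" for a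
  proof -
    have "2 \<in> P"
    proof (rule ccontr)
      assume "2 \<notin> P"
      then have "inverse 2 \<in> A" by (intro inverse_A) simp_all
      then have "inverse 2 * (2 / p) \<in> A" using two by (intro A_closed)
      then show False using nonunit by simp
    qed
    obtain t where t: "algebraic_int t" "t \<notin> P" "algebraic_int (t * a)" using a by (rule AE)
    have t0: "t \<noteq> 0" using t P_0 by auto
    obtain u where u: "algebraic_int u" "1 - t * u \<in> P" using P_inverse[OF t(1,2)] by (elim exE conjE)
    obtain b where b: "algebraic_int b" "t * a * u - b * b \<in> P"
      using sqrt_mod_P[OF \<open>2 \<in> P\<close>, of "t * a * u"] t u by (auto simp: algebraic_int_mult)
    have "a * ((1 - t * u) / p) + (t * a * u - b * b) / p \<in> A"
      by (intro A_closed a qp u b)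
    also have "a * ((1 - t * u) / p) + (t * a * u - b * b) / p = (a - b * b) / p"
      by (simp add: add_divide_distrib[symmetric] algebra_simps)
    finally show ?thesis using A_int[OF b(1)] by blast
  qed
qed

end

section \<open>Finitely generated modules and Nakayama's lemma\<close>

text \<open>For the algebraic integers of \<open>K\<close> as \<open>A\<close> this is \<open>ok_span\<close>;
  the other use is with a localization as \<open>A\<close>.\<close>

definition mspan :: "('k::field \<Rightarrow> 'h::ring_1 \<Rightarrow> 'h) \<Rightarrow> 'k set \<Rightarrow> 'h set \<Rightarrow> 'h set" where
  "mspan sc A B = {\<Sum>x\<in>B. sc (c x) x | c. \<forall>x\<in>B. c x \<in> A}"

definition submod :: "('k::field \<Rightarrow> 'h::ring_1 \<Rightarrow> 'h) \<Rightarrow> 'k set \<Rightarrow> 'h set \<Rightarrow> bool" where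
  "submod sc A M \<longleftrightarrow> 0 \<in> M \<and> (\<forall>x\<in>M. \<forall>y\<in>M. x + y \<in> M) \<and> (\<forall>a\<in>A. \<forall>x\<in>M. sc a x \<in> M)"

lemma ok_span_mspan: "ok_span sc B = mspan sc (Collect algebraic_int) B"
  by (simp add: ok_span_def mspan_def)

lemma submodD:
  assumes "submod sc A M"
  shows "0 \<in> M" "x \<in> M \<Longrightarrow> y \<in> M \<Longrightarrow> x + y \<in> M" "a \<in> A \<Longrightarrow> x \<in> M \<Longrightarrow> sc a x \<in> M"
  using assms by (simp_all add: submod_def)

context algebra_over
begin

lemma submod_sum:
  assumes "submod sc A M" "\<And>x. x \<in> B \<Longrightarrow> f x \<in> M"
  shows "(\<Sum>x\<in>B. f x) \<in> M"
  using assms(2)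
  by (induction B rule: infinite_finite_induct) (simp_all add: submodD[OF assms(1)])

lemma submod_diff:
  assumes "subring_set A" "submod sc A M" "x \<in> M" "y \<in> M"
  shows "x - y \<in> M"
proof -
  have "sc (- 1) y \<in> M" using assms subring_setD[OF assms(1)] by (intro submodD(3)[OF assms(2)])
  then have "x + sc (- 1) y \<in> M" using assms by (intro submodD(2)[OF assms(2)])
  then show ?thesis by simp
qed

lemma mspan_submod:
  assumes "subring_set A"
  shows "submod sc A (mspan sc A B)"
  unfolding submod_def
proof (intro conjI ballI)
  note [simp] = subring_setD[OF assms]
  have "0 = (\<Sum>x\<in>B. sc 0 x)" by simp
  then show "0 \<in> mspan sc A B" unfolding mspan_def by fastforce
  fix x assume "x \<in> mspan sc A B"
  then obtain c where c: "x = (\<Sum>b\<in>B. sc (c b) b)" "\<forall>b\<in>B. c b \<in> A" by (auto simp: mspan_def)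
  {
    fix y assume "y \<in> mspan sc A B"
    then obtain d where d: "y = (\<Sum>b\<in>B. sc (d b) b)" "\<forall>b\<in>B. d b \<in> A" by (auto simp: mspan_def)
    have "x + y = (\<Sum>b\<in>B. sc (c b + d b) b)"
      by (simp add: c d scale_left_distrib sum.distrib)
    moreover have "\<forall>b\<in>B. c b + d b \<in> A" using c d by simp
    ultimately show "x + y \<in> mspan sc A B"
      unfolding mspan_def by (intro CollectI exI[of _ "\<lambda>b. c b + d b"] conjI)
  }
  fix a assume "a \<in> A"
  then have "sc a x = (\<Sum>b\<in>B. sc (a * c b) b)" "\<forall>b\<in>B. a * c b \<in> A"
    using c by (simp_all add: scale_sum_right)
  then show "sc a x \<in> mspan sc A B"
    unfolding mspan_def by (intro CollectI exI[of _ "\<lambda>b. a * c b"] conjI)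
qed

lemma mspan_base:
  assumes "subring_set A" "finite B" "b \<in> B"
  shows "b \<in> mspan sc A B"
proof -
  have "b = (\<Sum>x\<in>B. sc (if x = b then 1 else 0) x)"
    using assms(2,3) by (simp add: if_distrib[of "\<lambda>c. sc c _"] cong: if_cong)
  moreover have "\<forall>x\<in>B. (if x = b then 1 else 0) \<in> A"
    using subring_setD(1,2)[OF assms(1)] by simp
  ultimately show ?thesis
    unfolding mspan_def by (intro CollectI exI[of _ "\<lambda>x. if x = b then 1 else 0"] conjI)
qed

lemma mspan_minimal:
  assumes "submod sc A M" "B \<subseteq> M"
  shows "mspan sc A B \<subseteq> M"
proof
  fix x assume "x \<in> mspan sc A B"
  then obtain c where c: "x = (\<Sum>b\<in>B. sc (c b) b)" "\<forall>b\<in>B. c b \<in> A" by (auto simp: mspan_def)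
  show "x \<in> M" unfolding c(1)
    using assms c(2) by (intro submod_sum[OF assms(1)] submodD(3)[OF assms(1)]) auto
qed

lemma mspan_insertE:
  assumes "x \<in> mspan sc A (insert b B)" "finite B" "b \<notin> B"
  obtains a y where "a \<in> A" "y \<in> mspan sc A B" "x = sc a b + y"
proof -
  obtain c where c: "x = (\<Sum>v\<in>insert b B. sc (c v) v)" "\<forall>v\<in>insert b B. c v \<in> A"
    using assms(1) by (auto simp: mspan_def)
  have "x = sc (c b) b + (\<Sum>v\<in>B. sc (c v) v)" using c(1) assms by simp
  moreover have "(\<Sum>v\<in>B. sc (c v) v) \<in> mspan sc A B"
    unfolding mspan_def using c(2) by (intro CollectI exI[of _ c]) simp
  ultimately show ?thesis using that c(2) by blast
qed

lemma mspan_subset_span: "mspan sc A B \<subseteq> span B"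
  proof
  fix x assume "x \<in> mspan sc A B"
  then obtain c where "x = (\<Sum>b\<in>B. sc (c b) b)" by (auto simp: mspan_def)
  then show "x \<in> span B" by (simp add: span_sum span_scale span_base)
qed

end

locale local_algebra = local_ring A \<pi> + algebra_over sc
  for A :: "'k::field_char_0 set" and \<pi> :: 'k and sc :: "'k \<Rightarrow> 'h::ring_1 \<Rightarrow> 'h"
begin

lemmas A_closed = subring_setD[OF A_ring]

text \<open>Induction on the number of generators: the relation for \<open>b\<close> has the unit coefficient
  \<open>1 - \<pi> c\<close> at \<open>b\<close>, so \<open>b\<close> can be eliminated from the relations
  for the other generators.\<close>

lemma nakayama:
  assumes "finite B" and N: "submod sc A N"
    and "\<And>b. b \<in> B \<Longrightarrow> \<exists>m\<in>mspan sc A B. b - sc \<pi> m \<in> N"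
  shows "B \<subseteq> N"
  using assms(1,3)
proof (induction B rule: finite_induct)
  case empty
  then show ?case by simp
next
  case (insert b B)
  have SB: "submod sc A (mspan sc A B)" by (rule mspan_submod[OF A_ring])
  obtain m where m: "m \<in> mspan sc A (insert b B)" "b - sc \<pi> m \<in> N" using insert.prems by blast
  obtain c m' where c: "c \<in> A" "m' \<in> mspan sc A B" "m = sc c b + m'"
    using mspan_insertE[OF m(1) insert.hyps(1,2)] by blast
  define u where "u = 1 - \<pi> * c"
  have uA: "u \<in> A" unfolding u_def by (intro A_closed c pi_A)
  have u0: "u \<noteq> 0"
  proof
    assume "u = 0"
    then have "1 / \<pi> = c" using pi_nz by (simp add: u_def field_simps)
    then show False using c(1) pi_nonunit by simp
  qed
  have "u / \<pi> \<notin> A"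
  proof
    assume "u / \<pi> \<in> A"
    then have "u / \<pi> + c \<in> A" by (intro A_closed c)
    moreover have "u / \<pi> + c = 1 / \<pi>" using pi_nz by (simp add: u_def field_simps)
    ultimately show False using pi_nonunit by simp
  qed
  then have iu: "inverse u \<in> A" using unit_or uA by blast
  define n where "n = b - sc \<pi> m"
  have "sc u b = n + sc \<pi> m'"
    by (simp add: u_def n_def c(3) scale_left_diff_distrib scale_right_distrib)
  then have "sc (inverse u) (sc u b) = sc (inverse u) (n + sc \<pi> m')" by simp
  then have b: "b = sc (inverse u) n + sc \<pi> (sc (inverse u) m')"
    using u0 by (simp add: scale_right_distrib mult.commute)
  have n: "n \<in> N" using m by (simp add: n_def)
  have "B \<subseteq> N"
  proof (rule insert.IH)
    fix b' assume "b' \<in> B"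
    then obtain m2 where m2: "m2 \<in> mspan sc A (insert b B)" "b' - sc \<pi> m2 \<in> N"
      using insert.prems by blast
    obtain d m3 where d: "d \<in> A" "m3 \<in> mspan sc A B" "m2 = sc d b + m3"
      using mspan_insertE[OF m2(1) insert.hyps(1,2)] by blast
    define m4 where "m4 = sc (\<pi> * d * inverse u) m' + m3"
    have "m4 \<in> mspan sc A B"
      unfolding m4_def by (intro submodD[OF SB] A_closed pi_A d iu c)
    moreover have "b' - sc \<pi> m4 \<in> N"
    proof -
      have "sc \<pi> (sc d b) = sc (\<pi> * d * inverse u) n + sc \<pi> (sc (\<pi> * d * inverse u) m')"
        using arg_cong[OF b, of "\<lambda>x. sc \<pi> (sc d x)"]
        by (simp add: scale_right_distrib mult.commute mult.left_commute mult.assoc)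
      then have "b' - sc \<pi> m4 = (b' - sc \<pi> m2) + sc (\<pi> * d * inverse u) n"
        unfolding d(3) m4_def by (simp only: scale_right_distrib) simp
      also have "\<dots> \<in> N" by (intro submodD[OF N] A_closed pi_A d iu n m2)
      finally show ?thesis .
    qed
    ultimately show "\<exists>m\<in>mspan sc A B. b' - sc \<pi> m \<in> N" by blast
  qed
  then have "m' \<in> N" using mspan_minimal[OF N] c by blast
  then have "sc (inverse u) n + sc \<pi> (sc (inverse u) m') \<in> N"
    by (intro submodD[OF N] iu n pi_A)
  then have "b \<in> N" using b by simp
  then show ?case using \<open>B \<subseteq> N\<close> by simp
qed

end

section \<open>Orders over a local ring\<close>

text \<open>The consequences of being a quaternion algebra with orthogonal involution on which the local theory
  rests: every element is quadratic with additive trace, skew elements form a space of dimension at most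
  one, and the dimension is exactly four.\<close>

locale involution_algebra = algebra_over sc
  for sc :: "'k::field_char_0 \<Rightarrow> 'h::ring_1 \<Rightarrow> 'h" +
  fixes star :: "'h \<Rightarrow> 'h" and \<tau> \<nu> :: "'h \<Rightarrow> 'k"
  assumes star_add: "star (x + y) = star x + star y"
    and star_scale: "star (sc c x) = sc c (star x)"
    and star_mult: "star (x * y) = star y * star x"
    and star_star: "star (star x) = x"
    and quadratic: "x * x = sc (\<tau> x) x - sc (\<nu> x) 1"
    and trace_add: "\<tau> (x + y) = \<tau> x + \<tau> y"
    and skew_rank: "\<exists>c d. (c \<noteq> 0 \<or> d \<noteq> 0) \<and> sc c (x - star x) + sc d (y - star y) = 0"
    and dim_le_4: "\<exists>a b c d e. (a \<noteq> 0 \<or> b \<noteq> 0 \<or> c \<noteq> 0 \<or> d \<noteq> 0 \<or> e \<noteq> 0) \<and>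
      sc a x1 + sc b x2 + sc c x3 + sc d x4 + sc e x5 = 0"
    and dim_ge_4: "finite C \<Longrightarrow> card C \<le> 3 \<Longrightarrow> span C \<noteq> UNIV"
begin

lemma star_1: "star 1 = 1"
  by (metis mult.right_neutral star_mult star_star mult_1_left)

lemma star_0: "star 0 = 0"
  using star_add[of 0 0] by simp

lemma star_minus: "star (- x) = - star x"
  using star_add[of x "- x"] by (simp add: star_0 eq_neg_iff_add_eq_0 add.commute)

lemma star_diff: "star (x - y) = star x - star y"
  using star_add[of x "- y"] by (simp add: star_minus)

end

locale local_star_order = local_algebra A \<pi> sc + involution_algebra sc star \<tau> \<nu>
  for A :: "'k::field_char_0 set" and \<pi> :: 'k and sc :: "'k \<Rightarrow> 'h::ring_1 \<Rightarrow> 'h"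
    and star :: "'h \<Rightarrow> 'h" and \<tau> \<nu> :: "'h \<Rightarrow> 'k" +
  fixes M :: "'h set"
  assumes M_1: "1 \<in> M" and M_mult: "x \<in> M \<Longrightarrow> y \<in> M \<Longrightarrow> x * y \<in> M"
    and M_star: "x \<in> M \<Longrightarrow> star x \<in> M"
    and M_fg: "\<exists>B. finite B \<and> M = mspan sc A B" and M_span: "span M = UNIV"
begin

lemma M_submod: "submod sc A M"
  using M_fg mspan_submod[OF A_ring] by auto

lemmas M_closed = submodD[OF M_submod] submod_diff[OF A_ring M_submod] M_1 M_mult M_star

text \<open>Congruences modulo \<open>\<pi> M\<close> are expressed by \<open>dv\<close> of a difference,
  avoiding the quotient algebra over the residue field.\<close>

definition dv :: "'h \<Rightarrow> bool" where "dv z \<longleftrightarrow> sc (1 / \<pi>) z \<in> M"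

lemma dv_0: "dv 0" by (simp add: dv_def M_closed)

lemma dv_add: "dv x \<Longrightarrow> dv y \<Longrightarrow> dv (x + y)"
  by (simp add: dv_def scale_right_distrib M_closed)

lemma dv_diff: "dv x \<Longrightarrow> dv y \<Longrightarrow> dv (x - y)"
  by (simp add: dv_def scale_right_diff_distrib M_closed)

lemma dv_minus: "dv x \<Longrightarrow> dv (- x)"
  using dv_diff[OF dv_0] by simp

lemma dv_scale: "a \<in> A \<Longrightarrow> dv x \<Longrightarrow> dv (sc a x)"
  unfolding dv_def by (subst scale_left_commute) (rule M_closed)

lemma dv_pi: "x \<in> M \<Longrightarrow> dv (sc \<pi> x)"
  by (simp add: dv_def pi_nz)

lemma dv_coeff: "a / \<pi> \<in> A \<Longrightarrow> x \<in> M \<Longrightarrow> dv (sc a x)"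
  unfolding dv_def by (simp add: M_closed(3))

lemma dv_mult_left: "x \<in> M \<Longrightarrow> dv y \<Longrightarrow> dv (x * y)"
  by (simp add: dv_def M_mult flip: scale_mult_right)

lemma dv_mult_right: "dv x \<Longrightarrow> y \<in> M \<Longrightarrow> dv (x * y)"
  by (simp add: dv_def M_mult flip: scale_mult_left)

lemma dv_star: "dv x \<Longrightarrow> dv (star x)"
  by (simp add: dv_def M_star flip: star_scale)

lemma dv_imp_M: "dv x \<Longrightarrow> x \<in> M"
proof -
  assume "dv x"
  then have "sc \<pi> (sc (1 / \<pi>) x) \<in> M" unfolding dv_def by (rule M_closed(3)[OF pi_A])
  then show ?thesis using pi_nz by simp
qed

text \<open>Inclusions between local orders need to be checked modulo \<open>\<pi>\<close> only.\<close>

lemma nakayama_M: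
  assumes N: "submod sc A N" and "\<And>x. x \<in> M \<Longrightarrow> \<exists>n\<in>N. dv (x - n)"
  shows "M \<subseteq> N"
proof -
  obtain B where B: "finite B" "M = mspan sc A B" using M_fg by blast
  have "B \<subseteq> N"
  proof (rule nakayama[OF B(1) N])
    fix b assume "b \<in> B"
    then have "b \<in> M" using mspan_base[OF A_ring B(1)] B(2) by simp
    then obtain n where n: "n \<in> N" "dv (b - n)" using assms(2) by blast
    have eq: "b - sc \<pi> (sc (1 / \<pi>) (b - n)) = n" using pi_nz by simp
    have "sc (1 / \<pi>) (b - n) \<in> M" using n(2) by (simp only: dv_def)
    then have "sc (1 / \<pi>) (b - n) \<in> mspan sc A B" using B(2) by blast
    then show "\<exists>m\<in>mspan sc A B. b - sc \<pi> m \<in> N"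
      by (rule bexI[rotated]) (simp only: eq n(1))
  qed
  then show ?thesis using mspan_minimal[OF N] B(2) by simp
qed

lemma not_dv_1: "\<not> dv 1"
proof
  assume d: "dv 1"
  have "submod sc A {0}" by (simp add: submod_def)
  then have "M \<subseteq> {0}"
    using dv_mult_left[OF _ d] by (intro nakayama_M) auto
  then show False using M_1 by auto
qed

lemma dv_unit_cancel:
  assumes "a \<in> A" "dv (sc a x)" "\<not> dv x"
  shows "a / \<pi> \<in> A"
proof (rule ccontr)
  assume n: "a / \<pi> \<notin> A"
  have "dv (sc (inverse a) (sc a x))" by (rule dv_scale[OF unit_or[OF assms(1) n] assms(2)])
  moreover have "a \<noteq> 0" using n A_closed(2) by auto
  ultimately show False using assms(3) by simp
qed

text \<open>The algebra \<open>M / \<pi> M\<close> needs at least four generators as a vector space, since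
  generators modulo \<open>\<pi>\<close> span \<open>H\<close> by Nakayama's lemma. This dimension count
  yields \<open>ex_independent\<close> and \<open>J_not_divisible\<close>.\<close>

lemma generators_span:
  assumes C: "finite C" "C \<subseteq> M" and gen: "\<And>x. x \<in> M \<Longrightarrow> \<exists>y\<in>mspan sc A C. dv (x - y)"
  shows "card C > 3"
proof -
  have "M \<subseteq> mspan sc A C"
    by (rule nakayama_M[OF mspan_submod[OF A_ring] gen])
  then have "M \<subseteq> span C" using mspan_subset_span by blast
  then have "span M \<subseteq> span C" by (metis span_mono span_span)
  then have "span C = UNIV" using M_span by auto
  then show ?thesis using dim_ge_4[OF C(1)] by force
qed

text \<open>Five elements are linearly dependent over the field; dividing by the coefficient of least valuation
  gives a relation that is nontrivial modulo the uniformizer.\<close>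

lemma normalized_relation:
  "\<exists>a b c d e. {a, b, c, d, e} \<subseteq> A \<and> 1 \<in> {a, b, c, d, e} \<and>
     sc a x1 + sc b x2 + sc c x3 + sc d x4 + sc e x5 = 0"
proof -
  obtain a b c d e where r: "a \<noteq> 0 \<or> b \<noteq> 0 \<or> c \<noteq> 0 \<or> d \<noteq> 0 \<or> e \<noteq> 0"
    "sc a x1 + sc b x2 + sc c x3 + sc d x4 + sc e x5 = 0"
    using dim_le_4 by meson
  define G where "G = {a, b, c, d, e} - {0}"
  have "\<exists>p\<in>G. \<forall>g\<in>G. g / p \<in> A"
    by (rule ex_minimal_valuation[OF A_ring A_val]) (use r in \<open>auto simp: G_def\<close>)
  then obtain p where p: "p \<in> G" "\<forall>g\<in>G. g / p \<in> A" by blast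
  have p0: "p \<noteq> 0" using p(1) by (simp add: G_def)
  have gA: "g / p \<in> A" if "g \<in> {a, b, c, d, e}" for g
    using p(2) that A_closed(2) by (cases "g = 0") (auto simp: G_def)
  have "sc (1 / p) (sc a x1 + sc b x2 + sc c x3 + sc d x4 + sc e x5) = 0" using r by simp
  then have "sc (a / p) x1 + sc (b / p) x2 + sc (c / p) x3 + sc (d / p) x4 + sc (e / p) x5 = 0"
    by (simp add: scale_right_distrib)
  moreover have "p = a \<or> p = b \<or> p = c \<or> p = d \<or> p = e" using p(1) by (simp add: G_def)
  then have "1 \<in> {a / p, b / p, c / p, d / p, e / p}" using p0 by auto
  ultimately show ?thesis using gA
    by (intro exI[of _ "a / p"] exI[of _ "b / p"] exI[of _ "c / p"] exI[of _ "d / p"] exI[of _ "e / p"] conjI)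
       simp_all
qed

definition \<Lambda> :: "'h set" where "\<Lambda> = {x \<in> M. star x = x}"

lemma \<Lambda>_M: "x \<in> \<Lambda> \<Longrightarrow> x \<in> M" and \<Lambda>_star: "x \<in> \<Lambda> \<Longrightarrow> star x = x"
  by (simp_all add: \<Lambda>_def)

lemma \<Lambda>I: "x \<in> M \<Longrightarrow> star x = x \<Longrightarrow> x \<in> \<Lambda>" by (simp add: \<Lambda>_def)

lemma \<Lambda>_1: "1 \<in> \<Lambda>" by (simp add: \<Lambda>_def M_1 star_1)
lemma \<Lambda>_0: "0 \<in> \<Lambda>" by (simp add: \<Lambda>_def M_closed star_0)
lemma \<Lambda>_add: "x \<in> \<Lambda> \<Longrightarrow> y \<in> \<Lambda> \<Longrightarrow> x + y \<in> \<Lambda>" by (simp add: \<Lambda>_def M_closed star_add)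
lemma \<Lambda>_diff: "x \<in> \<Lambda> \<Longrightarrow> y \<in> \<Lambda> \<Longrightarrow> x - y \<in> \<Lambda>" by (simp add: \<Lambda>_def M_closed star_diff)
lemma \<Lambda>_scale: "a \<in> A \<Longrightarrow> x \<in> \<Lambda> \<Longrightarrow> sc a x \<in> \<Lambda>" by (simp add: \<Lambda>_def M_closed star_scale)
lemma \<Lambda>_square: "x \<in> \<Lambda> \<Longrightarrow> x * x \<in> \<Lambda>" by (simp add: \<Lambda>_def M_mult star_mult)

lemmas \<Lambda>_closed = \<Lambda>_0 \<Lambda>_1 \<Lambda>_add \<Lambda>_diff \<Lambda>_scale \<Lambda>_square

text \<open>Membership in \<open>\<Lambda> + \<pi> M\<close>. The quotient of \<open>M\<close> by this module
  records the skew part \<open>x - star x\<close> modulo \<open>\<pi>\<close>.\<close>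

definition inL :: "'h \<Rightarrow> bool" where "inL x \<longleftrightarrow> (\<exists>l\<in>\<Lambda>. dv (x - l))"

lemma inLE:
  assumes "inL x" obtains l where "l \<in> \<Lambda>" "dv (x - l)"
  using assms unfolding inL_def by blast

lemma inLI: "l \<in> \<Lambda> \<Longrightarrow> dv (x - l) \<Longrightarrow> inL x" unfolding inL_def by blast

lemma \<Lambda>_inL: "x \<in> \<Lambda> \<Longrightarrow> inL x" by (rule inLI[of x]) (simp_all add: dv_0)
lemma dv_inL: "dv x \<Longrightarrow> inL x" by (rule inLI[of 0]) (simp_all add: \<Lambda>_0)

lemma inL_add: "inL x \<Longrightarrow> inL y \<Longrightarrow> inL (x + y)"
proof -
  assume "inL x" "inL y"
  then obtain l l' where "l \<in> \<Lambda>" "dv (x - l)" "l' \<in> \<Lambda>" "dv (y - l')" by (meson inLE)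
  then show ?thesis
    using dv_add[of "x - l" "y - l'"] by (intro inLI[of "l + l'"]) (simp_all add: \<Lambda>_add algebra_simps)
qed

lemma inL_scale: "a \<in> A \<Longrightarrow> inL x \<Longrightarrow> inL (sc a x)"
proof -
  assume a: "a \<in> A" and "inL x"
  then obtain l where "l \<in> \<Lambda>" "dv (x - l)" by (meson inLE)
  then show ?thesis
    using dv_scale[OF a, of "x - l"] a
    by (intro inLI[of "sc a l"]) (simp_all add: \<Lambda>_scale scale_right_diff_distrib)
qed

lemma inL_minus: "inL x \<Longrightarrow> inL (- x)"
  using inL_scale[of "- 1" x] A_closed by simp

lemma inL_diff: "inL x \<Longrightarrow> inL y \<Longrightarrow> inL (x - y)"
  using inL_add[of x "- y"] inL_minus by simp

lemma inL_unit_cancel: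
  assumes "a \<in> A" "inL (sc a x)" "\<not> inL x"
  shows "a / \<pi> \<in> A"
proof (rule ccontr)
  assume n: "a / \<pi> \<notin> A"
  have "inL (sc (inverse a) (sc a x))" by (rule inL_scale[OF unit_or[OF assms(1) n] assms(2)])
  moreover have "a \<noteq> 0" using n A_closed(2) by auto
  ultimately show False using assms(3) by simp
qed

text \<open>The skew parts \<open>x - star x\<close> and \<open>y - star y\<close> are proportional. If the
  proportionality factor is not integral, then its inverse is divisible by \<open>\<pi>\<close> and
  \<open>x\<close> would be symmetric modulo \<open>\<pi>\<close>.\<close>

lemma order_mod_L:
  assumes x: "x \<in> M" "\<not> inL x" and y: "y \<in> M"
  shows "\<exists>a\<in>A. inL (y - sc a x)"
proof -
  obtain c d where cd: "c \<noteq> 0 \<or> d \<noteq> 0" "sc c (x - star x) + sc d (y - star y) = 0"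
    using skew_rank by blast
  have "sc c (star x) + sc d (star y) = sc c x + sc d y"
    using cd(2) by (simp add: scale_right_diff_distrib algebra_simps)
  then have sym: "star (sc c x + sc d y) = sc c x + sc d y"
    by (simp only: star_add star_scale)
  have dcd: "d \<noteq> 0 \<and> c / d \<in> A"
  proof (rule ccontr)
    assume n: "\<not> ?thesis"
    then have c0: "c \<noteq> 0" using cd(1) A_closed(2) by auto
    have dc: "d / c \<in> A" using n A_val[of "c / d"] A_closed(2) by (cases "d = 0") auto
    have dcpi: "d / c / \<pi> \<in> A"
    proof (rule ccontr)
      assume "d / c / \<pi> \<notin> A"
      then have "inverse (d / c) \<in> A" "d \<noteq> 0" using unit_or[OF dc] A_closed(2) by auto
      then show False using n by simp
    qed
    have eq: "x + sc (d / c) y = sc (1 / c) (sc c x + sc d y)" using c0 by (simp add: scale_right_distrib)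
    have "x + sc (d / c) y \<in> \<Lambda>"
      by (rule \<Lambda>I) (use x y dc in \<open>simp add: M_closed\<close>, simp only: eq star_scale sym)
    then have "inL (x + sc (d / c) y - sc (d / c) y)"
      by (intro inL_diff \<Lambda>_inL dv_inL dv_coeff[OF dcpi y])
    then show False using x(2) by simp
  qed
  have eq: "y - sc (- (c / d)) x = sc (1 / d) (sc c x + sc d y)" using dcd by (simp add: scale_right_distrib)
  have "y - sc (- (c / d)) x \<in> \<Lambda>"
    by (rule \<Lambda>I) (use x y dcd in \<open>simp add: M_closed\<close>, simp only: eq star_scale sym)
  then show ?thesis using dcd A_closed(5) by (intro bexI[of _ "- (c / d)"] \<Lambda>_inL) auto
qed

text \<open>In \<open>y\<^sup>2 = \<tau> y - \<nu>\<close> a coefficient that is not integral could be divided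
  out, which would make \<open>y\<close> a scalar modulo \<open>\<pi>\<close>.\<close>

lemma coeffs_integral:
  assumes y: "y \<in> M" and far: "\<And>e. e \<in> A \<Longrightarrow> \<not> dv (y - sc e 1)"
  shows "\<tau> y \<in> A" "\<nu> y \<in> A"
proof -
  have q: "sc (\<tau> y) y - sc (\<nu> y) 1 \<in> M"
    unfolding quadratic[symmetric] by (intro M_mult y)
  show t: "\<tau> y \<in> A"
  proof (rule ccontr)
    assume n: "\<tau> y \<notin> A"
    define t where "t = inverse (\<tau> y)"
    have t0: "\<tau> y \<noteq> 0" using n A_closed(2) by auto
    have tA: "t \<in> A" using n A_val by (auto simp: t_def)
    have tpi: "t / \<pi> \<in> A" using unit_or[OF tA] n by (auto simp: t_def)
    have "y - sc (t * \<nu> y) 1 = sc t (y * y)"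
      using t0 by (simp add: quadratic t_def scale_right_diff_distrib)
    then have d: "dv (y - sc (t * \<nu> y) 1)" using dv_coeff[OF tpi M_mult[OF y y]] by simp
    then have n2: "t * \<nu> y \<notin> A" using far by blast
    define u where "u = inverse (t * \<nu> y)"
    have u0: "t * \<nu> y \<noteq> 0" using n2 A_closed(2) by auto
    have uA: "u \<in> A" using n2 A_val[of "t * \<nu> y"] by (auto simp: u_def)
    have upi: "u / \<pi> \<in> A" using unit_or[OF uA] n2 by (auto simp: u_def)
    have "dv (sc u y - sc u (y - sc (t * \<nu> y) 1))"
      by (intro dv_diff dv_coeff[OF upi] y dv_scale[OF uA d])
    also have "sc u y - sc u (y - sc (t * \<nu> y) 1) = sc (u * (t * \<nu> y)) 1"
      by (simp add: scale_right_diff_distrib)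
    also have "u * (t * \<nu> y) = 1" using left_inverse[OF u0] by (simp only: u_def)
    finally show False using not_dv_1 by simp
  qed
  show "\<nu> y \<in> A"
  proof (rule ccontr)
    assume n: "\<nu> y \<notin> A"
    define u where "u = inverse (\<nu> y)"
    have u0: "\<nu> y \<noteq> 0" using n A_closed(2) by auto
    have uA: "u \<in> A" using n A_val by (auto simp: u_def)
    have upi: "u / \<pi> \<in> A" using unit_or[OF uA] n by (auto simp: u_def)
    have "sc (\<tau> y) y - (sc (\<tau> y) y - sc (\<nu> y) 1) \<in> M" by (intro M_closed t y q)
    then have "sc (\<nu> y) 1 \<in> M" by simp
    then have "dv (sc u (sc (\<nu> y) 1))" by (rule dv_coeff[OF upi])
    then show False using u0 not_dv_1 by (simp add: u_def)
  qed
qed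

end

section \<open>Orders whose symmetric part is commutative modulo the uniformizer\<close>

text \<open>The exceptional case of the comparison: \<open>L = \<Lambda> + \<pi> M\<close> is a proper subring.
  It is commutative modulo \<open>\<pi>\<close> because the involution reverses products, see
  \<open>comm\<close>.\<close>

locale commutative_local_star_order = local_star_order A \<pi> sc star \<tau> \<nu> M
  for A :: "'k::field_char_0 set" and \<pi> :: 'k and sc :: "'k \<Rightarrow> 'h::ring_1 \<Rightarrow> 'h"
    and star :: "'h \<Rightarrow> 'h" and \<tau> \<nu> :: "'h \<Rightarrow> 'k" and M :: "'h set" +
  fixes x0 :: 'h
  assumes x0_M: "x0 \<in> M" and x0_L: "\<not> inL x0"
    and \<Lambda>_mult_L: "\<alpha> \<in> \<Lambda> \<Longrightarrow> \<beta> \<in> \<Lambda> \<Longrightarrow> inL (\<alpha> * \<beta>)"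
begin

lemma comm:
  assumes "\<alpha> \<in> \<Lambda>" "\<beta> \<in> \<Lambda>"
  shows "dv (\<alpha> * \<beta> - \<beta> * \<alpha>)"
proof -
  obtain l where l: "l \<in> \<Lambda>" "dv (\<alpha> * \<beta> - l)" using \<Lambda>_mult_L[OF assms] by (rule inLE)
  have "dv (\<alpha> * \<beta> - l - star (\<alpha> * \<beta> - l))" by (intro dv_diff dv_star l)
  then show ?thesis using assms l by (simp add: star_diff star_mult \<Lambda>_star)
qed

definition V :: "'h set" where "V = {v \<in> \<Lambda>. dv (v * v)}"

lemma V_\<Lambda>: "v \<in> V \<Longrightarrow> v \<in> \<Lambda>" and V_square: "v \<in> V \<Longrightarrow> dv (v * v)"
  by (simp_all add: V_def)

lemma V_M: "v \<in> V \<Longrightarrow> v \<in> M" by (intro \<Lambda>_M V_\<Lambda>)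

text \<open>Let \<open>l\<close> be the symmetric element congruent to \<open>v w\<close> and suppose it is
  nonzero modulo \<open>\<pi>\<close>. It is annihilated by \<open>v\<close>, \<open>w\<close> and itself.
  Multiplying a relation between \<open>1, v, w, l, x0\<close> by \<open>l\<close>, \<open>w\<close> and
  \<open>v\<close> shows that its coefficients vanish modulo \<open>\<pi>\<close> one after the other, so
  these five elements would be independent.\<close>

lemma V_mult:
  assumes v: "v \<in> V" and w: "w \<in> V"
  shows "dv (v * w)"
proof (rule ccontr)
  assume vw: "\<not> dv (v * w)"
  note mem = v[THEN V_\<Lambda>] w[THEN V_\<Lambda>] v[THEN V_M] w[THEN V_M]
  obtain l where l: "l \<in> \<Lambda>" "dv (v * w - l)" using \<Lambda>_mult_L[OF mem(1,2)] by (rule inLE)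
  have lM: "l \<in> M" using l \<Lambda>_M by blast
  have nl: "\<not> dv l" using vw dv_add[OF l(2)] by fastforce
  have wv: "dv (w * v - v * w)" by (rule comm[OF mem(2,1)])
  have nwv: "\<not> dv (w * v)"
  proof
    assume "dv (w * v)"
    then have "dv (w * v - (w * v - v * w))" using wv by (rule dv_diff)
    then show False using vw by simp
  qed
  have vl: "dv (v * l)"
  proof -
    have "dv (v * v * w - v * (v * w - l))"
      by (intro dv_diff dv_mult_left dv_mult_right V_square v mem l)
    then show ?thesis by (simp add: right_diff_distrib mult.assoc)
  qed
  have wl: "dv (w * l)"
  proof -
    have "dv ((w * v - v * w) * w + v * (w * w) - w * (v * w - l))"
      by (intro dv_diff dv_add dv_mult_left[OF mem(3)] dv_mult_left[OF mem(4)] dv_mult_right[OF wv] V_square w mem l)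
    then show ?thesis by (simp add: algebra_simps)
  qed
  have ll: "dv (l * l)"
  proof -
    have "dv (v * (w * l) - (v * w - l) * l)"
      by (intro dv_diff dv_mult_left[OF mem(3) wl] dv_mult_right[OF l(2) lM])
    then show ?thesis by (simp add: algebra_simps)
  qed
  obtain a b c d e where coef: "{a, b, c, d, e} \<subseteq> A" "1 \<in> {a, b, c, d, e}"
    and rel: "sc a 1 + sc b v + sc c w + sc d l + sc e x0 = 0"
    using normalized_relation[of 1 v w l x0] by (elim exE conjE)
  have cA: "a \<in> A" "b \<in> A" "c \<in> A" "d \<in> A" "e \<in> A" using coef(1) by auto
  define y where "y = sc a 1 + sc b v + sc c w + sc d l"
  have "y + sc e x0 = 0" using rel by (simp only: y_def)
  then have ex: "sc e x0 = - y" by (simp only: add_eq_0_iff)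
  have "inL y" unfolding y_def by (intro inL_add inL_scale \<Lambda>_inL \<Lambda>_closed cA mem l)
  then have epi: "e / \<pi> \<in> A" using inL_unit_cancel[OF cA(5) _ x0_L] ex inL_minus by simp
  have dvy: "dv y" using dv_minus[OF dv_coeff[OF epi x0_M]] ex by simp
  have api: "a / \<pi> \<in> A"
  proof (rule dv_unit_cancel[OF cA(1) _ nl])
    have "dv (y * l - sc b (v * l) - sc c (w * l) - sc d (l * l))"
      by (intro dv_diff dv_scale dv_mult_right dvy vl wl ll cA lM)
    then show "dv (sc a l)" by (simp add: y_def distrib_right scale_mult_left)
  qed
  \<comment> \<open>Multiplying the relation by \<open>w\<close> leaves only its term in \<open>v\<close>, since
    \<open>w w\<close> and \<open>w l\<close> vanish.\<close>
  have bpi: "b / \<pi> \<in> A"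
  proof (rule dv_unit_cancel[OF cA(2) _ nwv])
    have "dv (w * y - sc a w - sc c (w * w) - sc d (w * l))"
      by (intro dv_diff dv_scale dv_mult_left dvy wl cA mem V_square w dv_coeff[OF api])
    then show "dv (sc b (w * v))" by (simp add: y_def distrib_left scale_mult_right)
  qed
  have cpi: "c / \<pi> \<in> A"
  proof (rule dv_unit_cancel[OF cA(3) _ vw])
    have "dv (v * y - sc a v - sc b (v * v) - sc d (v * l))"
      by (intro dv_diff dv_scale dv_mult_left dvy vl cA mem V_square v dv_coeff[OF api])
    then show "dv (sc c (v * w))" by (simp add: y_def distrib_left scale_mult_right)
  qed
  have dpi: "d / \<pi> \<in> A"
  proof (rule dv_unit_cancel[OF cA(4) _ nl])
    have "dv (y - sc a 1 - sc b v - sc c w)"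
      by (intro dv_diff dvy dv_coeff[OF api] dv_coeff[OF bpi] dv_coeff[OF cpi] mem M_1)
    then show "dv (sc d l)" by (simp add: y_def)
  qed
  show False using coef(2) api bpi cpi dpi epi pi_nonunit by auto
qed

lemma V_add: "v \<in> V \<Longrightarrow> w \<in> V \<Longrightarrow> v + w \<in> V"
proof -
  assume v: "v \<in> V" and w: "w \<in> V"
  have "dv (v * v + v * w + (w * v + w * w))" by (intro dv_add V_mult v w)
  then show ?thesis using v w by (simp add: V_def \<Lambda>_add algebra_simps)
qed

lemma V_scale: "a \<in> A \<Longrightarrow> v \<in> V \<Longrightarrow> sc a v \<in> V"
proof -
  assume a: "a \<in> A" and v: "v \<in> V"
  have "dv (sc (a * a) (v * v))" by (intro dv_scale A_closed a V_square v)
  then show ?thesis using a v by (simp add: V_def \<Lambda>_scale scale_mult_left scale_mult_right)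
qed

lemma V_0: "0 \<in> V" by (simp add: V_def \<Lambda>_0 dv_0)

lemma order_generators:
  assumes C: "finite C" "C \<subseteq> \<Lambda>" and gen: "\<And>l. l \<in> \<Lambda> \<Longrightarrow> \<exists>y\<in>mspan sc A C. dv (l - y)"
  shows "card C \<ge> 3"
proof -
  have "card (insert x0 C) > 3"
  proof (rule generators_span)
    show "finite (insert x0 C)" "insert x0 C \<subseteq> M" using C \<Lambda>_M x0_M by auto
    have SM: "submod sc A (mspan sc A (insert x0 C))" by (rule mspan_submod[OF A_ring])
    have base: "b \<in> mspan sc A (insert x0 C)" if "b \<in> insert x0 C" for b
      by (rule mspan_base[OF A_ring]) (use C that in auto)
    have sub: "mspan sc A C \<subseteq> mspan sc A (insert x0 C)"
      by (rule mspan_minimal[OF SM]) (use base in auto)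
    fix x assume "x \<in> M"
    then obtain a where a: "a \<in> A" "inL (x - sc a x0)" using order_mod_L[OF x0_M x0_L] by blast
    obtain l where l: "l \<in> \<Lambda>" "dv (x - sc a x0 - l)" using a(2) by (rule inLE)
    obtain y where y: "y \<in> mspan sc A C" "dv (l - y)" using gen[OF l(1)] by blast
    have "sc a x0 + y \<in> mspan sc A (insert x0 C)"
      using y(1) sub base[of x0] by (intro submodD[OF SM] a) auto
    moreover have "dv (x - (sc a x0 + y))"
      using dv_add[OF l(2) y(2)] by (simp add: algebra_simps)
    ultimately show "\<exists>y\<in>mspan sc A (insert x0 C). dv (x - y)" by blast
  qed
  then show ?thesis using C(1) by (simp add: card_insert_if split: if_splits)
qed

text \<open>Modulo \<open>\<pi>\<close> the symmetric elements have dimension at least three.\<close>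

lemma ex_independent:
  assumes \<alpha>: "\<alpha> \<in> \<Lambda>"
  shows "\<exists>w\<in>\<Lambda>. \<forall>a\<in>A. \<forall>b\<in>A. \<not> dv (w - (sc a 1 + sc b \<alpha>))"
proof (rule ccontr)
  assume n: "\<not> ?thesis"
  have SM: "submod sc A (mspan sc A {1, \<alpha>})" by (rule mspan_submod[OF A_ring])
  have "card {1, \<alpha>} \<ge> 3"
  proof (rule order_generators)
    show "finite {1, \<alpha>}" "{1, \<alpha>} \<subseteq> \<Lambda>" using \<alpha> \<Lambda>_1 by auto
    fix l assume "l \<in> \<Lambda>"
    then obtain a b where ab: "a \<in> A" "b \<in> A" "dv (l - (sc a 1 + sc b \<alpha>))" using n by blast
    have "sc a 1 + sc b \<alpha> \<in> mspan sc A {1, \<alpha>}"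
      by (intro submodD[OF SM] ab mspan_base[OF A_ring]) auto
    then show "\<exists>y\<in>mspan sc A {1, \<alpha>}. dv (l - y)" using ab by blast
  qed
  moreover have "card {1, \<alpha>} \<le> 2" by (simp add: card_insert_if)
  ultimately show False by simp
qed

text \<open>Modulo \<open>\<pi>\<close> and up to scalars every symmetric element is nilpotent. Comparing the
  quadratic equations of \<open>\<alpha>\<close>, \<open>w\<close> and \<open>\<alpha> + w\<close>, where
  \<open>1, \<alpha>, w\<close> are independent, expresses \<open>\<alpha> w + w \<alpha>\<close> linearly
  in \<open>\<alpha>\<close>, \<open>w\<close> and 1 (\<open>pol\<close>), and modulo \<open>\<pi>\<close>
  this is \<open>2 \<alpha> w\<close>. If 2 vanishes modulo \<open>\<pi>\<close>, independence kills the
  traces, so \<open>\<alpha>\<^sup>2\<close> is a scalar, hence the square of a scalar. If 2 is a unit,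
  subtract half the traces to get \<open>\<alpha>0\<close> and \<open>w0\<close>: then
  \<open>\<alpha>0\<^sup>2 = c\<close> and \<open>2 \<alpha>0 w0 = d\<close> are scalars, whence \<open>2 c
  w0 = d \<alpha>0\<close> and \<open>c\<close> vanishes by independence.\<close>

lemma \<Lambda>_decomp:
  assumes \<alpha>: "\<alpha> \<in> \<Lambda>"
  shows "\<exists>a\<in>A. \<exists>v\<in>V. dv (\<alpha> - (sc a 1 + v))"
proof (cases "\<exists>e\<in>A. dv (\<alpha> - sc e 1)")
  case True
  then show ?thesis using V_0 by force
next
  case False
  obtain w where w: "w \<in> \<Lambda>" and ind: "\<And>a b. a \<in> A \<Longrightarrow> b \<in> A \<Longrightarrow> \<not> dv (w - (sc a 1 + sc b \<alpha>))"
    using ex_independent[OF \<alpha>] by blast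
  have M: "\<alpha> \<in> M" "w \<in> M" "\<alpha> + w \<in> M" using \<alpha> w by (simp_all add: \<Lambda>_M M_closed)
  have far\<alpha>: "\<not> dv (\<alpha> - sc e 1)" if "e \<in> A" for e using False that by blast
  have farw: "\<not> dv (w - sc e 1)" if "e \<in> A" for e using ind[OF that A_closed(2)] by simp
  have farsum: "\<not> dv (\<alpha> + w - sc e 1)" if "e \<in> A" for e
  proof -
    have eq: "\<alpha> + w - sc e 1 = w - (sc e 1 + sc (- 1) \<alpha>)" by (simp add: algebra_simps)
    show ?thesis unfolding eq by (rule ind[OF that A_closed(5)[OF A_closed(1)]])
  qed
  define t u where "t = \<tau> \<alpha>" and "u = \<tau> w"
  define n m where "n = \<nu> \<alpha>" and "m = \<nu> (\<alpha> + w) - \<nu> \<alpha> - \<nu> w"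
  have tA: "t \<in> A" "n \<in> A" unfolding t_def n_def by (rule coeffs_integral[OF M(1) far\<alpha>], assumption)+
  have uA: "u \<in> A" "\<nu> w \<in> A" unfolding u_def by (rule coeffs_integral[OF M(2) farw], assumption)+
  have mA: "m \<in> A" unfolding m_def
    by (intro A_closed uA tA[unfolded n_def] coeffs_integral[OF M(3) farsum])
  have \<alpha>2: "\<alpha> * \<alpha> = sc t \<alpha> - sc n 1" by (simp add: t_def n_def quadratic)
  have "\<alpha> * w + w * \<alpha> = (\<alpha> + w) * (\<alpha> + w) - \<alpha> * \<alpha> - w * w" by (simp add: algebra_simps)
  also have "\<dots> = sc u \<alpha> + sc t w - sc m 1"
    by (simp add: quadratic trace_add t_def u_def m_def scale_left_distrib scale_right_distrib
        scale_left_diff_distrib algebra_simps)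
  finally have pol: "\<alpha> * w + w * \<alpha> = sc u \<alpha> + sc t w - sc m 1" .
  have cm: "dv (\<alpha> * w - w * \<alpha>)" by (rule comm[OF \<alpha> w])
  show ?thesis
  proof (cases "2 / \<pi> \<in> A")
    case True
    have "dv (sc 2 (w * \<alpha>) + (\<alpha> * w - w * \<alpha>))"
      by (intro dv_add cm dv_coeff[OF True] M_mult M)
    also have "sc 2 (w * \<alpha>) + (\<alpha> * w - w * \<alpha>) = \<alpha> * w + w * \<alpha>"
      using scale_left_distrib[of 1 1 "w * \<alpha>"] by simp
    finally have d: "dv (sc u \<alpha> + sc t w - sc m 1)" unfolding pol .
    have tpi: "t / \<pi> \<in> A"
    proof (rule ccontr)
      assume nt: "t / \<pi> \<notin> A"
      have it: "inverse t \<in> A" by (rule unit_or[OF tA(1) nt])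
      have t0: "t \<noteq> 0" using nt A_closed(2) by auto
      have "dv (sc (inverse t) (sc u \<alpha> + sc t w - sc m 1))" by (rule dv_scale[OF it d])
      also have "sc (inverse t) (sc u \<alpha> + sc t w - sc m 1) =
          w - (sc (inverse t * m) 1 + sc (- (inverse t * u)) \<alpha>)"
        using t0 by (simp add: scale_right_distrib scale_right_diff_distrib algebra_simps)
      finally show False using ind[of "inverse t * m" "- (inverse t * u)"] it mA uA A_closed by auto
    qed
    \<comment> \<open>A square root of the residue \<open>-n\<close> of \<open>\<alpha>\<^sup>2\<close>, the trace
      \<open>t\<close> being zero there.\<close>
    obtain b where b: "b \<in> A" "(- n - b * b) / \<pi> \<in> A"
      using A_sqrt[OF True A_closed(5)[OF tA(2)]] by blast
    define v where "v = \<alpha> - sc b 1"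
    have "dv (sc t \<alpha> + sc (- n - b * b) 1 + sc 2 (sc (b * b) 1 - sc b \<alpha>))"
      by (intro dv_add dv_coeff[OF tpi] dv_coeff[OF b(2)] dv_coeff[OF True] M_closed A_closed b M(1))
    also have "sc t \<alpha> + sc (- n - b * b) 1 + sc 2 (sc (b * b) 1 - sc b \<alpha>) = v * v"
    proof -
      have two: "sc 2 x = x + x" for x using scale_left_distrib[of 1 1 x] by simp
      have "v * v = \<alpha> * \<alpha> - sc b \<alpha> - sc b \<alpha> + sc (b * b) 1"
        by (simp add: v_def algebra_simps scale_mult_left scale_mult_right)
      then show ?thesis unfolding \<alpha>2 two by (simp add: scale_left_diff_distrib algebra_simps)
    qed
    finally have "v \<in> V" unfolding V_def using \<alpha> b by (simp add: v_def \<Lambda>_closed)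
    then show ?thesis using b(1) dv_0 by (intro bexI[of _ b] bexI[of _ v]) (simp_all add: v_def)
  next
    case False
    have h: "inverse 2 \<in> A" using unit_or[OF _ False] A_closed(6)[OF A_closed(1,1)] by simp
    define p q where "p = inverse 2 * t" and "q = inverse 2 * u"
    have pA: "p \<in> A" "q \<in> A" unfolding p_def q_def by (intro A_closed h tA uA)+
    have tp: "t = p + p" "u = q + q" by (simp_all add: p_def q_def)
    define \<alpha>0 w0 where "\<alpha>0 = \<alpha> - sc p 1" and "w0 = w - sc q 1"
    have \<Lambda>0: "\<alpha>0 \<in> \<Lambda>" "w0 \<in> \<Lambda>" unfolding \<alpha>0_def w0_def by (intro \<Lambda>_closed \<alpha> w pA)+
    define c d where "c = p * p - n" and "d = p * q + p * q - m"
    have cA: "c \<in> A" unfolding c_def by (intro A_closed pA tA)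
    have dA: "d \<in> A" unfolding d_def by (intro A_closed pA mA)
    have sq: "\<alpha>0 * \<alpha>0 = sc c 1"
    proof -
      have "\<alpha>0 * \<alpha>0 = \<alpha> * \<alpha> - sc p \<alpha> - sc p \<alpha> + sc (p * p) 1"
        by (simp add: \<alpha>0_def algebra_simps scale_mult_left scale_mult_right)
      then show ?thesis unfolding \<alpha>2 tp c_def scale_left_distrib scale_left_diff_distrib
        by simp
    qed
    have anti: "\<alpha>0 * w0 + w0 * \<alpha>0 = sc d 1"
    proof -
      have "\<alpha>0 * w0 + w0 * \<alpha>0 = (\<alpha> * w + w * \<alpha>) - sc (q + q) \<alpha> - sc (p + p) w + sc (p * q + p * q) 1"
        unfolding scale_left_distrib \<alpha>0_def w0_def
        by (simp add: algebra_simps scale_mult_left scale_mult_right)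
      then show ?thesis unfolding pol tp d_def scale_left_distrib scale_left_diff_distrib by simp
    qed
    have "dv (sc d \<alpha>0 - sc 2 (sc c w0))"
    proof -
      have two: "sc 2 x = x + x" for x using scale_left_distrib[of 1 1 x] by simp
      have "dv (\<alpha>0 * (w0 * \<alpha>0 - \<alpha>0 * w0))"
        by (rule dv_mult_left[OF \<Lambda>_M[OF \<Lambda>0(1)] comm[OF \<Lambda>0(2,1)]])
      also have "\<alpha>0 * (w0 * \<alpha>0 - \<alpha>0 * w0) = \<alpha>0 * (\<alpha>0 * w0 + w0 * \<alpha>0) - sc 2 (\<alpha>0 * \<alpha>0 * w0)"
        by (simp add: two algebra_simps)
      also have "\<dots> = sc d \<alpha>0 - sc 2 (sc c w0)"
        by (simp add: sq anti scale_mult_right scale_mult_left)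
      finally show ?thesis .
    qed
    then have "dv (sc (inverse 2) (sc d \<alpha>0 - sc 2 (sc c w0)))" by (rule dv_scale[OF h])
    then have d1: "dv (sc (inverse 2 * d) \<alpha>0 - sc c w0)" by (simp add: scale_right_diff_distrib)
    have cpi: "c / \<pi> \<in> A"
    proof (rule ccontr)
      assume nc: "c / \<pi> \<notin> A"
      have ic: "inverse c \<in> A" by (rule unit_or[OF cA nc])
      have c0: "c \<noteq> 0" using nc A_closed(2) by auto
      define f where "f = inverse c * (inverse 2 * d)"
      have fA: "f \<in> A" unfolding f_def by (intro A_closed ic h dA)
      have "dv (- sc (inverse c) (sc (inverse 2 * d) \<alpha>0 - sc c w0))"
        by (intro dv_minus dv_scale[OF ic d1])
      also have "- sc (inverse c) (sc (inverse 2 * d) \<alpha>0 - sc c w0) = w - (sc (q - f * p) 1 + sc f \<alpha>)"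
        using c0 by (simp add: \<alpha>0_def w0_def f_def scale_right_diff_distrib scale_left_diff_distrib
            algebra_simps)
      finally show False using ind[OF _ fA, of "q - f * p"] fA pA A_closed(3,4) by simp
    qed
    have "\<alpha>0 \<in> V" unfolding V_def using \<Lambda>0(1) dv_coeff[OF cpi M_1] by (simp add: sq)
    then show ?thesis using pA(1) dv_0 by (intro bexI[of _ p] bexI[of _ \<alpha>0]) (simp_all add: \<alpha>0_def)
  qed
qed

end

section \<open>The radical ideal and comparison of local orders\<close>

context commutative_local_star_order
begin

definition J :: "'h set" where "J = {z. \<exists>v\<in>V. dv (z - v)}"

lemma JI: "v \<in> V \<Longrightarrow> dv (z - v) \<Longrightarrow> z \<in> J" unfolding J_def by blast

lemma JE:
  assumes "z \<in> J" obtains v where "v \<in> V" "dv (z - v)"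
  using assms unfolding J_def by blast

lemma V_J: "v \<in> V \<Longrightarrow> v \<in> J" by (rule JI[of v]) (simp_all add: dv_0)
lemma dv_J: "dv z \<Longrightarrow> z \<in> J" by (rule JI[of 0]) (simp_all add: V_0)

lemma J_add: "x \<in> J \<Longrightarrow> y \<in> J \<Longrightarrow> x + y \<in> J"
proof -
  assume "x \<in> J" "y \<in> J"
  then obtain v w where "v \<in> V" "dv (x - v)" "w \<in> V" "dv (y - w)" by (meson JE)
  then show ?thesis using dv_add[of "x - v" "y - w"]
    by (intro JI[of "v + w"]) (simp_all add: V_add algebra_simps)
qed

lemma J_scale: "a \<in> A \<Longrightarrow> x \<in> J \<Longrightarrow> sc a x \<in> J"
proof -
  assume a: "a \<in> A" and "x \<in> J"
  then obtain v where "v \<in> V" "dv (x - v)" by (meson JE)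
  then show ?thesis using dv_scale[OF a, of "x - v"] a
    by (intro JI[of "sc a v"]) (simp_all add: V_scale scale_right_diff_distrib)
qed

lemma J_submod: "submod sc A J"
  unfolding submod_def using V_J V_0 J_add J_scale by blast

lemma J_M: "x \<in> J \<Longrightarrow> x \<in> M"
proof -
  assume "x \<in> J"
  then obtain v where v: "v \<in> V" "dv (x - v)" by (rule JE)
  have "(x - v) + v \<in> M" by (intro M_closed dv_imp_M v V_M)
  then show ?thesis by simp
qed

lemma J_inL: "x \<in> J \<Longrightarrow> inL x"
  unfolding J_def using inLI V_\<Lambda> by blast

lemma J_star: "x \<in> J \<Longrightarrow> star x \<in> J"
proof -
  assume "x \<in> J"
  then obtain v where v: "v \<in> V" "dv (x - v)" by (rule JE)
  then show ?thesis using dv_star[OF v(2)]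
    by (intro JI[of v]) (simp_all add: star_diff \<Lambda>_star V_\<Lambda>)
qed

text \<open>Write \<open>x0 v = s x0 + l\<close> modulo \<open>\<pi>\<close> with symmetric \<open>l\<close>.
  Multiplying by \<open>v\<close> gives \<open>0 = s\<^sup>2 x0 + s l + l v\<close>, so \<open>s\<^sup>2
  x0\<close> lies in \<open>L\<close> and \<open>s\<close> is not a unit.\<close>

lemma x0_V_inL:
  assumes v: "v \<in> V"
  shows "inL (x0 * v)"
proof -
  obtain s where s: "s \<in> A" "inL (x0 * v - sc s x0)"
    using order_mod_L[OF x0_M x0_L M_mult[OF x0_M V_M[OF v]]] by blast
  obtain l where l: "l \<in> \<Lambda>" "dv (x0 * v - sc s x0 - l)" using s(2) by (rule inLE)
  have "dv ((x0 * v - sc s x0 - l) * v - x0 * (v * v))"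
    by (intro dv_diff dv_mult_right dv_mult_left l V_M V_square v x0_M)
  then have "dv (- (l * v) - sc s (x0 * v))"
    by (simp add: algebra_simps scale_mult_left)
  then have "dv (- (l * v) - sc s (x0 * v) + sc s (x0 * v - sc s x0 - l))"
    by (intro dv_add dv_scale s l)
  then have d: "dv (- (sc (s * s) x0 + (l * v + sc s l)))"
    by (simp add: scale_right_diff_distrib algebra_simps)
  have "inL (- (- (sc (s * s) x0 + (l * v + sc s l))) - (l * v + sc s l))"
    by (intro inL_diff inL_minus inL_add dv_inL[OF d] \<Lambda>_mult_L inL_scale \<Lambda>_inL l V_\<Lambda> v s)
  then have ss: "inL (sc s (sc s x0))" by simp
  have spi: "s / \<pi> \<in> A"
  proof (rule ccontr)
    assume n: "s / \<pi> \<notin> A"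
    then have "\<not> inL (sc s x0)" using inL_unit_cancel[OF s(1) _ x0_L] by blast
    then show False using inL_unit_cancel[OF s(1) ss] n by blast
  qed
  have "inL ((x0 * v - sc s x0) + sc s x0)"
    by (intro inL_add s dv_inL dv_coeff[OF spi] x0_M)
  then show ?thesis by simp
qed

lemma M_V_inL:
  assumes y: "y \<in> M" and v: "v \<in> V"
  shows "inL (y * v)"
proof -
  obtain s where s: "s \<in> A" "inL (y - sc s x0)" using order_mod_L[OF x0_M x0_L y] by blast
  obtain l where l: "l \<in> \<Lambda>" "dv (y - sc s x0 - l)" using s(2) by (rule inLE)
  have "inL ((y - sc s x0 - l) * v + sc s (x0 * v) + l * v)"
    by (intro inL_add dv_inL dv_mult_right l V_M v inL_scale s x0_V_inL \<Lambda>_mult_L V_\<Lambda>)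
  then show ?thesis by (simp add: algebra_simps scale_mult_left)
qed

text \<open>The product is congruent to a symmetric \<open>l = a + w\<close> with \<open>w\<close> in
  \<open>V\<close>, and multiplying by \<open>v\<close> shows that \<open>a v\<close> vanishes modulo
  \<open>\<pi>\<close>.\<close>

lemma M_V_J:
  assumes y: "y \<in> M" and v: "v \<in> V"
  shows "y * v \<in> J"
proof (cases "dv v")
  case True
  then show ?thesis using y by (intro dv_J dv_mult_left)
next
  case False
  obtain l where l: "l \<in> \<Lambda>" "dv (y * v - l)" using M_V_inL[OF y v] by (rule inLE)
  obtain a w where aw: "a \<in> A" "w \<in> V" "dv (l - (sc a 1 + w))" using \<Lambda>_decomp[OF l(1)] by blast
  have "dv (y * (v * v) - (y * v - l) * v - (l - (sc a 1 + w)) * v - w * v)"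
    by (intro dv_diff dv_mult_left[OF y] dv_mult_right V_M V_square v l aw V_mult)
  then have "dv (sc a v)" by (simp add: algebra_simps scale_mult_left)
  then have api: "a / \<pi> \<in> A" using dv_unit_cancel[OF aw(1) _ False] by blast
  have "dv ((y * v - l) + (l - (sc a 1 + w)) + sc a 1)"
    by (intro dv_add l aw dv_coeff[OF api] M_1)
  then show ?thesis by (intro JI[OF aw(2)]) (simp add: algebra_simps)
qed

lemma J_left_ideal: "x \<in> M \<Longrightarrow> z \<in> J \<Longrightarrow> x * z \<in> J"
proof -
  assume x: "x \<in> M" and "z \<in> J"
  then obtain v where v: "v \<in> V" "dv (z - v)" by (meson JE)
  have "x * (z - v) + x * v \<in> J" by (intro J_add dv_J dv_mult_left x v M_V_J)
  then show ?thesis by (simp add: algebra_simps)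
qed

lemma J_right_ideal: "z \<in> J \<Longrightarrow> x \<in> M \<Longrightarrow> z * x \<in> J"
  using J_star[OF J_left_ideal[OF M_star J_star, of x z]] by (simp add: star_mult star_star)

text \<open>Otherwise symmetric elements would be scalars modulo \<open>\<pi>\<close>, contradicting the
  dimension count.\<close>

lemma J_not_divisible: "\<exists>j\<in>J. \<not> dv j"
proof (rule ccontr)
  assume n: "\<not> ?thesis"
  have SM: "submod sc A (mspan sc A {1})" by (rule mspan_submod[OF A_ring])
  have "card {1 :: 'h} \<ge> 3"
  proof (rule order_generators)
    show "finite {1 :: 'h}" "{1 :: 'h} \<subseteq> \<Lambda>" using \<Lambda>_1 by auto
    fix l assume "l \<in> \<Lambda>"
    then obtain a v where av: "a \<in> A" "v \<in> V" "dv (l - (sc a 1 + v))" using \<Lambda>_decomp by blast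
    have "dv v" using n V_J av(2) by blast
    then have "dv (l - (sc a 1 + v) + v)" by (intro dv_add av)
    moreover have "sc a 1 \<in> mspan sc A {1}"
      by (intro submodD[OF SM] av mspan_base[OF A_ring]) auto
    ultimately show "\<exists>y\<in>mspan sc A {1}. dv (l - y)" by (intro bexI[of _ "sc a 1"]) simp_all
  qed
  then show False by simp
qed

lemma J_square_inL:
  assumes VV: "\<And>v w. v \<in> V \<Longrightarrow> w \<in> V \<Longrightarrow> inL (sc (1 / \<pi>) (v * w))"
    and z: "z1 \<in> J" "z2 \<in> J"
  shows "inL (sc (1 / \<pi>) (z1 * z2))"
proof -
  obtain v where v: "v \<in> V" "dv (z1 - v)" using z(1) by (rule JE)
  obtain w where w: "w \<in> V" "dv (z2 - w)" using z(2) by (rule JE)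
  define m where "m = sc (1 / \<pi>) (z1 - v)"
  define n where "n = sc (1 / \<pi>) (z2 - w)"
  have mn: "m \<in> M" "n \<in> M" using v w unfolding m_def n_def dv_def by auto
  have "sc (1 / \<pi>) (z1 * z2) = sc (1 / \<pi>) (v * w) + v * n + m * z2"
    by (simp add: m_def n_def scale_mult_left scale_mult_right scale_right_diff_distrib algebra_simps)
  also have "inL (sc (1 / \<pi>) (v * w) + v * n + m * z2)"
    by (intro inL_add VV v w J_inL[OF J_right_ideal] J_inL[OF J_left_ideal] V_J mn z)
  finally show ?thesis .
qed

text \<open>The set \<open>\<pi>\<^sup>-\<^sup>1 J J\<close> is an ideal contained in \<open>L\<close>, and
  \<open>L\<close> consists of scalars plus elements of \<open>J\<close>. A unit scalar part
  \<open>a\<close> of an element is impossible, as multiplication by \<open>x0\<close> would put \<open>a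
  x0\<close> into \<open>L\<close>.\<close>

lemma J_square:
  assumes VV: "\<And>v w. v \<in> V \<Longrightarrow> w \<in> V \<Longrightarrow> inL (sc (1 / \<pi>) (v * w))"
    and z: "z1 \<in> J" "z2 \<in> J"
  shows "sc (1 / \<pi>) (z1 * z2) \<in> J"
proof -
  define z where "z = sc (1 / \<pi>) (z1 * z2)"
  have "inL z" unfolding z_def by (rule J_square_inL[OF VV z])
  then obtain l where l: "l \<in> \<Lambda>" "dv (z - l)" by (rule inLE)
  obtain a v where av: "a \<in> A" "v \<in> V" "dv (l - (sc a 1 + v))" using \<Lambda>_decomp[OF l(1)] by blast
  have "dv ((z - l) + (l - (sc a 1 + v)))" by (intro dv_add l av)
  then have zJ: "z - sc a 1 \<in> J" by (intro JI[OF av(2)]) (simp add: algebra_simps)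
  have "inL (sc (1 / \<pi>) ((x0 * z1) * z2))" by (intro J_square_inL[OF VV] J_left_ideal x0_M z)
  moreover have "sc (1 / \<pi>) ((x0 * z1) * z2) = x0 * z"
    by (simp add: z_def scale_mult_right mult.assoc)
  ultimately have "inL (x0 * z - x0 * (z - sc a 1))"
    using J_inL[OF J_left_ideal[OF x0_M zJ]] by (intro inL_diff) simp_all
  then have "inL (sc a x0)" by (simp add: right_diff_distrib scale_mult_right)
  then have api: "a / \<pi> \<in> A" using inL_unit_cancel[OF av(1) _ x0_L] by blast
  have "(z - sc a 1) + sc a 1 \<in> J" by (intro J_add zJ dv_J dv_coeff[OF api] M_1)
  then show ?thesis by (simp add: z_def)
qed

end

text \<open>The third alternative describes an ideal \<open>J\<close> for which \<open>M + \<pi>\<^sup>-\<^sup>1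
  J\<close> is a strictly larger order with involution. It arises when the two orders share no element
  outside \<open>\<Lambda> + \<pi> M\<close> and none outside \<open>\<Lambda> + \<pi> M'\<close>, because a
  shared element gives one of the inclusions by Nakayama's lemma.\<close>

theorem local_star_orders_comparable:
  assumes M: "local_star_order A \<pi> sc star \<tau> \<nu> M" and M': "local_star_order A \<pi> sc star \<tau> \<nu> M'"
    and sym: "{x \<in> M. star x = x} = {x \<in> M'. star x = x}"
  shows "M \<subseteq> M' \<or> M' \<subseteq> M \<or>
    (\<exists>J \<subseteq> M. submod sc A J \<and> (\<forall>x\<in>M. sc \<pi> x \<in> J) \<and> (\<forall>x\<in>J. star x \<in> J) \<and>
      (\<forall>x\<in>M. \<forall>z\<in>J. x * z \<in> J \<and> z * x \<in> J) \<and> (\<forall>x\<in>J. \<forall>y\<in>J. sc (1 / \<pi>) (x * y) \<in> J) \<and>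
      (\<exists>z\<in>J. sc (1 / \<pi>) z \<notin> M))"
proof -
  interpret M: local_star_order A \<pi> sc star \<tau> \<nu> M by (rule M)
  interpret M': local_star_order A \<pi> sc star \<tau> \<nu> M' by (rule M')
  have \<Lambda>: "M'.\<Lambda> = M.\<Lambda>" using sym unfolding M.\<Lambda>_def M'.\<Lambda>_def by simp
  have incl: "N \<subseteq> N'"
    if N: "local_star_order A \<pi> sc star \<tau> \<nu> N" and N': "local_star_order A \<pi> sc star \<tau> \<nu> N'"
      and sym: "{x \<in> N. star x = x} = {x \<in> N'. star x = x}"
      and x: "x \<in> N" "x \<in> N'" "\<not> local_star_order.inL \<pi> sc star N x" for N N' x
  proof -
    interpret N: local_star_order A \<pi> sc star \<tau> \<nu> N by (rule N)
    interpret N': local_star_order A \<pi> sc star \<tau> \<nu> N' by (rule N')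
    show ?thesis
    proof (rule N.nakayama_M[OF N'.M_submod])
      fix y assume "y \<in> N"
      then obtain a where a: "a \<in> A" "N.inL (y - sc a x)" using N.order_mod_L[OF x(1,3)] by blast
      obtain l where l: "l \<in> N.\<Lambda>" "N.dv (y - sc a x - l)" using a(2) by (rule N.inLE)
      have "l \<in> N'" using l(1) sym unfolding N.\<Lambda>_def by auto
      then have "sc a x + l \<in> N'" by (intro N'.M_closed a x)
      moreover have "N.dv (y - (sc a x + l))" using l(2) by (simp add: algebra_simps)
      ultimately show "\<exists>n\<in>N'. N.dv (y - n)" by blast
    qed
  qed
  have all_L: "N \<subseteq> N'"
    if N: "local_star_order A \<pi> sc star \<tau> \<nu> N" and N': "local_star_order A \<pi> sc star \<tau> \<nu> N'"
      and sym: "{x \<in> N. star x = x} = {x \<in> N'. star x = x}"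
      and all: "\<forall>x\<in>N. local_star_order.inL \<pi> sc star N x" for N N'
  proof -
    interpret N: local_star_order A \<pi> sc star \<tau> \<nu> N by (rule N)
    interpret N': local_star_order A \<pi> sc star \<tau> \<nu> N' by (rule N')
    show ?thesis
    proof (rule N.nakayama_M[OF N'.M_submod])
      fix y assume "y \<in> N"
      then have "N.inL y" using all by blast
      then obtain l where l: "l \<in> N.\<Lambda>" "N.dv (y - l)" by (rule N.inLE)
      have "l \<in> N'" using l(1) sym unfolding N.\<Lambda>_def by auto
      then show "\<exists>n\<in>N'. N.dv (y - n)" using l(2) by blast
    qed
  qed
  show ?thesis
  proof (cases "M \<subseteq> M' \<or> M' \<subseteq> M")
    case True
    then show ?thesis by blast
  next
    case False
    have noM: "M.inL x" if "x \<in> M" "x \<in> M'" for x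
      using incl[OF M M' sym that] False by blast
    have noM': "M'.inL x" if "x \<in> M" "x \<in> M'" for x
      using incl[OF M' M sym[symmetric] that(2,1)] False by blast
    obtain x0 where x0: "x0 \<in> M" "\<not> M.inL x0" using all_L[OF M M' sym] False by blast
    obtain x0' where x0': "x0' \<in> M'" "\<not> M'.inL x0'" using all_L[OF M' M sym[symmetric]] False by blast
    have prods: "a * b \<in> M \<and> a * b \<in> M'" if "a \<in> M.\<Lambda>" "b \<in> M.\<Lambda>" for a b
      using that M.M_mult M'.M_mult M.\<Lambda>_M M'.\<Lambda>_M \<Lambda> by metis
    interpret C: commutative_local_star_order A \<pi> sc star \<tau> \<nu> M x0
      by unfold_locales (use x0 noM prods in auto)
    interpret C': commutative_local_star_order A \<pi> sc star \<tau> \<nu> M' x0'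
      by unfold_locales (use x0' noM' prods \<Lambda> in auto)
    have V: "v \<in> C'.V" if v: "v \<in> C.V" for v
    proof -
      have v\<Lambda>: "v \<in> M.\<Lambda>" "M.dv (v * v)" using v by (simp_all add: C.V_def)
      have "sc (1 / \<pi>) (v * v) \<in> M.\<Lambda>"
        by (rule M.\<Lambda>I) (use v\<Lambda> in \<open>simp_all add: M.dv_def M.star_scale M.star_mult M.\<Lambda>_star\<close>)
      then have "M'.dv (v * v)" using \<Lambda> M'.\<Lambda>_M unfolding M'.dv_def by blast
      then show ?thesis using v\<Lambda>(1) \<Lambda> by (simp add: C'.V_def)
    qed
    have VV: "M.inL (sc (1 / \<pi>) (v * w))" if "v \<in> C.V" "w \<in> C.V" for v w
      using noM[of "sc (1 / \<pi>) (v * w)"] C.V_mult[OF that] C'.V_mult[OF V V, OF that]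
      unfolding M.dv_def M'.dv_def by blast
    have "C.J \<subseteq> M" using C.J_M by blast
    moreover have "\<forall>x\<in>M. sc \<pi> x \<in> C.J" using C.dv_J M.dv_pi by blast
    moreover have "\<exists>z\<in>C.J. sc (1 / \<pi>) z \<notin> M" using C.J_not_divisible unfolding M.dv_def by blast
    moreover have "\<forall>x\<in>M. \<forall>z\<in>C.J. x * z \<in> C.J \<and> z * x \<in> C.J"
      by (simp add: C.J_left_ideal C.J_right_ideal)
    moreover have "\<forall>x\<in>C.J. \<forall>y\<in>C.J. sc (1 / \<pi>) (x * y) \<in> C.J"
      using C.J_square[OF VV] by simp
    moreover have "\<forall>x\<in>C.J. star x \<in> C.J" by (simp add: C.J_star)
    ultimately show ?thesis
      using C.J_submod by (intro disjI2 exI[of _ C.J] conjI)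
  qed
qed

section \<open>Maximal orders are determined by their symmetric elements\<close>

abbreviation alg_ints :: "'k::field_char_0 set" where "alg_ints \<equiv> Collect algebraic_int"

text \<open>Every order must be exhibited with finitely many generators. Modules between \<open>l R\<close> and
  \<open>R\<close> have them because \<open>R / l R\<close> is finite.\<close>

lemma (in involution_algebra) fg_of_multiple:
  assumes nf: "number_field TYPE('k)" and l: "prime (l::int)" and B: "finite B"
    and M: "submod sc alg_ints M" "M \<subseteq> ok_span sc B" and lM: "\<And>x. x \<in> ok_span sc B \<Longrightarrow> sc (of_int l) x \<in> M"
  shows "\<exists>B'. finite B' \<and> M = ok_span sc B'"
proof -
  obtain F :: "'k set" where F: "finite F" "F \<subseteq> Collect algebraic_int"
    "\<forall>x. algebraic_int x \<longrightarrow> (\<exists>y\<in>F. \<exists>z. algebraic_int z \<and> x = y + of_int l * z)"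
    using finite_int_quotient[OF nf l] by (elim exE conjE)
  define R where "R = (\<lambda>f. \<Sum>b\<in>B. sc (f b) b) ` (B \<rightarrow>\<^sub>E F)"
  define B' where "B' = (R \<inter> M) \<union> sc (of_int l) ` B"
  have finR: "finite R" unfolding R_def by (intro finite_imageI finite_PiE B F)
  have fin: "finite B'" unfolding B'_def using finR B by simp
  have SB': "submod sc alg_ints (mspan sc alg_ints B')" by (rule mspan_submod[OF subring_algebraic_int])
  have base: "b \<in> mspan sc alg_ints B'" if "b \<in> B'" for b
    by (rule mspan_base[OF subring_algebraic_int fin that])
  have "M = mspan sc alg_ints B'"
  proof
    have "b \<in> M" if "b \<in> B'" for b
      using that lM mspan_base[OF subring_algebraic_int B] unfolding B'_def ok_span_mspan by auto
    then show "mspan sc alg_ints B' \<subseteq> M" by (intro mspan_minimal M) auto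
    show "M \<subseteq> mspan sc alg_ints B'"
    proof
      fix x assume x: "x \<in> M"
      then obtain c where c: "x = (\<Sum>b\<in>B. sc (c b) b)" "\<forall>b\<in>B. algebraic_int (c b)"
        using M(2) by (auto simp: ok_span_def)
      have "\<forall>b\<in>B. \<exists>y z. y \<in> F \<and> algebraic_int z \<and> c b = y + of_int l * z"
        using F(3) c(2) by blast
      then obtain f z where fz: "\<forall>b\<in>B. f b \<in> F \<and> algebraic_int (z b) \<and> c b = f b + of_int l * z b"
        by metis
      define r where "r = (\<Sum>b\<in>B. sc (f b) b)"
      define y where "y = (\<Sum>b\<in>B. sc (z b) b)"
      have yO: "y \<in> ok_span sc B" using fz by (auto simp: ok_span_def y_def)
      have xr: "x = r + sc (of_int l) y"
        unfolding c(1) r_def y_def using fz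
        by (simp add: scale_sum_right sum.distrib[symmetric] scale_left_distrib)
      have "r = x - sc (of_int l) y" using xr by simp
      then have rM: "r \<in> M" using submod_diff[OF subring_algebraic_int M(1) x lM[OF yO]] by simp
      have "r \<in> R" unfolding R_def r_def
        by (rule image_eqI[of _ _ "restrict f B"]) (use fz in auto)
      then have "r \<in> mspan sc alg_ints B'" using base rM by (simp add: B'_def)
      moreover have "sc (of_int l) y = (\<Sum>b\<in>B. sc (z b) (sc (of_int l) b))"
        by (simp add: y_def scale_sum_right mult.commute)
      moreover have "\<dots> \<in> mspan sc alg_ints B'"
        by (intro submod_sum[OF SB'] submodD(3)[OF SB'] base) (use fz in \<open>auto simp: B'_def\<close>)
      ultimately show "x \<in> mspan sc alg_ints B'" unfolding xr by (intro submodD(2)[OF SB']) simp_all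
    qed
  qed
  then show ?thesis using fin unfolding ok_span_mspan by blast
qed

context involution_algebra
begin

lemma star_orderD:
  assumes "star_order sc star R"
  shows "1 \<in> R" "x \<in> R \<Longrightarrow> y \<in> R \<Longrightarrow> x - y \<in> R" "x \<in> R \<Longrightarrow> y \<in> R \<Longrightarrow> x * y \<in> R"
    "x \<in> R \<Longrightarrow> star x \<in> R" "\<exists>B. finite B \<and> R = ok_span sc B" "span R = UNIV"
    "submod sc alg_ints R" "0 \<in> R" "x \<in> R \<Longrightarrow> y \<in> R \<Longrightarrow> x + y \<in> R"
    "algebraic_int a \<Longrightarrow> x \<in> R \<Longrightarrow> sc a x \<in> R"
proof -
  show "1 \<in> R" "x \<in> R \<Longrightarrow> y \<in> R \<Longrightarrow> x - y \<in> R" "x \<in> R \<Longrightarrow> y \<in> R \<Longrightarrow> x * y \<in> R"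
    "x \<in> R \<Longrightarrow> star x \<in> R" "span R = UNIV"
    using assms by (simp_all add: star_order_def is_order_def)
  show fg: "\<exists>B. finite B \<and> R = ok_span sc B"
    using assms by (simp add: star_order_def is_order_def)
  then show S: "submod sc alg_ints R"
    using mspan_submod[OF subring_algebraic_int] unfolding ok_span_mspan by auto
  show "0 \<in> R" "x \<in> R \<Longrightarrow> y \<in> R \<Longrightarrow> x + y \<in> R" "algebraic_int a \<Longrightarrow> x \<in> R \<Longrightarrow> sc a x \<in> R"
    using submodD[OF S] by auto
qed

lemma star_orderI:
  assumes "submod sc alg_ints R" "1 \<in> R" "\<And>x y. x \<in> R \<Longrightarrow> y \<in> R \<Longrightarrow> x * y \<in> R"
    "\<And>x. x \<in> R \<Longrightarrow> star x \<in> R" "finite B" "R = ok_span sc B" "span R = UNIV"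
  shows "star_order sc star R"
  unfolding star_order_def is_order_def
  using assms submod_diff[OF subring_algebraic_int assms(1)] by blast

lemma fg_sum:
  assumes "finite B" "finite C"
    and W: "submod sc alg_ints W" "B \<subseteq> W" "C \<subseteq> W"
    and gen: "\<And>x. x \<in> W \<Longrightarrow> \<exists>y\<in>ok_span sc B. \<exists>z\<in>ok_span sc C. x = y + z"
  shows "W = ok_span sc (B \<union> C)"
proof
  have S: "submod sc alg_ints (mspan sc alg_ints (B \<union> C))" by (rule mspan_submod[OF subring_algebraic_int])
  show "ok_span sc (B \<union> C) \<subseteq> W" unfolding ok_span_mspan using W by (intro mspan_minimal) auto
  have "mspan sc alg_ints B \<subseteq> mspan sc alg_ints (B \<union> C)" "mspan sc alg_ints C \<subseteq> mspan sc alg_ints (B \<union> C)"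
    using assms(1,2) mspan_base[OF subring_algebraic_int] by (intro mspan_minimal[OF S]; force)+
  then show "W \<subseteq> ok_span sc (B \<union> C)"
    using gen submodD(2)[OF S] unfolding ok_span_mspan by blast
qed

end

locale order_at_prime = number_field_prime P + involution_algebra sc star \<tau> \<nu>
  for P :: "'k::field_char_0 set" and sc :: "'k \<Rightarrow> 'h::ring_1 \<Rightarrow> 'h"
    and star :: "'h \<Rightarrow> 'h" and \<tau> \<nu> :: "'h \<Rightarrow> 'k"
begin

definition loc :: "'h set \<Rightarrow> 'h set" where
  "loc R = {z. \<exists>s. algebraic_int s \<and> s \<notin> P \<and> sc s z \<in> R}"

lemma locI: "algebraic_int s \<Longrightarrow> s \<notin> P \<Longrightarrow> sc s z \<in> R \<Longrightarrow> z \<in> loc R"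
  unfolding loc_def by blast

lemma locE:
  assumes "z \<in> loc R"
  obtains s where "algebraic_int s" "s \<notin> P" "sc s z \<in> R"
  using assms unfolding loc_def by blast

lemma subset_loc: "R \<subseteq> loc R"
  using locI[of 1] P_1 by auto

lemma loc_mspan:
  assumes B: "finite B"
  shows "loc (ok_span sc B) = mspan sc A B"
proof
  show "loc (ok_span sc B) \<subseteq> mspan sc A B"
  proof
    fix z assume "z \<in> loc (ok_span sc B)"
    then obtain s where s: "algebraic_int s" "s \<notin> P" "sc s z \<in> ok_span sc B" by (rule locE)
    then obtain c where c: "sc s z = (\<Sum>b\<in>B. sc (c b) b)" "\<forall>b\<in>B. algebraic_int (c b)"
      by (auto simp: ok_span_def)
    have s0: "s \<noteq> 0" using s P_0 by auto
    have "z = sc (inverse s) (sc s z)" using s0 by simp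
    also have "\<dots> = (\<Sum>b\<in>B. sc (inverse s * c b) b)" unfolding c(1) by (simp add: scale_sum_right)
    finally have "z = (\<Sum>b\<in>B. sc (inverse s * c b) b)" .
    moreover have "\<forall>b\<in>B. inverse s * c b \<in> A"
      using c(2) A_int inverse_A[OF s(1,2)] A_closed(4) by blast
    ultimately show "z \<in> mspan sc A B"
      unfolding mspan_def by (intro CollectI exI[of _ "\<lambda>b. inverse s * c b"] conjI)
  qed
  show "mspan sc A B \<subseteq> loc (ok_span sc B)"
  proof
    fix z assume "z \<in> mspan sc A B"
    then obtain c where c: "z = (\<Sum>b\<in>B. sc (c b) b)" "\<forall>b\<in>B. c b \<in> A" by (auto simp: mspan_def)
    have "\<exists>s. algebraic_int s \<and> s \<notin> P \<and> (\<forall>x\<in>c ` B. algebraic_int (s * x))"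
      by (rule A_common_denominator) (use B c in auto)
    then obtain s where s: "algebraic_int s" "s \<notin> P" "\<forall>x\<in>c ` B. algebraic_int (s * x)"
      by (elim exE conjE)
    have "sc s z = (\<Sum>b\<in>B. sc (s * c b) b)" unfolding c(1) by (simp add: scale_sum_right)
    moreover have "\<forall>b\<in>B. algebraic_int (s * c b)" using s(3) by auto
    ultimately have "sc s z \<in> ok_span sc B"
      unfolding ok_span_def by (intro CollectI exI[of _ "\<lambda>b. s * c b"] conjI)
    then show "z \<in> loc (ok_span sc B)" by (rule locI[OF s(1,2)])
  qed
qed

lemma loc_star_order:
  assumes R: "star_order sc star R" and lr: "local_ring A p"
  shows "local_star_order A p sc star \<tau> \<nu> (loc R)"
proof -
  interpret L: local_ring A p by (rule lr)
  note RD = star_orderD[OF R]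
  obtain B where B: "finite B" "R = ok_span sc B" using RD(5) by blast
  show ?thesis
  proof
    show "1 \<in> loc R" using subset_loc RD(1) by blast
    show "\<exists>B. finite B \<and> loc R = mspan sc A B" using loc_mspan[OF B(1)] B by blast
    show "span (loc R) = UNIV" using span_mono[OF subset_loc[of R]] RD(6) by auto
    fix x assume "x \<in> loc R"
    then obtain s where s: "algebraic_int s" "s \<notin> P" "sc s x \<in> R" by (rule locE)
    have "sc s (star x) \<in> R" using RD(4)[OF s(3)] by (simp add: star_scale)
    then show "star x \<in> loc R" by (rule locI[OF s(1,2)])
    fix y assume "y \<in> loc R"
    then obtain t where t: "algebraic_int t" "t \<notin> P" "sc t y \<in> R" by (rule locE)
    have "sc (s * t) (x * y) = sc s x * sc t y" by (simp add: scale_mult_left scale_mult_right)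
    then have "sc (s * t) (x * y) \<in> R" using RD(3)[OF s(3) t(3)] by simp
    then show "x * y \<in> loc R" using s t by (intro locI[of "s * t"] algebraic_int_mult notP_mult)
  qed
qed

text \<open>The larger order is \<open>R + c (J \<inter> R)\<close> with \<open>c = s / p\<close>.
  Multiplication by \<open>c\<close> equals multiplication by \<open>1 / p\<close> up to a unit of the
  localization, but it maps \<open>P R\<close> into \<open>R\<close> itself (\<open>clear\<close>), so
  nothing changes at the other primes.\<close>

lemma enlargeable_not_maximal:
  assumes R: "star_order sc star R"
    and p: "p \<in> P" "p \<noteq> 0" and s: "algebraic_int s" "s \<notin> P" "\<forall>q\<in>P. algebraic_int (s * q / p)"
    and J: "J \<subseteq> loc R" "submod sc A J" "\<forall>x\<in>loc R. sc p x \<in> J" "\<forall>x\<in>J. star x \<in> J"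
      "\<forall>x\<in>loc R. \<forall>z\<in>J. x * z \<in> J \<and> z * x \<in> J" "\<forall>x\<in>J. \<forall>y\<in>J. sc (1 / p) (x * y) \<in> J"
      "\<exists>z\<in>J. sc (1 / p) z \<notin> loc R"
  shows "\<not> maximal_star_order sc star R"
proof -
  note RD = star_orderD[OF R]
  obtain B where B: "finite B" "R = ok_span sc B" using RD(5) by blast
  have Rloc: "x \<in> loc R" if "x \<in> R" for x using subset_loc that by blast
  \<comment> \<open>Multiplication by \<open>s / p\<close> takes the part of \<open>R\<close> divisible by
    \<open>p\<close> in the localization back into \<open>R\<close>.\<close>
  have clear: "sc (s / p) z \<in> R" if z: "z \<in> R" "sc (1 / p) z \<in> loc R" for z
  proof -
    obtain a where a: "algebraic_int a" "a \<notin> P" "sc a (sc (1 / p) z) \<in> R" using z(2) by (rule locE)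
    obtain b where b: "algebraic_int b" "1 - a * b \<in> P" using P_inverse[OF a(1,2)] by blast
    have "sc (s * b) (sc a (sc (1 / p) z)) + sc (s * (1 - a * b) / p) z \<in> R"
      by (intro RD(9,10) algebraic_int_mult s(1) b a z s(3)[rule_format])
    also have "sc (s * b) (sc a (sc (1 / p) z)) + sc (s * (1 - a * b) / p) z =
        sc (s * b * a * (1 / p) + s * (1 - a * b) / p) z"
      by (simp add: scale_left_distrib mult.assoc)
    also have "s * b * a * (1 / p) + s * (1 - a * b) / p = s / p"
      by (simp add: add_divide_distrib[symmetric] algebra_simps)
    finally show ?thesis .
  qed
  define I where "I = J \<inter> R"
  have SI: "submod sc alg_ints I"
    unfolding submod_def I_def using submodD[OF J(2)] RD A_int by simp
  obtain l :: int where l: "prime l" "\<forall>z. of_int z \<in> P \<longleftrightarrow> l dvd z"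
    using ex_prime by (elim exE conjE)
  have lP: "of_int l \<in> P" using l(2) by simp
  have "\<exists>B'. finite B' \<and> I = ok_span sc B'"
  proof (rule fg_of_multiple[OF nf l(1) B(1) SI])
    show "I \<subseteq> ok_span sc B" using B(2) by (auto simp: I_def)
    fix x assume "x \<in> ok_span sc B"
    then have x: "x \<in> R" using B(2) by simp
    have "sc (inverse s * (s * of_int l / p)) (sc p x) \<in> J"
      using s lP by (intro submodD(3)[OF J(2)] A_closed(4) inverse_A A_int J(3)[rule_format] Rloc x) simp_all
    moreover have "inverse s * (s * of_int l / p) * p = of_int l"
    proof -
      have "s \<noteq> 0" using s P_0 by auto
      then show ?thesis using p(2) by simp
    qed
    ultimately have "sc (of_int l) x \<in> J" by simp
    moreover have "sc (of_int l) x \<in> R" by (rule RD(10)[OF algebraic_int_of_int x])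
    ultimately show "sc (of_int l) x \<in> I" by (simp add: I_def)
  qed
  then obtain B' where B': "finite B'" "I = ok_span sc B'" by blast
  define c where "c = s / p"
  define W where "W = {x + sc c j |x j. x \<in> R \<and> j \<in> I}"
  have WI: "x + sc c j \<in> W" if "x \<in> R" "j \<in> I" for x j using that by (auto simp: W_def)
  have WE: "\<exists>x j. w = x + sc c j \<and> x \<in> R \<and> j \<in> I" if "w \<in> W" for w using that by (auto simp: W_def)
  have RW: "x \<in> W" if "x \<in> R" for x using WI[OF that submodD(1)[OF SI]] by simp
  have SW: "submod sc alg_ints W"
    unfolding submod_def
  proof (intro conjI ballI)
    show "0 \<in> W" by (rule RW[OF RD(8)])
    fix w assume "w \<in> W"
    then obtain x j where w: "w = x + sc c j" "x \<in> R" "j \<in> I" using WE by blast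
    {
      fix w' assume "w' \<in> W"
      then obtain x' j' where w': "w' = x' + sc c j'" "x' \<in> R" "j' \<in> I" using WE by blast
      have "w + w' = (x + x') + sc c (j + j')" by (simp add: w w' scale_right_distrib algebra_simps)
      then show "w + w' \<in> W"
        using WI[OF RD(9)[OF w(2) w'(2)] submodD(2)[OF SI w(3) w'(3)]] by simp
    }
    fix a :: 'k assume a: "a \<in> alg_ints"
    have "sc a w = sc a x + sc c (sc a j)" by (simp add: w scale_right_distrib mult.commute)
    then show "sc a w \<in> W" using WI[OF RD(10)[of a, OF _ w(2)] submodD(3)[OF SI a w(3)]] a by simp
  qed
  have mulI: "x * j \<in> I" "j * x \<in> I" if "x \<in> R" "j \<in> I" for x j
    using that J(5) Rloc RD(3) by (auto simp: I_def)
  have sqI: "sc c (j * j') \<in> I" if "j \<in> I" "j' \<in> I" for j j'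
  proof -
    have d: "sc (1 / p) (j * j') \<in> J" using that J(6) by (simp add: I_def)
    then have "sc s (sc (1 / p) (j * j')) \<in> J" by (rule submodD(3)[OF J(2) A_int[OF s(1)]])
    moreover have "sc c (j * j') \<in> R" unfolding c_def
      by (rule clear) (use that d J(1) RD(3) in \<open>auto simp: I_def\<close>)
    ultimately show ?thesis by (simp add: I_def c_def)
  qed
  have "star_order sc star W"
  proof (rule star_orderI[OF SW])
    show "1 \<in> W" by (rule RW[OF RD(1)])
    show "span W = UNIV" using span_mono[of R W] RW RD(6) by auto
    show "finite (B \<union> sc c ` B')" using B B' by simp
    show "W = ok_span sc (B \<union> sc c ` B')"
    proof (rule fg_sum[OF B(1) finite_imageI[OF B'(1)] SW])
      show "B \<subseteq> W" using mspan_base[OF subring_algebraic_int B(1)] B(2) RW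
        unfolding ok_span_mspan by auto
      show "sc c ` B' \<subseteq> W"
      proof
        fix y assume "y \<in> sc c ` B'"
        then obtain b where b: "b \<in> B'" "y = sc c b" by blast
        have "b \<in> I" using mspan_base[OF subring_algebraic_int B'(1) b(1)] B'(2) by (simp add: ok_span_mspan)
        then show "y \<in> W" using WI[OF RD(8)] b(2) by simp
      qed
      fix w assume "w \<in> W"
      then obtain x j where w: "w = x + sc c j" "x \<in> R" "j \<in> I" using WE by blast
      obtain f where f: "j = (\<Sum>b\<in>B'. sc (f b) b)" "\<forall>b\<in>B'. algebraic_int (f b)"
        using w(3) B'(2) by (auto simp: ok_span_def)
      have SC: "submod sc alg_ints (mspan sc alg_ints (sc c ` B'))"
        by (rule mspan_submod[OF subring_algebraic_int])
      have "sc c j = (\<Sum>b\<in>B'. sc (f b) (sc c b))"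
        unfolding f(1) by (simp add: scale_sum_right mult.commute)
      also have "\<dots> \<in> mspan sc alg_ints (sc c ` B')"
        by (intro submod_sum[OF SC] submodD(3)[OF SC] mspan_base[OF subring_algebraic_int])
           (use f(2) B'(1) in auto)
      finally show "\<exists>y\<in>ok_span sc B. \<exists>z\<in>ok_span sc (sc c ` B'). w = y + z"
        using w B(2) unfolding ok_span_mspan by blast
    qed
    fix w assume "w \<in> W"
    then obtain x j where w: "w = x + sc c j" "x \<in> R" "j \<in> I" using WE by blast
    have "star j \<in> I" using w(3) J(4) RD(4) by (simp add: I_def)
    then show "star w \<in> W" using WI[OF RD(4)[OF w(2)]] by (simp add: w star_add star_scale)
    fix w' assume "w' \<in> W"
    then obtain x' j' where w': "w' = x' + sc c j'" "x' \<in> R" "j' \<in> I" using WE by blast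
    have "w * w' = x * x' + sc c (x * j' + j * x' + sc c (j * j'))"
      by (simp add: w w' algebra_simps scale_mult_left scale_mult_right scale_right_distrib)
    moreover have "x * j' + j * x' + sc c (j * j') \<in> I"
      by (intro submodD(2)[OF SI] mulI sqI w w')
    ultimately show "w * w' \<in> W" using WI[OF RD(3)[OF w(2) w'(2)]] by simp
  qed
  moreover have "R \<subset> W"
  proof -
    obtain z where z: "z \<in> J" "sc (1 / p) z \<notin> loc R" using J(7) by blast
    obtain a where a: "algebraic_int a" "a \<notin> P" "sc a z \<in> R" using J(1) z(1) by (meson locE subsetD)
    have "sc a z \<in> I" using submodD(3)[OF J(2) A_int[OF a(1)] z(1)] a(3) by (simp add: I_def)
    then have "sc c (sc a z) \<in> W" using WI[OF RD(8)] by (simp del: scale_scale)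
    moreover have "sc c (sc a z) \<notin> R"
    proof
      assume "sc c (sc a z) \<in> R"
      then have "sc (s * a) (sc (1 / p) z) \<in> R" by (simp add: c_def mult.commute)
      then have "sc (1 / p) z \<in> loc R" using s a by (intro locI[of "s * a"] algebraic_int_mult notP_mult)
      then show False using z(2) by blast
    qed
    ultimately show ?thesis using RW by blast
  qed
  ultimately show ?thesis unfolding maximal_star_order_def by blast
qed

lemma maximal_loc_comparable:
  assumes R: "maximal_star_order sc star R" and R': "star_order sc star R'"
    and sym: "{x \<in> R. star x = x} = {x \<in> R'. star x = x}"
  shows "loc R \<subseteq> loc R' \<or> loc R' \<subseteq> loc R"
proof -
  obtain p s where p: "p \<in> P" "p \<noteq> 0" and s: "algebraic_int s" "s \<notin> P" "\<forall>q\<in>P. algebraic_int (s * q / p)"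
    using ex_uniformizer by (elim exE conjE)
  have lr: "local_ring A p" by (rule local_ring[OF p s])
  have so: "star_order sc star R" using R by (simp add: maximal_star_order_def)
  have locsym: "z \<in> loc S'" if z: "z \<in> loc S" "star z = z" and S: "{x \<in> S. star x = x} = {x \<in> S'. star x = x}"
    for z S S'
  proof -
    obtain t where t: "algebraic_int t" "t \<notin> P" "sc t z \<in> S" using z(1) by (rule locE)
    have "star (sc t z) = sc t z" using z(2) by (simp add: star_scale)
    then have "sc t z \<in> S'" using S t(3) by blast
    then show ?thesis by (rule locI[OF t(1,2)])
  qed
  have "{x \<in> loc R. star x = x} = {x \<in> loc R'. star x = x}"
    using locsym[OF _ _ sym] locsym[OF _ _ sym[symmetric]] by blast
  from local_star_orders_comparable[OF loc_star_order[OF so lr] loc_star_order[OF R' lr] this]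
  show ?thesis
  proof (elim disjE exE conjE)
    fix J
    assume J: "J \<subseteq> loc R" "submod sc A J" "\<forall>x\<in>loc R. sc p x \<in> J" "\<forall>x\<in>J. star x \<in> J"
      "\<forall>x\<in>loc R. \<forall>z\<in>J. x * z \<in> J \<and> z * x \<in> J" "\<forall>x\<in>J. \<forall>y\<in>J. sc (1 / p) (x * y) \<in> J"
      "\<exists>z\<in>J. sc (1 / p) z \<notin> loc R"
    from enlargeable_not_maximal[OF so p s J] R show ?thesis by blast
  qed simp_all
qed

end

context involution_algebra
begin

text \<open>Both orders equal their sum \<open>W\<close>. The sum is closed under mixed products since one
  localization contains the other at every maximal ideal.\<close>

theorem maximal_star_order_unique:
  assumes nf: "number_field TYPE('k)"
    and R: "maximal_star_order sc star R" and R': "maximal_star_order sc star R'"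
    and sym: "{x \<in> R. star x = x} = {x \<in> R'. star x = x}"
  shows "R = R'"
proof -
  have so: "star_order sc star R" "star_order sc star R'"
    using R R' by (simp_all add: maximal_star_order_def)
  note D = star_orderD[OF so(1)] and D' = star_orderD[OF so(2)]
  obtain B where B: "finite B" "R = ok_span sc B" using D(5) by blast
  obtain B' where B': "finite B'" "R' = ok_span sc B'" using D'(5) by blast
  define W where "W = {x + y |x y. x \<in> R \<and> y \<in> R'}"
  have WI: "x + y \<in> W" if "x \<in> R" "y \<in> R'" for x y using that by (auto simp: W_def)
  have WE: "\<exists>x y. w = x + y \<and> x \<in> R \<and> y \<in> R'" if "w \<in> W" for w using that by (auto simp: W_def)
  have RW: "x \<in> W" if "x \<in> R" for x using WI[OF that D'(8)] by simp
  have RW': "x \<in> W" if "x \<in> R'" for x using WI[OF D(8) that] by simp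
  have SW: "submod sc alg_ints W"
    unfolding submod_def
  proof (intro conjI ballI)
    show "0 \<in> W" by (rule RW[OF D(8)])
    fix w assume "w \<in> W"
    then obtain x y where w: "w = x + y" "x \<in> R" "y \<in> R'" using WE by blast
    {
      fix w' assume "w' \<in> W"
      then obtain x' y' where w': "w' = x' + y'" "x' \<in> R" "y' \<in> R'" using WE by blast
      have "w + w' = (x + x') + (y + y')" by (simp add: w w')
      then show "w + w' \<in> W" using WI[OF D(9)[OF w(2) w'(2)] D'(9)[OF w(3) w'(3)]] by simp
    }
    fix a :: 'k assume a: "a \<in> alg_ints"
    then show "sc a w \<in> W" using WI[OF D(10)[of a, OF _ w(2)] D'(10)[of a, OF _ w(3)]]
      by (simp add: w scale_right_distrib)
  qed
  note WD = submodD[OF SW]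
  \<comment> \<open>The multipliers carrying a mixed product into the sum form an ideal that lies in no maximal ideal.\<close>
  have mixed: "x * y \<in> W \<and> y * x \<in> W" if x: "x \<in> R" and y: "y \<in> R'" for x y
  proof -
    define I where "I = {c. algebraic_int c \<and> sc c (x * y) \<in> W \<and> sc c (y * x) \<in> W}"
    have II: "int_ideal I"
      unfolding int_ideal_def
    proof (intro conjI ballI allI impI)
      show "I \<subseteq> Collect algebraic_int" by (auto simp: I_def)
      show "0 \<in> I" by (simp add: I_def WD)
      show "a + b \<in> I" if "a \<in> I" "b \<in> I" for a b
        using that WD by (simp add: I_def algebraic_int_add scale_left_distrib)
      fix r a :: 'k assume r: "algebraic_int r" and a: "a \<in> I"
      have "sc r (sc a (x * y)) \<in> W" "sc r (sc a (y * x)) \<in> W"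
        using r a by (auto simp: I_def intro!: WD(3) simp del: scale_scale)
      then show "r * a \<in> I" using r a by (simp add: I_def algebraic_int_mult)
    qed
    have "1 \<in> I"
    proof (rule ccontr)
      assume "1 \<notin> I"
      then obtain P where P: "max_ideal P" "I \<subseteq> P" using ex_max_ideal[OF II] by blast
      interpret order_at_prime P sc star \<tau> \<nu>
        by unfold_locales (rule nf, rule P(1))
      have in1: False if "loc R \<subseteq> loc R'"
      proof -
        have "x \<in> loc R'" using that subset_loc x by blast
        then obtain s where s: "algebraic_int s" "s \<notin> P" "sc s x \<in> R'" by (rule locE)
        have "sc s x * y \<in> W" "y * sc s x \<in> W" using D'(3) s(3) y RW' by blast+
        then have "s \<in> I" using s(1) by (simp add: I_def scale_mult_left scale_mult_right)
        then show False using P(2) s(2) by blast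
      qed
      have in2: False if "loc R' \<subseteq> loc R"
      proof -
        have "y \<in> loc R" using that subset_loc y by blast
        then obtain s where s: "algebraic_int s" "s \<notin> P" "sc s y \<in> R" by (rule locE)
        have "x * sc s y \<in> W" "sc s y * x \<in> W" using D(3) s(3) x RW by blast+
        then have "s \<in> I" using s(1) by (simp add: I_def scale_mult_left scale_mult_right)
        then show False using P(2) s(2) by blast
      qed
      show False using maximal_loc_comparable[OF R so(2) sym] in1 in2 by blast
    qed
    then show ?thesis by (simp add: I_def)
  qed
  have "star_order sc star W"
  proof (rule star_orderI[OF SW])
    show "1 \<in> W" by (rule RW[OF D(1)])
    show "span W = UNIV" using span_mono[of R W] RW D(6) by auto
    show "finite (B \<union> B')" using B B' by simp
    show "W = ok_span sc (B \<union> B')"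
    proof (rule fg_sum[OF B(1) B'(1) SW])
      show "B \<subseteq> W" using mspan_base[OF subring_algebraic_int B(1)] B(2) RW
        unfolding ok_span_mspan by auto
      show "B' \<subseteq> W" using mspan_base[OF subring_algebraic_int B'(1)] B'(2) RW'
        unfolding ok_span_mspan by auto
      show "\<exists>y\<in>ok_span sc B. \<exists>z\<in>ok_span sc B'. w = y + z" if "w \<in> W" for w
        using WE[OF that] B(2) B'(2) by blast
    qed
    fix w assume "w \<in> W"
    then obtain x y where w: "w = x + y" "x \<in> R" "y \<in> R'" using WE by blast
    show "star w \<in> W" using WI[OF D(4)[OF w(2)] D'(4)[OF w(3)]] by (simp add: w star_add)
    fix w' assume "w' \<in> W"
    then obtain x' y' where w': "w' = x' + y'" "x' \<in> R" "y' \<in> R'" using WE by blast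
    have "x * x' + x * y' + (y * x' + y * y') \<in> W"
      using mixed[OF w(2) w'(3)] mixed[OF w'(2) w(3)] RW[OF D(3)[OF w(2) w'(2)]] RW'[OF D'(3)[OF w(3) w'(3)]]
      by (intro WD(2)) simp_all
    then show "w * w' \<in> W" by (simp add: w w' algebra_simps)
  qed
  moreover have "R \<subseteq> W" "R' \<subseteq> W" using RW RW' by blast+
  ultimately show ?thesis using R R' unfolding maximal_star_order_def by blast
qed

end

section \<open>Quaternion bases adapted to the involution\<close>

locale quaternion_coords = algebra_over sc
  for sc :: "'k::field_char_0 \<Rightarrow> 'h::ring_1 \<Rightarrow> 'h" +
  fixes a b :: 'k and i j :: 'h
  assumes basis: "quaternion_basis sc a b i j"
begin

sublocale quaternion_algebra sc
  by unfold_locales (use basis in blast)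

abbreviation q :: "'k \<Rightarrow> 'k \<Rightarrow> 'k \<Rightarrow> 'k \<Rightarrow> 'h" where "q \<equiv> qcomb sc i j"

lemma a_nz: "a \<noteq> 0" and b_nz: "b \<noteq> 0"
  using basis by (auto simp: quaternion_basis_def)

lemma q_mult: "q t u v w * q t' u' v' w' =
    q (t * t' + a * u * u' + b * v * v' - a * b * w * w')
      (t * u' + u * t' - b * v * w' + b * w * v')
      (t * v' + v * t' + a * u * w' - a * w * u')
      (t * w' + w * t' + u * v' - v * u')"
  unfolding qcomb_def
  by (simp add: distrib_left distrib_right scale_mult_left scale_mult_right qbasis_mult[OF basis]
      scale_left_diff_distrib scale_left_distrib algebra_simps)

lemma q_add: "q t u v w + q t' u' v' w' = q (t + t') (u + u') (v + v') (w + w')"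
  by (simp add: qcomb_def scale_left_distrib)

lemma q_minus: "- q t u v w = q (- t) (- u) (- v) (- w)"
  by (simp add: qcomb_def)

lemma q_scale: "sc c (q t u v w) = q (c * t) (c * u) (c * v) (c * w)"
  by (simp add: qcomb_def scale_right_distrib)

lemma q_scalar: "sc c 1 = q c 0 0 0" by (simp add: qcomb_def)

lemma q_1: "1 = q 1 0 0 0" by (simp add: qcomb_def)

lemma generators_q: "q 0 1 0 0 = i" "q 0 0 1 0 = j" "q 0 0 0 1 = i * j"
  by (simp_all add: qcomb_def)

lemma generator_mult_q:
  "i * q t u v w = q (a * u) t (a * w) v"
  "q t u v w * i = q (a * u) t (- (a * w)) (- v)"
  "j * q t u v w = q (b * v) (- (b * w)) t (- u)"
  "q t u v w * j = q (b * v) (b * w) t u"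
  "i * j * q t u v w = q (- (a * b * w)) (b * v) (- (a * u)) t"
  "q t u v w * (i * j) = q (- (a * b * w)) (- (b * v)) (a * u) t"
  using q_mult[of 0 1 0 0 t u v w] q_mult[of t u v w 0 1 0 0] q_mult[of 0 0 1 0 t u v w]
    q_mult[of t u v w 0 0 1 0] q_mult[of 0 0 0 1 t u v w] q_mult[of t u v w 0 0 0 1]
  by (simp_all add: generators_q)

lemma qE: obtains t u v w where "x = q t u v w"
  using qcomb_exists[OF basis] by blast

lemma q_eq_iff: "q t u v w = q t' u' v' w' \<longleftrightarrow> t = t' \<and> u = u' \<and> v = v' \<and> w = w'"
proof
  assume "q t u v w = q t' u' v' w'"
  then have "q (t - t') (u - u') (v - v') (w - w') = 0" by (simp flip: qcomb_diff)
  from qcomb_eq_0[OF basis this] show "t = t' \<and> u = u' \<and> v = v' \<and> w = w'" by simp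
qed simp

lemma q_eq_0_iff: "q t u v w = 0 \<longleftrightarrow> t = 0 \<and> u = 0 \<and> v = 0 \<and> w = 0"
  using q_eq_iff[of t u v w 0 0 0 0] by (simp add: qcomb_def)

definition pure :: "'h \<Rightarrow> bool" where "pure x \<longleftrightarrow> (\<exists>u v w. x = q 0 u v w)"

lemma pureE:
  assumes "pure x" obtains u v w where "x = q 0 u v w"
  using assms unfolding pure_def by blast

lemma pure_square: "pure x \<Longrightarrow> \<exists>m. x * x = sc m 1"
  unfolding pure_def using qcomb_pure_square[OF basis] by blast

lemma pure_add: "pure x \<Longrightarrow> pure y \<Longrightarrow> pure (x + y)"
  unfolding pure_def by (auto simp: q_add) (metis add_0)

lemma pure_minus: "pure x \<Longrightarrow> pure (- x)"
  unfolding pure_def by (elim exE) (metis q_minus minus_zero)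

lemma pure_scale: "pure x \<Longrightarrow> pure (sc c x)"
  unfolding pure_def by (elim exE) (metis q_scale mult_zero_right)

lemma scalar_pure_decomp: "\<exists>t p. pure p \<and> x = sc t 1 + p"
proof -
  obtain t u v w where "x = q t u v w" by (rule qE)
  then have "x = sc t 1 + q 0 u v w" by (simp add: q_scalar q_add)
  then show ?thesis unfolding pure_def by blast
qed

lemma pure_scalar: "pure (sc c 1) \<Longrightarrow> c = 0"
  unfolding pure_def by (auto simp: q_scalar q_eq_iff)

lemma qconj_pure: "pure p \<Longrightarrow> qconj sc (sc t 1 + p) = sc t 1 - p"
  by (elim pureE) (simp add: q_scalar q_add q_minus qconj_qcomb[OF basis] diff_conv_add_uminus del: add_uminus_conv_diff)

lemma anticomm_scalar:
  assumes "pure x" "pure y"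
  shows "\<exists>m. x * y + y * x = sc m 1"
proof -
  obtain m n l where "(x + y) * (x + y) = sc m 1" "x * x = sc n 1" "y * y = sc l 1"
    using pure_square assms pure_add by meson
  moreover have "x * y + y * x = (x + y) * (x + y) - x * x - y * y" by (simp add: algebra_simps)
  ultimately have "x * y + y * x = sc (m - n - l) 1" by (simp add: scale_left_diff_distrib)
  then show ?thesis by blast
qed

lemma nondegenerate:
  assumes "pure y" "y \<noteq> 0"
  shows "\<exists>z. pure z \<and> y * z + z * y \<noteq> 0"
proof -
  obtain u v w where y: "y = q 0 u v w" using assms(1) by (rule pureE)
  have p: "pure (q 0 u v w)" for u v w unfolding pure_def by blast
  have "u \<noteq> 0 \<or> v \<noteq> 0 \<or> w \<noteq> 0" using assms(2) y q_eq_0_iff by auto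
  then show ?thesis
  proof (elim disjE)
    assume "u \<noteq> 0"
    then have "y * q 0 1 0 0 + q 0 1 0 0 * y \<noteq> 0" using a_nz by (simp add: y q_mult q_add q_eq_0_iff)
    then show ?thesis using p by blast
  next
    assume "v \<noteq> 0"
    then have "y * q 0 0 1 0 + q 0 0 1 0 * y \<noteq> 0" using b_nz by (simp add: y q_mult q_add q_eq_0_iff)
    then show ?thesis using p by blast
  next
    assume "w \<noteq> 0"
    then have "y * q 0 0 0 1 + q 0 0 0 1 * y \<noteq> 0" using a_nz b_nz by (simp add: y q_mult q_add q_eq_0_iff)
    then show ?thesis using p by blast
  qed
qed

text \<open>Commutators with \<open>x\<close> anticommute with \<open>x\<close> if \<open>x\<^sup>2\<close> is a
  scalar, and the squares of the commutators with \<open>i\<close>, \<open>j\<close> and \<open>i j\<close>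
  can vanish simultaneously only if \<open>x = 0\<close>.\<close>

lemma ex_anisotropic_commutator:
  assumes "pure x" "x * x \<noteq> 0"
  shows "\<exists>e. pure (x * e - e * x) \<and> (x * e - e * x) * (x * e - e * x) \<noteq> 0"
proof -
  obtain u v w where x: "x = q 0 u v w" using assms(1) by (rule pureE)
  have p: "pure (x * e - e * x)" for e
  proof -
    obtain t' u' v' w' where e: "e = q t' u' v' w'" by (rule qE)
    show ?thesis unfolding pure_def x e q_mult by (simp add: qcomb_diff q_eq_iff)
  qed
  show ?thesis
  proof (rule ccontr)
    assume "\<not> ?thesis"
    then have z: "(x * e - e * x) * (x * e - e * x) = 0" for e using p by blast
    have 1: "v * v = a * (w * w)"
      using z[of "q 0 1 0 0"] a_nz b_nz by (simp add: x q_mult qcomb_diff q_eq_0_iff)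
        (simp add: algebra_simps)
    have 2: "u * u = b * (w * w)"
      using z[of "q 0 0 1 0"] a_nz b_nz by (simp add: x q_mult qcomb_diff q_eq_0_iff)
        (simp add: algebra_simps)
    have "a * (a * (b * (u * (u * 4)))) + a * (b * (b * (v * (v * 4)))) = 0"
      using z[of "q 0 0 0 1"] by (simp add: x q_mult qcomb_diff q_eq_0_iff) (simp add: algebra_simps)
    moreover have "a * (a * (b * (u * (u * 4)))) + a * (b * (b * (v * (v * 4)))) =
        4 * a * b * (a * (u * u) + b * (v * v))"
      by (simp add: algebra_simps)
    ultimately have 3: "a * (u * u) + b * (v * v) = 0" using a_nz b_nz by simp
    have "w = 0" using 3 unfolding 1 2 using a_nz b_nz by (simp add: mult.left_commute)
    then show False using 1 2 assms(2) by (simp add: x q_mult q_eq_0_iff)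
  qed
qed

lemma basis_card: "card {1, i, j, i * j} = 4" "finite {1, i, j, i * j}"
  using basis distinct_card[of "[1, i, j, i * j]"] by (auto simp: quaternion_basis_def)

lemma basis_ind: "independent {1, i, j, i * j}" and basis_span: "span {1, i, j, i * j} = UNIV"
  using basis by (auto simp: quaternion_basis_def)

text \<open>Conjugation by \<open>i'\<close> and by \<open>j'\<close> separates the four terms of a linear
  relation; spanning follows by comparing cardinalities with the given basis.\<close>

lemma new_basis:
  assumes nz: "a' \<noteq> 0" "b' \<noteq> 0" and sq: "i' * i' = sc a' 1" "j' * j' = sc b' 1"
    and anti: "j' * i' = - (i' * j')"
  shows "quaternion_basis sc a' b' i' j'"
proof -
  have zero: "t = 0 \<and> u = 0 \<and> v = 0 \<and> w = 0"
    if r: "sc t 1 + sc u i' + sc v j' + sc w (i' * j') = 0" for t u v w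
  proof -
    have iij: "i' * (i' * j') = sc a' j'" by (simp add: mult.assoc[symmetric] sq scale_mult_left)
    have iji: "i' * j' * i' = - sc a' j'" by (simp add: mult.assoc anti iij)
    have iji': "i' * (j' * i') = - sc a' j'" using iji by (simp add: mult.assoc)
    have iiji: "i' * (i' * (j' * i')) = - sc a' (i' * j')"
      by (simp add: iji' scale_mult_right)
    define X where "X = sc t 1 + sc u i'"
    define Y where "Y = sc v j' + sc w (i' * j')"
    have XY: "X + Y = 0" using r by (simp add: X_def Y_def add.assoc)
    have "i' * X * i' = sc a' X"
      by (simp add: X_def distrib_left distrib_right scale_mult_left scale_mult_right sq scale_right_distrib mult.commute)
    moreover have "i' * Y * i' = - sc a' Y"
      by (simp add: Y_def distrib_left distrib_right scale_mult_left scale_mult_right scale_right_distrib mult.assoc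
          iji' iiji mult.commute[of a'])
    moreover have "i' * X * i' + i' * Y * i' = i' * (X + Y) * i'" by (simp add: algebra_simps)
    ultimately have "sc a' X - sc a' Y = 0" using XY by simp
    then have "sc a' (X - Y) = 0" by (simp add: scale_right_diff_distrib)
    then have "X - Y = 0" using nz by simp
    then have X: "X = 0" and Y: "Y = 0"
    proof -
      assume "X - Y = 0"
      then have "X + X = 0" using XY by (simp add: eq_diff_eq)
      then have "sc 2 X = 0" using scale_left_distrib[of 1 1 X] by simp
      then show "X = 0" by simp
      then show "Y = 0" using XY by simp
    qed
    have key: "t' = 0 \<and> u' = 0" if z: "sc t' 1 + sc u' i' = 0" for t' u'
    proof -
      have "j' * (sc t' 1 + sc u' i') * j' = 0" by (simp add: z)
      moreover have "j' * (sc t' 1 + sc u' i') * j' = sc b' (sc t' 1 - sc u' i')"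
        by (simp add: distrib_left distrib_right scale_mult_left scale_mult_right sq scale_right_diff_distrib
            left_diff_distrib anti mult.assoc mult.commute[of b'])
      ultimately have "sc t' 1 - sc u' i' = 0" using nz by simp
      then have "sc t' 1 + sc t' 1 = 0" using z by (simp add: eq_diff_eq)
      then have "sc (t' + t') 1 = sc 0 (1::'h)" by (simp only: scale_left_distrib scale_zero_left)
      then have "t' + t' = 0" by (rule scale_right_imp_eq[OF one_neq_zero])
      then have t: "t' = 0" by simp
      have "i' \<noteq> 0"
      proof
        assume "i' = 0"
        then have "sc a' (1::'h) = 0" using sq by simp
        then show False using nz by simp
      qed
      then show ?thesis using z t by simp
    qed
    have "(sc v 1 + sc w i') * j' * j' = 0"
      using Y by (simp add: Y_def distrib_right scale_mult_left)
    then have "sc b' (sc v 1 + sc w i') = 0" by (simp add: mult.assoc sq scale_mult_right)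
    then have "sc v 1 + sc w i' = 0" using nz by simp
    then show ?thesis using key[of v w] key[of t u] X unfolding X_def by simp
  qed
  have dist: "distinct [1, i', j', i' * j']"
    using zero[of 1 "-1" 0 0] zero[of 1 0 "-1" 0] zero[of 1 0 0 "-1"] zero[of 0 1 "-1" 0]
      zero[of 0 1 0 "-1"] zero[of 0 0 1 "-1"] by auto
  have ind: "independent {1, i', j', i' * j'}"
  proof -
    have "\<forall>v\<in>{1, i', j', i' * j'}. f v = 0" if "(\<Sum>v\<in>{1, i', j', i' * j'}. sc (f v) v) = 0" for f
    proof -
      have "(\<Sum>v\<in>{1, i', j', i' * j'}. sc (f v) v) =
          sc (f 1) 1 + sc (f i') i' + sc (f j') j' + sc (f (i' * j')) (i' * j')"
        using dist by (auto simp: add.assoc)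
      then show ?thesis using zero that by auto
    qed
    then show ?thesis by (subst dependent_finite) auto
  qed
  have "span {1, i', j', i' * j'} = UNIV"
  proof -
    have c: "card {1, i', j', i' * j'} = 4" using dist distinct_card[of "[1, i', j', i' * j']"] by simp
    define S where "S = {1, i', j', i' * j'}"
    have S: "independent S" "finite S" "card S = 4" using ind c by (simp_all add: S_def)
    have "x \<in> span S" for x
    proof (rule ccontr)
      assume x: "x \<notin> span S"
      then have "independent (insert x S)" by (rule independent_insertI[OF _ S(1)])
      then have "card (insert x S) \<le> 4"
        using independent_span_bound[OF basis_card(2), of "insert x S", unfolded basis_span basis_card(1)]
        by blast
      moreover have "x \<notin> S" using x by (metis span_base)
      ultimately show False using S(2,3) by simp
    qed
    then have "span S = UNIV" by blast
    then show ?thesis by (simp only: S_def)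
  qed
  then show ?thesis using assms dist ind by (simp add: quaternion_basis_def)
qed

end

locale orthogonal_involution_algebra = quaternion_algebra sc
  for sc :: "'k::field_char_0 \<Rightarrow> 'h::ring_1 \<Rightarrow> 'h" +
  fixes star :: "'h \<Rightarrow> 'h"
  assumes orth: "orthogonal_involution sc star"
begin

lemma star_linear: "Vector_Spaces.linear sc sc star"
  using orth by (simp add: orthogonal_involution_def)

lemma st_add: "star (x + y) = star x + star y" and st_scale: "star (sc c x) = sc c (star x)"
proof -
  interpret L: Vector_Spaces.linear sc sc star by (rule star_linear)
  show "star (x + y) = star x + star y" "star (sc c x) = sc c (star x)"
    by (rule L.add, rule L.scale)
qed

lemma st_mult: "star (x * y) = star y * star x" and st_star: "star (star x) = x"
  and st_neq: "star \<noteq> qconj sc"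
  using orth unfolding orthogonal_involution_def by simp_all

lemma st_1: "star 1 = 1"
  by (metis mult.right_neutral st_mult st_star mult_1_left)

lemma st_0: "star 0 = 0"
  using st_add[of 0 0] by simp

lemma st_minus: "star (- x) = - star x"
  using st_add[of x "- x"] by (simp add: st_0 eq_neg_iff_add_eq_0 add.commute)

lemma st_diff: "star (x - y) = star x - star y"
  using st_add[of x "- y"] by (simp add: st_minus)

lemma st_split:
  obtains p m where "x = p + m" "star p = p" "star m = - m" "p = sc (1 / 2) (x + star x)" "m = sc (1 / 2) (x - star x)"
proof
  have two: "sc (1/2) (y + y) = y" for y
    by (simp add: scale_right_distrib scale_left_distrib[symmetric])
  have "sc (1 / 2) (x + star x) + sc (1 / 2) (x - star x) = sc (1 / 2) (x + x)"
    by (simp only: scale_right_distrib[symmetric]) simp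
  then show "x = sc (1 / 2) (x + star x) + sc (1 / 2) (x - star x)" by (simp add: two)
  show "star (sc (1 / 2) (x + star x)) = sc (1 / 2) (x + star x)"
    by (simp add: st_scale st_add st_star add.commute)
  show "star (sc (1 / 2) (x - star x)) = - sc (1 / 2) (x - star x)"
    by (simp only: st_scale st_diff st_star) (simp add: scale_right_diff_distrib)
qed (rule refl)+

text \<open>The involution preserves the pure quaternions, and its two eigenspaces there are orthogonal for the
  anticommutator form. As it differs from the standard involution it fixes some nonzero pure element, and
  nondegeneracy provides a fixed pure \<open>i\<close> with nonzero square. Among the pure elements
  anticommuting with \<open>i\<close> there is a \<open>c\<close> with nonzero square; its fixed part
  \<open>p\<close> or its skew part \<open>m\<close> has nonzero square as well. One takes \<open>j =
  p\<close> or \<open>j = i m\<close>, which is fixed since \<open>star m = - m\<close> and \<open>m\<close>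
  anticommutes with \<open>i\<close>.\<close>

lemma ex_symmetric_basis:
  "\<exists>a b i j. quaternion_basis sc a b i j \<and> star i = i \<and> star j = j"
proof -
  obtain a0 b0 i0 j0 where B0: "quaternion_basis sc a0 b0 i0 j0" using ex_quaternion_basis by blast
  interpret Q: quaternion_coords sc a0 b0 i0 j0 by unfold_locales (rule B0)
  have st_pure: "Q.pure (star p)" if p: "Q.pure p" for p
  proof -
    obtain m where m: "p * p = sc m 1" using Q.pure_square[OF p] by blast
    obtain t r where tr: "Q.pure r" "star p = sc t 1 + r" using Q.scalar_pure_decomp by blast
    obtain n where n: "r * r = sc n 1" using Q.pure_square[OF tr(1)] by blast
    have "star p * star p = sc m 1" by (simp add: st_mult[symmetric] m st_scale st_1)
    then have "sc (t * t) 1 + sc t r + sc t r + sc n 1 = sc m 1"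
      unfolding tr(2) by (simp add: distrib_left distrib_right scale_mult_left scale_mult_right scale_right_distrib n add.assoc)
    then have "sc (t + t) r = sc (m - t * t - n) 1"
      unfolding scale_left_distrib scale_left_diff_distrib by (simp add: algebra_simps)
    moreover have "Q.pure (sc (t + t) r)" by (rule Q.pure_scale[OF tr(1)])
    ultimately have z: "sc (t + t) r = 0" using Q.pure_scalar[of "m - t * t - n"] by simp
    show ?thesis
    proof (cases "t = 0")
      case True
      then show ?thesis using tr by simp
    next
      case False
      then have "r = 0" using z by simp
      then have "star p = sc t 1" using tr by simp
      then have "p = sc t 1" using st_star[of p] by (simp add: st_scale st_1)
      then show ?thesis using p False Q.pure_scalar by blast
    qed
  qed
  have orth_eig: "p * m + m * p = 0" if pm: "Q.pure p" "Q.pure m" "star p = p" "star m = - m" for p m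
  proof -
    obtain c where c: "p * m + m * p = sc c 1" using Q.anticomm_scalar[OF pm(1,2)] by blast
    have "star (p * m + m * p) = - (p * m + m * p)" by (simp add: st_add st_mult pm)
    then have "sc c 1 = - sc c (1::'h)" unfolding c by (simp add: st_scale st_1)
    then have "sc (c + c) 1 = sc 0 (1::'h)"
      by (simp only: scale_left_distrib eq_neg_iff_add_eq_0 scale_zero_left)
    then have "c + c = 0" by (rule scale_right_imp_eq[OF one_neq_zero])
    then have "c = 0" by simp
    then show ?thesis using c by simp
  qed
  have split_pure: "\<exists>p m. x = p + m \<and> Q.pure p \<and> Q.pure m \<and> star p = p \<and> star m = - m \<and>
      p = sc (1 / 2) (x + star x) \<and> m = sc (1 / 2) (x - star x)" if x: "Q.pure x" for x
  proof -
    obtain p m where pm: "x = p + m" "star p = p" "star m = - m"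
      "p = sc (1 / 2) (x + star x)" "m = sc (1 / 2) (x - star x)" by (rule st_split)
    have "Q.pure p" "Q.pure m"
      using Q.pure_scale[OF Q.pure_add[OF x st_pure[OF x]]] Q.pure_scale[OF Q.pure_add[OF x Q.pure_minus[OF st_pure[OF x]]]]
      by (simp_all add: pm(4,5))
    then show ?thesis using pm by blast
  qed
  have "\<exists>y. Q.pure y \<and> star y = y \<and> y \<noteq> 0"
  proof (rule ccontr)
    assume n: "\<not> ?thesis"
    have "star x = qconj sc x" for x
    proof -
      obtain t p where tp: "Q.pure p" "x = sc t 1 + p" using Q.scalar_pure_decomp by blast
      have "Q.pure (p + star p)" "star (p + star p) = p + star p"
        using tp st_pure by (simp_all add: Q.pure_add st_add st_star add.commute)
      then have "p + star p = 0" using n by blast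
      then have "star p = - p" by (simp add: eq_neg_iff_add_eq_0 add.commute)
      then show ?thesis unfolding tp(2) Q.qconj_pure[OF tp(1)] by (simp add: st_add st_scale st_1)
    qed
    then show False using st_neq by blast
  qed
  then obtain y where y: "Q.pure y" "star y = y" "y \<noteq> 0" by (elim exE conjE)
  have "\<exists>i. Q.pure i \<and> star i = i \<and> i * i \<noteq> 0"
  proof (cases "y * y = 0")
    case False
    then show ?thesis using y by blast
  next
    case True
    obtain z where z: "Q.pure z" "y * z + z * y \<noteq> 0" using Q.nondegenerate[OF y(1,3)] by blast
    obtain p m where pm: "z = p + m" "Q.pure p" "Q.pure m" "star p = p" "star m = - m"
      using split_pure[OF z(1)] by (elim exE conjE)
    have "y * z + z * y = (y * p + p * y) + (y * m + m * y)" by (simp add: pm(1) algebra_simps)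
    then have yp: "y * p + p * y \<noteq> 0" using z(2) orth_eig[OF y(1) pm(3) y(2) pm(5)] by simp
    show ?thesis
    proof (cases "p * p = 0")
      case False
      then show ?thesis using pm by blast
    next
      case p0: True
      have "(y + p) * (y + p) = y * p + p * y" using True p0 by (simp add: algebra_simps)
      then show ?thesis using yp y pm Q.pure_add[OF y(1) pm(2)] by (intro exI[of _ "y + p"]) (simp add: st_add)
    qed
  qed
  then obtain i where i: "Q.pure i" "star i = i" "i * i \<noteq> 0" by (elim exE conjE)
  obtain a where a: "i * i = sc a 1" using Q.pure_square[OF i(1)] by blast
  have a0: "a \<noteq> 0" using a i(3) by auto
  obtain e where e: "Q.pure (i * e - e * i)" "(i * e - e * i) * (i * e - e * i) \<noteq> 0"
    using Q.ex_anisotropic_commutator[OF i(1,3)] by (elim exE conjE)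
  define c where "c = i * e - e * i"
  have ic: "i * c = - (c * i)"
    by (simp add: c_def right_diff_distrib left_diff_distrib mult.assoc a scale_mult_right)
       (simp add: mult.assoc[symmetric] a scale_mult_left)
  have isc: "i * star c = - (star c * i)"
  proof -
    have "star (i * c) = - star (c * i)" unfolding ic by (simp add: st_minus)
    then have "star c * i = - (i * star c)" by (simp add: st_mult i(2))
    then show ?thesis by simp
  qed
  obtain p m where pm: "c = p + m" "Q.pure p" "Q.pure m" "star p = p" "star m = - m"
    "p = sc (1 / 2) (c + star c)" "m = sc (1 / 2) (c - star c)"
    using split_pure[OF e(1)] unfolding c_def by (elim exE conjE)
  have ip: "p * i = - (i * p)"
    using ic isc by (simp add: pm(6) scale_mult_left scale_mult_right distrib_left distrib_right
        scale_right_distrib scale_right_diff_distrib)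
  have im: "m * i = - (i * m)"
    using ic isc by (simp add: pm(7) scale_mult_left scale_mult_right right_diff_distrib left_diff_distrib
        scale_right_diff_distrib)
  have "c * c = p * p + m * m + (p * m + m * p)" by (simp add: pm(1) algebra_simps)
  then have nz: "p * p + m * m \<noteq> 0" using e(2) orth_eig[OF pm(2,3,4,5)] by (simp add: c_def)
  show ?thesis
  proof (cases "p * p = 0")
    case False
    obtain b where b: "p * p = sc b 1" using Q.pure_square[OF pm(2)] by blast
    then have "b \<noteq> 0" using False by auto
    then have "quaternion_basis sc a b i p" by (rule Q.new_basis[OF a0 _ a b ip])
    then show ?thesis using i(2) pm(4) by blast
  next
    case True
    then have mm: "m * m \<noteq> 0" using nz by simp
    obtain b where b: "m * m = sc b 1" using Q.pure_square[OF pm(3)] by blast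
    then have b0: "b \<noteq> 0" using mm by auto
    have sq: "(i * m) * (i * m) = sc (- (a * b)) 1"
    proof -
      have "(i * m) * (i * m) = i * (m * i) * m" by (simp add: mult.assoc)
      also have "\<dots> = - ((i * i) * (m * m))" by (simp add: im mult.assoc)
      finally show ?thesis by (simp add: a b scale_mult_left)
    qed
    have anti: "(i * m) * i = - (i * (i * m))" by (simp add: mult.assoc im)
    have "- (a * b) \<noteq> 0" using a0 b0 by simp
    then have "quaternion_basis sc a (- (a * b)) i (i * m)" by (rule Q.new_basis[OF a0 _ a sq anti])
    moreover have "star (i * m) = i * m" by (simp add: st_mult i(2) pm(5) im)
    ultimately show ?thesis using i(2) by blast
  qed
qed

end

section \<open>Inner automorphisms\<close>

context quaternion_coords
begin

lemma qconj_q: "qconj sc (q t u v w) = q t (- u) (- v) (- w)"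
  by (rule qconj_qcomb[OF basis])

lemma qconj_mult_self: "qconj sc x * x = sc (nrm sc x) 1"
proof -
  obtain t u v w where x: "x = q t u v w" by (rule qE)
  show ?thesis
    unfolding x qconj_q nrm_qcomb[OF basis] q_mult q_scalar q_eq_iff
    by (simp add: power2_eq_square algebra_simps)
qed

lemma central_scalar:
  assumes "z * i = i * z" "z * j = j * z"
  shows "\<exists>c. z = sc c 1"
proof -
  obtain t u v w where z: "z = q t u v w" by (rule qE)
  have "w = 0" "v = 0" "u = 0"
    using assms a_nz b_nz unfolding z by (simp_all add: generator_mult_q q_eq_iff)
  then show ?thesis by (auto simp: z q_scalar)
qed

text \<open>Up to a factor 4, the projection to the elements intertwining \<open>f\<close> with the identity,
  obtained by averaging over the group generated by \<open>i\<close> and \<open>j\<close> modulo scalars.\<close>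

definition average :: "('h \<Rightarrow> 'h) \<Rightarrow> 'h \<Rightarrow> 'h" where
  "average f y = y + sc (1 / a) (f i * y * i) + sc (1 / b) (f j * y * j)
     - sc (1 / (a * b)) (f (i * j) * y * (i * j))"

lemma average_id: "average (\<lambda>x. x) (q t u v w) = sc (4 * t) 1"
  unfolding average_def generator_mult_q q_scale q_add qcomb_diff q_scalar q_eq_iff
  using a_nz b_nz by simp

text \<open>Averages intertwine \<open>f\<close> with the identity, and not all vanish: summing \<open>average f
  e * e\<^sup>-\<^sup>1\<close> over the basis elements \<open>e\<close> gives 4. For a nonzero intertwiner
  \<open>v\<close> the elements killed by left multiplication with \<open>v\<close> form a two-sided ideal,
  which is zero because averaging with the identity extracts from any nonzero ideal a nonzero scalar. Hence
  \<open>v\<close> times its conjugate, the reduced norm, is not zero.\<close>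

theorem skolem_noether:
  assumes f_add: "\<And>x y. f (x + y) = f x + f y" and f_scale: "\<And>c x. f (sc c x) = sc c (f x)"
    and f_mult: "\<And>x y. f (x * y) = f x * f y" and f_1: "f 1 = 1"
  shows "\<exists>v. nrm sc v \<noteq> 0 \<and> (\<forall>x. f x * v = v * x)"
proof -
  define I J where "I = f i" and "J = f j"
  have basic: "i * i = sc a 1" "j * j = sc b 1" "j * i = - (i * j)" using qbasis_mult[OF basis] by auto
  have f_minus: "f (- x) = - f x" for x using f_scale[of "- 1" x] by simp
  have big: "I * I = sc a 1" "J * J = sc b 1" "J * I = - (I * J)"
    unfolding I_def J_def f_mult[symmetric] basic by (simp_all add: f_scale f_1 f_minus)
  have r: "i * (i * z) = sc a z" "j * (j * z) = sc b z" "j * (i * z) = - (i * (j * z))"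
    "I * (I * z) = sc a z" "J * (J * z) = sc b z" "J * (I * z) = - (I * (J * z))" for z
    by (simp_all add: mult.assoc[symmetric] basic big scale_mult_left)
  have av: "average f y = y + sc (1 / a) (I * (y * i)) + sc (1 / b) (J * (y * j))
     - sc (1 / (a * b)) (I * (J * (y * (i * j))))" for y
    by (simp add: average_def f_mult I_def J_def mult.assoc)
  note rules = distrib_left distrib_right right_diff_distrib left_diff_distrib scale_mult_left
    scale_mult_right mult.assoc basic r
  have Iav: "I * average f y = average f y * i" for y
    unfolding av using a_nz b_nz by (simp add: rules)
  have Jav: "J * average f y = average f y * j" for y
    unfolding av using a_nz b_nz by (simp add: rules)
  have comm: "f x * average f y = average f y * x" for x y
  proof -
    obtain t u v w where "x = q t u v w" by (rule qE)
    then have x: "x = sc t 1 + sc u i + sc v j + sc w (i * j)" by (simp add: qcomb_def)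
    have "I * J * average f y = average f y * (i * j)"
      by (metis Iav Jav mult.assoc)
    then show ?thesis unfolding x
      by (simp add: f_add f_scale f_mult f_1 I_def[symmetric] J_def[symmetric] distrib_left distrib_right
          scale_mult_left scale_mult_right Iav Jav)
  qed
  have "\<exists>y. average f y \<noteq> 0"
  proof (rule ccontr)
    assume "\<not> ?thesis"
    then have z: "average f y = 0" for y by blast
    have "average f 1 + sc (1 / a) (average f i * i) + sc (1 / b) (average f j * j)
        - sc (1 / (a * b)) (average f (i * j) * (i * j)) = sc 4 1"
    proof -
      have four: "sc 4 x = x + x + x + x" for x
        using scale_left_distrib[of 2 2 x] scale_left_distrib[of 1 1 x] by (simp add: add.assoc)
      show ?thesis unfolding av four using a_nz b_nz
        by (simp add: rules scale_right_distrib scale_right_diff_distrib mult.commute[of b a])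
    qed
    then have "sc 4 1 = (0 :: 'h)" by (simp add: z)
    then show False by simp
  qed
  then obtain y where y: "average f y \<noteq> 0" by blast
  define v where "v = average f y"
  have fv: "f x * v = v * x" for x unfolding v_def by (rule comm)
  have ann: "x = 0" if vx: "v * x = 0" for x
  proof (rule ccontr)
    assume x0: "x \<noteq> 0"
    have two_sided: "v * (y * x * z) = 0" for y z
    proof -
      have "v * (y * x * z) = (v * y) * x * z" by (simp add: mult.assoc)
      also have "\<dots> = f y * (v * x) * z" by (simp add: fv[symmetric] mult.assoc)
      finally show ?thesis by (simp add: vx)
    qed
    have tr0: "t = 0" if "x * z = q t r s w" for z t r s w
    proof -
      have "v * average (\<lambda>x. x) (x * z) = 0"
        using two_sided[of 1 z] two_sided[of i "z * i"] two_sided[of j "z * j"] two_sided[of "i * j" "z * (i * j)"]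
        by (simp add: average_def distrib_left right_diff_distrib scale_mult_right mult.assoc)
      then have "sc (4 * t) v = 0" unfolding that average_id by (simp add: scale_mult_right)
      then show ?thesis using y by (simp add: v_def)
    qed
    obtain t r s w where x: "x = q t r s w" by (rule qE)
    have "t = 0" "r = 0" "s = 0" "w = 0"
      using tr0[of 1, unfolded x q_1 q_mult, OF refl] tr0[of "q 0 1 0 0", unfolded x q_mult, OF refl]
        tr0[of "q 0 0 1 0", unfolded x q_mult, OF refl] tr0[of "q 0 0 0 1", unfolded x q_mult, OF refl]
        a_nz b_nz by simp_all
    then show False using x0 x q_eq_0_iff by simp
  qed
  have "nrm sc v \<noteq> 0"
  proof
    assume n: "nrm sc v = 0"
    then have "v * qconj sc v = 0" using scale_nrm[of v] by simp
    then have "qconj sc v = 0" by (rule ann)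
    moreover obtain t r s w where x: "v = q t r s w" by (rule qE)
    ultimately have "v = 0" by (simp add: qconj_q q_eq_0_iff)
    then show False using y by (simp add: v_def)
  qed
  then show ?thesis using fv by blast
qed

end

definition trd :: "('k::field \<Rightarrow> 'h::ring_1 \<Rightarrow> 'h) \<Rightarrow> 'h \<Rightarrow> 'k" where
  "trd sc x = (THE c. sc c 1 = x + qconj sc x)"

locale symmetric_coords = orthogonal_involution_algebra sc star + quaternion_coords sc a b i j
  for sc :: "'k::field_char_0 \<Rightarrow> 'h::ring_1 \<Rightarrow> 'h" and star :: "'h \<Rightarrow> 'h" and a b :: 'k and i j :: 'h +
  assumes star_i: "star i = i" and star_j: "star j = j"
begin

lemma star_q: "star (q t u v w) = q t u v (- w)"
  by (simp add: qcomb_def st_add st_scale st_1 st_mult star_i star_j qbasis_mult[OF basis])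

lemma trd_q: "trd sc (q t u v w) = 2 * t"
  unfolding trd_def qconj_q q_add q_scalar q_eq_iff by (rule the_equality) auto

lemma involution_algebra: "involution_algebra sc star (trd sc) (nrm sc)"
proof
  fix x y :: 'h
  show "star (x + y) = star x + star y" by (rule st_add)
  show "star (sc c x) = sc c (star x)" for c by (rule st_scale)
  show "star (x * y) = star y * star x" by (rule st_mult)
  show "star (star x) = x" by (rule st_star)
  obtain t u v w where x: "x = q t u v w" by (rule qE)
  obtain t' u' v' w' where y: "y = q t' u' v' w'" by (rule qE)
  show "x * x = sc (trd sc x) x - sc (nrm sc x) 1"
    unfolding x trd_q nrm_qcomb[OF basis] q_mult q_scale q_scalar qcomb_diff q_eq_iff
    by (simp add: power2_eq_square algebra_simps)
  show "trd sc (x + y) = trd sc x + trd sc y"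
    unfolding x y q_add trd_q by (simp add: algebra_simps)
  show "\<exists>c d. (c \<noteq> 0 \<or> d \<noteq> 0) \<and> sc c (x - star x) + sc d (y - star y) = 0"
  proof (cases "w = 0")
    case True
    then show ?thesis by (intro exI[of _ 1] exI[of _ 0]) (simp add: x star_q)
  next
    case False
    then show ?thesis
      by (intro exI[of _ w'] exI[of _ "- w"]) (simp add: x y star_q qcomb_diff q_scale q_add q_eq_0_iff)
  qed
next
  fix x1 x2 x3 x4 x5 :: 'h
  obtain c where "(\<exists>k\<le>4. c k \<noteq> 0) \<and> (\<Sum>k\<le>4. sc (c k) ([x1, x2, x3, x4, x5] ! k)) = 0"
    using finite_relation[OF basis_card(2) basis_span, of "\<lambda>k. [x1, x2, x3, x4, x5] ! k"]
    unfolding basis_card(1) by (rule exE)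
  then have c: "\<exists>k\<le>4. c k \<noteq> 0" "(\<Sum>k\<le>4. sc (c k) ([x1, x2, x3, x4, x5] ! k)) = 0"
    by (rule conjunct1, rule conjunct2)
  have set4: "{..4::nat} = {0, 1, 2, 3, 4}" by auto
  have "c 0 \<noteq> 0 \<or> c 1 \<noteq> 0 \<or> c 2 \<noteq> 0 \<or> c 3 \<noteq> 0 \<or> c 4 \<noteq> 0"
  proof -
    obtain k where "k \<in> {..4}" "c k \<noteq> 0" using c(1) by auto
    then show ?thesis unfolding set4 by auto
  qed
  moreover have "sc (c 0) x1 + sc (c 1) x2 + sc (c 2) x3 + sc (c 3) x4 + sc (c 4) x5 = 0"
    using c(2) unfolding set4 by (simp add: add.assoc)
  ultimately show "\<exists>a b c d e. (a \<noteq> 0 \<or> b \<noteq> 0 \<or> c \<noteq> 0 \<or> d \<noteq> 0 \<or> e \<noteq> 0) \<and>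
      sc a x1 + sc b x2 + sc c x3 + sc d x4 + sc e x5 = 0"
    by blast
next
  fix C :: "'h set" assume C: "finite C" "card C \<le> 3"
  show "span C \<noteq> UNIV"
  proof
    assume s: "span C = UNIV"
    have "card {1, i, j, i * j} \<le> card C"
      using independent_span_bound[OF C(1) basis_ind] unfolding s by blast
    then show False using C(2) unfolding basis_card(1) by simp
  qed
qed

text \<open>Comparing \<open>f (star x)\<close> with \<open>star (f x)\<close> shows that \<open>star v *
  v\<close> is central. So \<open>star v\<close> is a multiple \<open>k\<close> of the conjugate of
  \<open>v\<close>, and in a basis of symmetric generators both maps only change signs of coordinates,
  whence \<open>k\<close> is a sign. It is negative if \<open>v\<close> is a combination of \<open>i\<close>
  and \<open>j\<close>.\<close>

theorem star_automorphism_inner: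
  assumes f_add: "\<And>x y. f (x + y) = f x + f y" and f_scale: "\<And>c x. f (sc c x) = sc c (f x)"
    and f_mult: "\<And>x y. f (x * y) = f x * f y" and f_1: "f 1 = 1" and f_star: "\<And>x. f (star x) = star (f x)"
  shows "\<exists>v v' r. nrm sc v \<noteq> 0 \<and> v * v' = 1 \<and> v' * v = 1 \<and> (r = 1 \<or> r = - 1) \<and>
    v * star v = sc (r * nrm sc v) 1 \<and> (\<forall>x. f x = v * x * v')"
proof -
  obtain v where v: "nrm sc v \<noteq> 0" "\<And>x. f x * v = v * x"
    using skolem_noether[OF f_add f_scale f_mult f_1] by auto
  define n where "n = nrm sc v"
  define v' where "v' = sc (1 / n) (qconj sc v)"
  have n0: "n \<noteq> 0" using v by (simp add: n_def)
  have vv': "v * v' = 1" "v' * v = 1"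
    using n0 scale_nrm[of v] qconj_mult_self[of v]
    by (simp_all add: v'_def scale_mult_left scale_mult_right n_def[symmetric] flip: scale_nrm)
  have fx: "f x = v * x * v'" for x
    by (metis v(2) vv'(1) mult.assoc mult.right_neutral)
  have "(star v * v) * x = x * (star v * v)" for x
  proof -
    have "v * x * v' = star v' * x * star v"
      using f_star[of "star x"] unfolding fx by (simp add: st_star st_mult mult.assoc)
    then have "star v * (v * x * v') * v = star v * (star v' * x * star v) * v" by simp
    moreover have "star v * star v' = 1" by (simp add: st_mult[symmetric] vv' st_1)
    then have "star v * (star v' * z) = z" for z by (simp add: mult.assoc[symmetric])
    ultimately show ?thesis by (simp add: mult.assoc vv')
  qed
  then obtain c where c: "star v * v = sc c 1" using central_scalar by blast
  have sv: "star v = sc c v'"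
  proof -
    have "star v = star v * v * v'" by (simp add: mult.assoc vv')
    then show ?thesis by (simp add: c scale_mult_left)
  qed
  obtain t r s w where q: "v = q t r s w" by (rule qE)
  have "q t r s (- w) = sc (c / n) (q t (- r) (- s) (- w))"
    using sv unfolding v'_def by (simp add: q star_q qconj_q)
  define k where "k = c / n"
  have e: "t = k * t" "r = - (k * r)" "s = - (k * s)" "w = k * w"
    using \<open>q t r s (- w) = sc (c / n) (q t (- r) (- s) (- w))\<close>
    by (simp_all add: q_scale q_eq_iff k_def)
  have "v \<noteq> 0" using vv' by auto
  then have "t \<noteq> 0 \<or> r \<noteq> 0 \<or> s \<noteq> 0 \<or> w \<noteq> 0" using q q_eq_0_iff by auto
  moreover have "(k - 1) * t = 0" "(k + 1) * r = 0" "(k + 1) * s = 0" "(k - 1) * w = 0"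
    using e by (simp_all add: left_diff_distrib distrib_right eq_neg_iff_add_eq_0 add.commute del: mult_eq_0_iff)
  ultimately have "c / n = 1 \<or> c / n = - 1"
    unfolding k_def[symmetric] by (auto simp: eq_neg_iff_add_eq_0)
  moreover have "v * star v = sc (c / n * n) 1" unfolding sv using n0 by (simp add: scale_mult_right vv')
  ultimately show ?thesis using v(1) vv' fx unfolding n_def by blast
qed

end

section \<open>Homomorphisms of orders with involution\<close>

text \<open>The leading coefficient of an integer equation is a denominator of its root.\<close>

lemma ex_integer_denominator:
  assumes nf: "number_field TYPE('k::field_char_0)"
  shows "\<exists>d::int. d \<noteq> 0 \<and> algebraic_int (of_int d * (x::'k))"
proof -
  obtain n where n: "\<forall>(f :: nat \<Rightarrow> 'k) l. prime l \<longrightarrow>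
    (\<exists>a::nat \<Rightarrow> int. (\<Sum>i\<le>n. of_int (a i) * f i) = 0 \<and> (\<exists>i\<le>n. \<not> l dvd a i))"
    using number_field_relation[OF nf] by (elim exE)
  have "\<exists>a::nat \<Rightarrow> int. (\<Sum>i\<le>n. of_int (a i) * x ^ i) = 0 \<and> (\<exists>i\<le>n. \<not> 2 dvd a i)"
    by (rule n[rule_format, of 2 "\<lambda>i. x ^ i"]) simp
  then obtain a i0 where a: "(\<Sum>i\<le>n. of_int (a i) * x ^ i) = 0" "i0 \<le> n" "\<not> 2 dvd (a i0 :: int)"
    by (elim exE conjE)
  define S where "S = {i. i \<le> n \<and> a i \<noteq> 0}"
  have S: "finite S" "S \<noteq> {}" using a(2,3) by (auto simp: S_def)
  define m where "m = Max S"
  have m: "m \<le> n" "a m \<noteq> 0" using Max_in[OF S] by (auto simp: m_def S_def)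
  have "i \<le> m" if "i \<in> S" for i using Max_ge[OF S(1) that] by (simp add: m_def)
  then have top: "a i = 0" if "m < i" "i \<le> n" for i
    using that unfolding S_def by force
  have rel: "(\<Sum>i\<le>m. of_int (a i) * x ^ i) = 0"
  proof -
    have "(\<Sum>i\<le>n. of_int (a i) * x ^ i) = (\<Sum>i\<le>m. of_int (a i) * x ^ i)"
      by (rule sum.mono_neutral_right) (use m top in auto)
    then show ?thesis using a(1) by simp
  qed
  have "m \<noteq> 0" using rel m(2) by (intro notI) simp
  then obtain k where k: "m = Suc k" by (cases m) auto
  have d: "(\<Sum>i=k..m. of_int (a i) * x ^ (i - k)) = of_int (a k) + of_int (a m) * x" by (simp add: k)
  have "algebraic_int (\<Sum>i=k..m. of_int (a i) * x ^ (i - k))"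
  proof (cases "k = 0")
    case True
    then show ?thesis using rel by (simp add: atLeast0AtMost)
  next
    case False
    then show ?thesis using algebraic_int_horner[OF rel, of k] k by simp
  qed
  then have "algebraic_int (of_int (a k) + of_int (a m) * x - of_int (a k))"
    unfolding d by (intro algebraic_int_diff algebraic_int_of_int)
  then show ?thesis using m(2) by (intro exI[of _ "a m"]) simp
qed

lemma ex_common_integer_denominator:
  assumes nf: "number_field TYPE('k::field_char_0)" and "finite (S :: 'k set)"
  shows "\<exists>d::int. d \<noteq> 0 \<and> (\<forall>x\<in>S. algebraic_int (of_int d * x))"
  using assms(2)
proof (induction S rule: finite_induct)
  case empty
  show ?case by (intro exI[of _ 1]) simp
next
  case (insert x S)
  then obtain d :: int where d: "d \<noteq> 0" "\<forall>x\<in>S. algebraic_int (of_int d * x)" by (elim exE conjE)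
  obtain e :: int where e: "e \<noteq> 0" "algebraic_int (of_int e * x)"
    using ex_integer_denominator[OF nf] by blast
  have "algebraic_int (of_int (e * d) * y)" if y: "y \<in> insert x S" for y
  proof (cases "y = x")
    case True
    have "of_int (e * d) * y = of_int d * (of_int e * x)" by (simp add: True)
    then show ?thesis by (simp only: algebraic_int_mult[OF algebraic_int_of_int e(2)])
  next
    case False
    then have dy: "algebraic_int (of_int d * y)" using d(2) y by blast
    have "of_int (e * d) * y = of_int e * (of_int d * y)" by simp
    then show ?thesis by (simp only: algebraic_int_mult[OF algebraic_int_of_int dy])
  qed
  moreover have "e * d \<noteq> 0" using d(1) e(1) by simp
  ultimately show ?case by blast
qed

definition star_hom :: "('k::field \<Rightarrow> 'h::ring_1 \<Rightarrow> 'h) \<Rightarrow> ('h \<Rightarrow> 'h) \<Rightarrow> ('h \<Rightarrow> 'h) \<Rightarrow> bool" where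
  "star_hom sc star f \<longleftrightarrow> (\<forall>x y. f (x + y) = f x + f y) \<and> (\<forall>c x. f (sc c x) = sc c (f x)) \<and>
     (\<forall>x y. f (x * y) = f x * f y) \<and> f 1 = 1 \<and> (\<forall>x. f (star x) = star (f x))"

lemma star_homD:
  assumes "star_hom sc star f"
  shows "f (x + y) = f x + f y" "f (sc c x) = sc c (f x)" "f (x * y) = f x * f y" "f 1 = 1"
    "f (star x) = star (f x)" "f 0 = 0" "f (- x) = - f x" "f (x - y) = f x - f y"
proof -
  show add: "\<And>x y. f (x + y) = f x + f y" and "f (sc c x) = sc c (f x)" "f (x * y) = f x * f y" "f 1 = 1"
    "f (star x) = star (f x)"
    using assms by (simp_all add: star_hom_def)
  show z: "f 0 = 0" using add[of 0 0] by simp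
  show m: "f (- x) = - f x" for x using add[of x "- x"] by (simp add: z eq_neg_iff_add_eq_0 add.commute)
  show "f (x - y) = f x - f y" using add[of x "- y"] by (simp add: m)
qed

context involution_algebra
begin

lemma star_order_image:
  assumes f: "star_hom sc star f" and bij: "bij f" and R: "star_order sc star R"
  shows "star_order sc star (f ` R)"
proof -
  note fD = star_homD[OF f] and RD = star_orderD[OF R]
  obtain B where B: "finite B" "R = ok_span sc B" using RD(5) by blast
  have f_sum: "f (\<Sum>x\<in>B. sc (c x) x) = (\<Sum>x\<in>B. sc (c x) (f x))" for c
    by (induction B rule: infinite_finite_induct) (simp_all add: fD)
  have inj: "inj_on f B" using bij by (auto simp: bij_def inj_on_def)
  show ?thesis
  proof (rule star_orderI)
    show "submod sc alg_ints (f ` R)"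
      unfolding submod_def
    proof (intro conjI ballI)
      show "0 \<in> f ` R" using RD(8) fD(6) by (metis image_eqI)
      show "x + y \<in> f ` R" if "x \<in> f ` R" "y \<in> f ` R" for x y
        using that RD(9) by (auto simp: fD(1)[symmetric])
      show "sc a x \<in> f ` R" if "a \<in> alg_ints" "x \<in> f ` R" for a x
        using that RD(10) by (auto simp: fD(2)[symmetric])
    qed
    show "1 \<in> f ` R" using RD(1) fD(4) by (metis image_eqI)
    show "x * y \<in> f ` R" if "x \<in> f ` R" "y \<in> f ` R" for x y
      using that RD(3) by (auto simp: fD(3)[symmetric])
    show "star x \<in> f ` R" if "x \<in> f ` R" for x
      using that RD(4) by (auto simp: fD(5)[symmetric])
    show "finite (f ` B)" using B by simp
    show "f ` R = ok_span sc (f ` B)"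
    proof
      show "f ` R \<subseteq> ok_span sc (f ` B)"
      proof
        fix y assume "y \<in> f ` R"
        then obtain c where c: "y = f (\<Sum>x\<in>B. sc (c x) x)" "\<forall>x\<in>B. algebraic_int (c x)"
          unfolding B(2) ok_span_def by blast
        have "y = (\<Sum>x\<in>f ` B. sc (c (the_inv_into B f x)) x)"
          unfolding c(1) f_sum by (simp add: sum.reindex[OF inj] the_inv_into_f_f[OF inj])
        moreover have "\<forall>x\<in>f ` B. algebraic_int (c (the_inv_into B f x))"
          using c(2) by (simp add: the_inv_into_f_f[OF inj])
        ultimately show "y \<in> ok_span sc (f ` B)"
          unfolding ok_span_def by (intro CollectI exI[of _ "\<lambda>x. c (the_inv_into B f x)"] conjI)
      qed
      show "ok_span sc (f ` B) \<subseteq> f ` R"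
      proof
        fix y assume "y \<in> ok_span sc (f ` B)"
        then obtain c where c: "y = (\<Sum>x\<in>f ` B. sc (c x) x)" "\<forall>x\<in>f ` B. algebraic_int (c x)"
          unfolding ok_span_def by blast
        have "y = f (\<Sum>x\<in>B. sc (c (f x)) x)"
          unfolding c(1) f_sum by (simp add: sum.reindex[OF inj])
        moreover have "(\<Sum>x\<in>B. sc (c (f x)) x) \<in> R"
          unfolding B(2) ok_span_def using c(2) by (intro CollectI exI[of _ "\<lambda>x. c (f x)"] conjI) auto
        ultimately show "y \<in> f ` R" by blast
      qed
    qed
    show "span (f ` R) = UNIV"
    proof -
      have "f x \<in> span (f ` R)" if "x \<in> span R" for x
        using that
      proof (induction rule: span_induct_alt)
        case base
        show ?case by (simp add: fD span_zero)
      next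
        case (step c x y)
        then show ?case by (simp add: fD span_add span_scale span_base)
      qed
      then show ?thesis using RD(6) bij by (auto simp: bij_def) (metis surjD)
    qed
  qed
qed

lemma maximal_star_order_image:
  assumes f: "star_hom sc star f" and g: "star_hom sc star g" and fg: "\<And>x. f (g x) = x" "\<And>x. g (f x) = x"
    and R: "maximal_star_order sc star R"
  shows "maximal_star_order sc star (f ` R)"
proof -
  have bij: "bij f" "bij g"
    by (rule o_bij[of g], simp_all add: fun_eq_iff fg, rule o_bij[of f], simp_all add: fun_eq_iff fg)
  have gf: "g ` f ` S = S" "f ` g ` S = S" for S by (auto simp: fg image_image)
  have so: "star_order sc star R" using R by (simp add: maximal_star_order_def)
  have "False" if S: "star_order sc star S" "f ` R \<subset> S" for S
  proof -
    have "star_order sc star (g ` S)" by (rule star_order_image[OF g bij(2) S(1)])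
    moreover have "R \<subset> g ` S"
    proof -
      have "g ` f ` R \<subseteq> g ` S" using S(2) by blast
      moreover have "g ` S \<noteq> R" using S(2) gf(2)[of S] by auto
      ultimately show ?thesis unfolding gf by blast
    qed
    ultimately show False using R unfolding maximal_star_order_def by blast
  qed
  then show ?thesis using star_order_image[OF f bij(1) so] unfolding maximal_star_order_def by blast
qed

text \<open>Choose a \<open>K\<close>-basis of \<open>H\<close> inside \<open>R\<close> and extend linearly. On
  \<open>R\<close> the extension agrees with the given map because an integer multiple of any element is an
  integral combination of the basis.\<close>

theorem star_orders_iso_extends:
  assumes nf: "number_field TYPE('k)" and R: "star_order sc star R"
    and R': "star_order sc star R'" and iso: "star_orders_iso sc star R R'"
  shows "\<exists>g. star_hom sc star g \<and> g ` R = R'"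
proof -
  note RD = star_orderD[OF R]
  obtain f where F: "bij_betw f R R'" "f 1 = 1" "\<forall>x\<in>R. \<forall>y\<in>R. f (x + y) = f x + f y"
    "\<forall>x\<in>R. \<forall>y\<in>R. f (x * y) = f x * f y"
    "\<forall>c. \<forall>x\<in>R. algebraic_int c \<longrightarrow> f (sc c x) = sc c (f x)"
    "\<forall>x\<in>R. f (star x) = star (f x)"
    using iso unfolding star_orders_iso_def by (elim exE conjE)
  note f = F(1,2) F(3-6)[rule_format]
  have f0: "f 0 = 0" using f(3)[OF RD(8,8)] by simp
  obtain E where E: "E \<subseteq> R" "independent E" "R \<subseteq> span E"
    using maximal_independent_subset[of R] by blast
  have spE: "span E = UNIV" using E(3) RD(6) by (metis span_mono span_span top.extremum_uniqueI)
  obtain B where B: "finite B" "R = ok_span sc B" using RD(5) by blast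
  have "span B = UNIV"
    using RD(6) mspan_subset_span[of alg_ints B] unfolding B(2) ok_span_mspan
    by (metis span_mono span_span top.extremum_uniqueI)
  then have finE: "finite E" using independent_span_bound[OF B(1) E(2)] by simp
  define g where "g x = (\<Sum>e\<in>E. sc (representation E x e) (f e))" for x
  have rep: "x = (\<Sum>e\<in>E. sc (representation E x e) e)" for x
    by (rule sum_representation_eq[OF E(2) _ finE order_refl, symmetric]) (simp add: spE)
  have g_add: "g (x + y) = g x + g y" for x y
    by (simp add: g_def representation_add[OF E(2)] spE scale_left_distrib sum.distrib)
  have g_scale: "g (sc c x) = sc c (g x)" for c x
    by (simp add: g_def representation_scale[OF E(2)] spE scale_sum_right)
  have gf: "g x = f x" if x: "x \<in> R" for x
  proof -
    define r where "r = representation E x"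
    obtain d :: int where d: "d \<noteq> 0" "\<forall>c\<in>r ` E. algebraic_int (of_int d * c)"
      using ex_common_integer_denominator[OF nf, of "r ` E"] finE by auto
    have f_sum: "(\<Sum>e\<in>F. sc (c e) e) \<in> R \<and> f (\<Sum>e\<in>F. sc (c e) e) = (\<Sum>e\<in>F. sc (c e) (f e))"
      if "finite F" "F \<subseteq> E" "\<forall>e\<in>F. algebraic_int (c e)" for F c
      using that
    proof (induction F rule: finite_induct)
      case empty
      show ?case by (simp add: f0 RD)
    next
      case (insert e F)
      have "sc (c e) e \<in> R" "f (sc (c e) e) = sc (c e) (f e)" using insert.prems E(1) RD(10) f(5) by auto
      then show ?case using insert RD(9) f(3) by auto
    qed
    have dx: "sc (of_int d) x = (\<Sum>e\<in>E. sc (of_int d * r e) e)"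
      by (subst rep[of x]) (simp add: scale_sum_right r_def)
    have "sc (of_int d) (f x) = f (sc (of_int d) x)" by (rule f(5)[OF x algebraic_int_of_int, symmetric])
    also have "\<dots> = (\<Sum>e\<in>E. sc (of_int d * r e) (f e))"
      unfolding dx using f_sum[OF finE order_refl, of "\<lambda>e. of_int d * r e"] d(2) by simp
    also have "\<dots> = sc (of_int d) (g x)" by (simp add: g_def r_def scale_sum_right)
    finally show ?thesis using d(1) by simp
  qed
  have g_mult: "g (x * y) = g x * g y" for x y
  proof -
    have "g (x * y) = g x * g y" if y: "y \<in> R" for y
    proof -
      have "x \<in> span R" by (simp add: RD)
      then show ?thesis
      proof (induction rule: span_induct_alt)
        case base
        show ?case using g_add[of 0 0] by simp
      next
        case (step c x z)
        then show ?case using y RD(3) f(4)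
          by (simp add: g_add g_scale distrib_right scale_mult_left gf)
      qed
    qed
    moreover have "y \<in> span R" by (simp add: RD)
    then show ?thesis
    proof (induction rule: span_induct_alt)
      case base
      show ?case using g_add[of 0 0] by simp
    next
      case (step c y z)
      then show ?case using calculation[of y]
        by (simp add: g_add g_scale distrib_left scale_mult_right)
    qed
  qed
  have g_star: "g (star x) = star (g x)" for x
  proof -
    have "x \<in> span R" by (simp add: RD)
    then show ?thesis
    proof (induction rule: span_induct_alt)
      case base
      show ?case using g_add[of 0 0] by (simp add: star_0)
    next
      case (step c x z)
      then show ?case using RD(4) f(6) by (simp add: g_add g_scale star_add star_scale gf)
    qed
  qed
  have "g 1 = 1" using gf[OF RD(1)] f(2) by simp
  then have "star_hom sc star g"
    unfolding star_hom_def by (intro conjI allI g_add g_scale g_mult g_star)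
  moreover have "g ` R = f ` R" by (rule image_cong) (simp_all add: gf)
  then have "g ` R = R'" using bij_betw_imp_surj_on[OF f(1)] by simp
  ultimately show ?thesis by (intro exI[of _ g] conjI)
qed

end

section \<open>Two-by-two matrices and extension of scalars\<close>

definition mat2 :: "'a::zero \<Rightarrow> 'a \<Rightarrow> 'a \<Rightarrow> 'a \<Rightarrow> 'a^2^2" where
  "mat2 a b c d = vector [vector [a, b], vector [c, d]]"

lemma mat2_nth:
  "vec_nth (vec_nth (mat2 a b c d) 1) 1 = a" "vec_nth (vec_nth (mat2 a b c d) 1) 2 = b"
  "vec_nth (vec_nth (mat2 a b c d) 2) 1 = c" "vec_nth (vec_nth (mat2 a b c d) 2) 2 = d"
  by (simp_all add: mat2_def)

lemma mat2_eqI: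
  assumes "vec_nth (vec_nth M 1) 1 = a" "vec_nth (vec_nth M 1) 2 = b"
    "vec_nth (vec_nth M 2) 1 = c" "vec_nth (vec_nth M 2) 2 = d"
  shows "M = mat2 a b c d"
  using assms by (simp add: Finite_Cartesian_Product.vec_eq_iff forall_2 mat2_nth)

lemma mat2_cases: obtains a b c d where "M = mat2 a b c d"
  using mat2_eqI by blast

lemma mat2_eq_iff: "mat2 a b c d = mat2 a' b' c' d' \<longleftrightarrow> a = a' \<and> b = b' \<and> c = c' \<and> d = d'"
  by (metis mat2_nth)

lemma mat2_mult: "mat2 a b c d ** mat2 a' b' c' d' =
    mat2 (a * a' + b * c') (a * b' + b * d') (c * a' + d * c') (c * b' + d * d' :: 'a::semiring_1)"
  by (rule mat2_eqI) (simp_all add: matrix_matrix_mult_def sum_2 mat2_nth)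

lemma mat2_diff: "mat2 a b c d - mat2 a' b' c' d' = mat2 (a - a') (b - b') (c - c') (d - d' :: 'a::ring_1)"
  by (rule mat2_eqI) (simp_all add: mat2_nth)

lemma mat2_add: "mat2 a b c d + mat2 a' b' c' d' = mat2 (a + a') (b + b') (c + c') (d + d' :: 'a::ring_1)"
  by (rule mat2_eqI) (simp_all add: mat2_nth)

lemma mat2_add_rdistrib:
  fixes M N X :: "'a::ring_1^2^2"
  shows "(M + N) ** X = M ** X + N ** X"
proof -
  obtain a b c d where M: "M = mat2 a b c d" by (rule mat2_cases)
  obtain a' b' c' d' where N: "N = mat2 a' b' c' d'" by (rule mat2_cases)
  obtain p q r s where X: "X = mat2 p q r s" by (rule mat2_cases)
  show ?thesis unfolding M N X by (simp add: mat2_mult mat2_add mat2_eq_iff distrib_right)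
qed

abbreviation one_mat :: "'a::ring_1^2^2" where "one_mat \<equiv> Finite_Cartesian_Product.mat 1"

lemma mat2_one: "one_mat = mat2 1 0 0 (1 :: 'a::ring_1)"
  by (rule mat2_eqI) (simp_all add: Finite_Cartesian_Product.mat_def)

lemma mat2_map: "map_matrix f (mat2 a b c d) = mat2 (f a) (f b) (f c) (f d)"
  by (rule mat2_eqI) (simp_all add: mat2_nth)

lemma mat2_SL_star: "mat2 a b c d \<in> SL_star st \<longleftrightarrow>
    st (a * st b) = a * st b \<and> st (c * st d) = c * st d \<and> a * st d - b * st c = 1"
  by (simp add: SL_star_def sym_elems_def mat2_nth)

lemma mat2_SL_star_over: "mat2 a b c d \<in> SL_star_over st R \<longleftrightarrow>
    mat2 a b c d \<in> SL_star st \<and> a \<in> R \<and> b \<in> R \<and> c \<in> R \<and> d \<in> R"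
  by (simp add: SL_star_over_def forall_2 mat2_nth)

lemma mat2_SL2: "mat2 a b c d \<in> SL2 \<longleftrightarrow> a * d - b * c = 1"
  by (simp add: SL2_def det_2 mat2_nth)

lemma matrix_inv_eqI:
  fixes G G' :: "'a::ring_1^2^2"
  assumes "G ** G' = one_mat" "G' ** G = one_mat"
  shows "matrix_inv G = G'"
proof -
  have "G ** matrix_inv G = one_mat \<and> matrix_inv G ** G = one_mat"
    unfolding matrix_inv_def by (rule someI[of _ G']) (use assms in simp)
  then have "G ** matrix_inv G = one_mat" by (rule conjunct1)
  then have "G' ** (G ** matrix_inv G) = G'" by (simp only: matrix_mul_rid)
  moreover have "G' ** (G ** matrix_inv G) = matrix_inv G"
    by (simp only: matrix_mul_assoc assms(2) matrix_mul_lid)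
  ultimately show ?thesis by simp
qed

lemma frag_sum_diff:
  fixes g :: "'p \<Rightarrow> 'r::ring_1"
  shows "(\<Sum>p\<in>Poly_Mapping.keys (r - r'). of_int (Poly_Mapping.lookup (r - r') p) * g p) =
    (\<Sum>p\<in>Poly_Mapping.keys r. of_int (Poly_Mapping.lookup r p) * g p) -
    (\<Sum>p\<in>Poly_Mapping.keys r'. of_int (Poly_Mapping.lookup r' p) * g p)"
proof -
  define S where "S = Poly_Mapping.keys r \<union> Poly_Mapping.keys r'"
  have ext: "(\<Sum>p\<in>Poly_Mapping.keys s. of_int (Poly_Mapping.lookup s p) * g p) =
      (\<Sum>p\<in>S. of_int (Poly_Mapping.lookup s p) * g p)" if "Poly_Mapping.keys s \<subseteq> S" for s
    by (rule sum.mono_neutral_left) (use that in \<open>auto simp: S_def in_keys_iff\<close>)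
  have sub: "Poly_Mapping.keys (r - r') \<subseteq> S" "Poly_Mapping.keys r \<subseteq> S" "Poly_Mapping.keys r' \<subseteq> S"
    unfolding S_def using keys_diff[of r r'] by auto
  show ?thesis
    unfolding ext[OF sub(1)] ext[OF sub(2)] ext[OF sub(3)]
    by (simp add: sum_subtractf lookup_minus left_diff_distrib)
qed

lemma frag_sum_of:
  fixes g :: "'p \<Rightarrow> 'r::ring_1"
  shows "(\<Sum>p\<in>Poly_Mapping.keys (frag_of q). of_int (Poly_Mapping.lookup (frag_of q) p) * g p) = g q"
  by simp

lemma (in algebra_over) scale_of_int: "sc (of_int n) x = of_int n * x"
proof -
  have nat: "sc (of_nat k) x = of_nat k * x" for k
    by (induction k) (simp_all add: scale_left_distrib distrib_right)
  show ?thesis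
  proof (cases n rule: int_cases2)
    case (nonneg k)
    then show ?thesis using nat[of k] by simp
  next
    case (nonpos k)
    then show ?thesis using nat[of k] by simp
  qed
qed

locale extended_involution =
  H: orthogonal_involution_algebra sc star + T: scalar_extension scT sc emb incl
  for sc :: "'k::field_char_0 \<Rightarrow> 'h::ring_1 \<Rightarrow> 'h" and star :: "'h \<Rightarrow> 'h"
    and scT :: "'l::field \<Rightarrow> 't::ring_1 \<Rightarrow> 't" and emb :: "'k \<Rightarrow> 'l" and incl :: "'h \<Rightarrow> 't" +
  fixes starT :: "'t \<Rightarrow> 't"
  assumes fe: "field_embedding emb" and le: "linear_extension scT incl star starT"
begin

lemma emb: "emb 1 = 1" "emb (x + y) = emb x + emb y" "emb (x * y) = emb x * emb y"
  using fe by (simp_all add: field_embedding_def)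

lemma emb_0: "emb 0 = 0" using emb(2)[of 0 0] by (metis add_0 add_right_cancel)

lemma emb_minus: "emb (- x) = - emb x"
  using emb(2)[of x "- x"] by (simp add: emb_0 eq_neg_iff_add_eq_0 add.commute)

lemma emb_eq_0: "emb x = 0 \<Longrightarrow> x = 0"
  using emb(3)[of x "inverse x"] emb(1) by (cases "x = 0") auto

lemma incl_0: "incl 0 = 0" using T.incl_add[of 0 0] by simp

lemma incl_minus: "incl (- x) = - incl x"
  using T.incl_add[of x "- x"] by (simp add: incl_0 eq_neg_iff_add_eq_0 add.commute)

lemma incl_diff: "incl (x - y) = incl x - incl y"
  using T.incl_add[of x "- y"] by (simp add: incl_minus)

lemma incl_scale: "incl (sc c x) = scT (emb c) (incl x)"
proof -
  have "tensor_eval scT incl (frag_of (sc c x, 1) - frag_of (x, emb c * 1)) = 0"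
    unfolding T.tensor_kernel by (rule tensor_relations.balanced)
  then show ?thesis unfolding tensor_eval_def frag_sum_diff frag_sum_of by simp
qed

lemma incl_scalar: "incl (sc c 1) = scT (emb c) 1"
  by (simp add: incl_scale T.incl_one)

text \<open>A \<open>K\<close>-linear functional on \<open>H\<close> extends to the tensor product. It is used
  with coordinate functionals to prove that \<open>incl\<close> is injective.\<close>

lemma relation_functional:
  assumes f: "\<And>x y. f (x + y) = f x + f y" "\<And>c x. f (sc c x) = c * f x"
    and r: "r \<in> tensor_relations sc emb"
  shows "(\<Sum>p\<in>Poly_Mapping.keys r. of_int (Poly_Mapping.lookup r p) * (emb (f (fst p)) * snd p)) = 0"
  using r
  by (induction rule: tensor_relations.induct)
     (simp_all only: frag_sum_diff frag_sum_of f emb fst_conv snd_conv, simp_all add: algebra_simps)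

lemma incl_inj:
  assumes "incl x = incl y"
  shows "x = y"
proof -
  have "incl (x - y) = 0" using assms by (simp add: incl_diff)
  then have "tensor_eval scT incl (frag_of (x - y, 1)) = 0"
    unfolding tensor_eval_def frag_sum_of by simp
  then have r: "frag_of (x - y, 1) \<in> tensor_relations sc emb" unfolding T.tensor_kernel .
  have functional: "f (x - y) = 0"
    if "\<And>x y. f (x + y) = f x + f y" "\<And>c x. f (sc c x) = c * f x" for f
    using relation_functional[OF that r] emb_eq_0 unfolding frag_sum_of by simp
  obtain a b i j where "quaternion_basis sc a b i j" using H.ex_quaternion_basis by blast
  then interpret Q: quaternion_coords sc a b i j by unfold_locales
  define S where "S = {1, i, j, i * j}"
  have ind: "H.independent S" and sp: "H.span S = UNIV" and fin: "finite S"
    using Q.basis_ind Q.basis_span by (simp_all add: S_def)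
  have "H.representation S (x - y) e = 0" for e
    by (rule functional[of "\<lambda>z. H.representation S z e"])
       (simp_all add: H.representation_add[OF ind] H.representation_scale[OF ind] sp)
  then have "(\<Sum>e\<in>S. sc (H.representation S (x - y) e) e) = 0" by simp
  moreover have "(\<Sum>e\<in>S. sc (H.representation S (x - y) e) e) = x - y"
    by (rule H.sum_representation_eq[OF ind _ fin order_refl]) (simp add: sp)
  ultimately show ?thesis by simp
qed

lemma T_induct:
  assumes sum: "\<And>x y. Q x \<Longrightarrow> Q y \<Longrightarrow> Q (x + y)" and base: "\<And>s x. Q (scT s (incl x))"
  shows "Q t"
proof -
  obtain r where r: "t = tensor_eval scT incl r" using T.tensor_surj by (metis UNIV_I imageE)
  have "Q (\<Sum>p\<in>F. of_int (Poly_Mapping.lookup r p) * scT (snd p) (incl (fst p)))" if "finite F" for F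
    using that
  proof (induction F rule: finite_induct)
    case empty
    show ?case using base[of 0] by simp
  next
    case (insert p F)
    have "Q (scT (of_int (Poly_Mapping.lookup r p) * snd p) (incl (fst p)))" by (rule base)
    then have "Q (of_int (Poly_Mapping.lookup r p) * scT (snd p) (incl (fst p)))"
      by (simp add: T.scale_of_int[symmetric])
    then show ?case using insert by (simp add: sum)
  qed
  then show ?thesis unfolding r tensor_eval_def by simp
qed

lemma starT_add: "starT (x + y) = starT x + starT y" and starT_scale: "starT (scT c x) = scT c (starT x)"
proof -
  have "Vector_Spaces.linear scT scT starT" using le by (simp add: linear_extension_def)
  then interpret L: Vector_Spaces.linear scT scT starT .
  show "starT (x + y) = starT x + starT y" "starT (scT c x) = scT c (starT x)"
    by (rule L.add, rule L.scale)
qed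

lemma starT_incl: "starT (incl x) = incl (star x)"
  using le by (simp add: linear_extension_def)

lemma starT_starT: "starT (starT x) = x"
  by (induction x rule: T_induct) (simp_all add: starT_add starT_scale starT_incl H.st_star)

lemma starT_mult: "starT (x * y) = starT y * starT x"
proof (induction x rule: T_induct)
  case (1 x z)
  then show ?case by (simp add: distrib_left distrib_right starT_add)
next
  case (2 s x)
  show ?case
  proof (induction y rule: T_induct)
    case (1 y z)
    then show ?case by (simp add: distrib_left distrib_right starT_add)
  next
    case (2 s' y)
    then show ?case
      by (simp add: T.scale_mult_left T.scale_mult_right starT_scale starT_incl H.st_mult
          T.incl_mult[symmetric] mult.commute)
  qed
qed

lemma starT_0: "starT 0 = 0" using starT_add[of 0 0] by simp

lemma starT_1: "starT 1 = 1" using starT_incl[of 1] by (simp add: T.incl_one H.st_1)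

lemma starT_minus: "starT (- x) = - starT x"
  using starT_add[of x "- x"] by (simp add: starT_0 eq_neg_iff_add_eq_0 add.commute)

lemma starT_diff: "starT (x - y) = starT x - starT y"
  using starT_add[of x "- y"] by (simp add: starT_minus)

lemma finite_spanning: "\<exists>S. finite S \<and> T.span S = UNIV"
proof -
  obtain a b i j where "quaternion_basis sc a b i j" using H.ex_quaternion_basis by blast
  then interpret Q: quaternion_coords sc a b i j by unfold_locales
  define S where "S = incl ` {1, i, j, i * j}"
  have inc: "incl x \<in> T.span S" for x
  proof -
    have "x \<in> H.span {1, i, j, i * j}" by (simp only: Q.basis_span UNIV_I)
    then show ?thesis
    proof (induction rule: H.span_induct_alt)
      case base
      show ?case by (simp add: incl_0 T.span_zero)
    next
      case (step c x y)
      have "incl x \<in> T.span S" using step(1) unfolding S_def by (intro T.span_base imageI)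
      then show ?case using step(2) by (simp add: T.incl_add incl_scale T.span_add T.span_scale)
    qed
  qed
  have "t \<in> T.span S" for t
    by (induction t rule: T_induct) (simp_all add: T.span_add T.span_scale inc)
  then show ?thesis by (intro exI[of _ S]) (auto simp: S_def)
qed

text \<open>Left multiplication by \<open>G'\<close> is an injective linear map of the finite-dimensional space
  of matrices, hence surjective.\<close>

lemma right_inverse_left_inverse:
  fixes G G' :: "'t^2^2"
  assumes GG': "G ** G' = one_mat"
  shows "G' ** G = one_mat"
proof -
  define scM where "scM c M = map_matrix (scT c) M" for c and M :: "'t^2^2"
  have scM2: "scM c (mat2 p q r s) = mat2 (scT c p) (scT c q) (scT c r) (scT c s)" for c p q r s
    unfolding scM_def by (rule mat2_map)
  interpret M: vector_space scM
  proof
    fix c d :: 'l and X Y :: "'t^2^2"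
    obtain p q r s where X: "X = mat2 p q r s" by (rule mat2_cases)
    obtain p' q' r' s' where Y: "Y = mat2 p' q' r' s'" by (rule mat2_cases)
    show "scM c (X + Y) = scM c X + scM c Y" unfolding X Y by (simp add: scM2 mat2_add T.scale_right_distrib)
    show "scM (c + d) X = scM c X + scM d X" unfolding X by (simp add: scM2 mat2_add T.scale_left_distrib)
    show "scM c (scM d X) = scM (c * d) X" unfolding X by (simp add: scM2)
    show "scM 1 X = X" unfolding X by (simp add: scM2)
  qed
  obtain S where S: "finite S" "T.span S = UNIV" using finite_spanning by blast
  define S4 where "S4 = (\<lambda>x. mat2 x 0 0 0) ` S \<union> (\<lambda>x. mat2 0 x 0 0) ` S \<union> (\<lambda>x. mat2 0 0 x 0) ` S \<union> (\<lambda>x. mat2 0 0 0 x) ` S"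
  have corner: "h x \<in> M.span S4"
    if h: "\<And>x y. h (x + y) = h x + h y" "\<And>c x. h (scT c x) = scM c (h x)" "h ` S \<subseteq> S4" for h :: "'t \<Rightarrow> 't^2^2" and x
  proof -
    have "x \<in> T.span S" by (simp add: S)
    then show ?thesis
    proof (induction rule: T.span_induct_alt)
      case base
      have "h 0 = 0" using h(1)[of 0 0] by simp
      then show ?case by (simp add: M.span_zero)
    next
      case (step c x y)
      then have "h x \<in> M.span S4" using h(3) by (intro M.span_base) auto
      then show ?case using step(2) by (simp add: h M.span_add M.span_scale)
    qed
  qed
  have "X \<in> M.span S4" for X
  proof -
    obtain p q r s where X: "X = mat2 p q r s" by (rule mat2_cases)
    have "mat2 p 0 0 0 \<in> M.span S4" "mat2 0 q 0 0 \<in> M.span S4" "mat2 0 0 r 0 \<in> M.span S4" "mat2 0 0 0 s \<in> M.span S4"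
      by (rule corner[of "\<lambda>x. mat2 x 0 0 0"] corner[of "\<lambda>x. mat2 0 x 0 0"]
            corner[of "\<lambda>x. mat2 0 0 x 0"] corner[of "\<lambda>x. mat2 0 0 0 x"];
          auto simp: mat2_add scM2 S4_def)+
    then have "mat2 p 0 0 0 + mat2 0 q 0 0 + mat2 0 0 r 0 + mat2 0 0 0 s \<in> M.span S4"
      by (intro M.span_add)
    then show ?thesis by (simp add: X mat2_add)
  qed
  then have sp4: "M.span S4 = UNIV" by blast
  obtain B where B: "B \<subseteq> S4" "M.independent B" "S4 \<subseteq> M.span B"
    using M.maximal_independent_subset[of S4] by blast
  have "finite B" using B(1) S(1) by (auto simp: S4_def intro: finite_subset)
  moreover have "M.span B = UNIV" using B(3) sp4 by (metis M.span_mono M.span_span top.extremum_uniqueI)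
  ultimately interpret F: finite_dimensional_vector_space scM B
    using B(2) by unfold_locales
  have lin: "Vector_Spaces.linear scM scM (\<lambda>X. G' ** X)"
  proof (unfold_locales, goal_cases)
    case (1 X Y)
    show ?case by (simp add: matrix_add_ldistrib)
  next
    case (2 c X)
    obtain p q r s where X: "X = mat2 p q r s" by (rule mat2_cases)
    obtain p' q' r' s' where G: "G' = mat2 p' q' r' s'" by (rule mat2_cases)
    show ?case unfolding X G by (simp add: scM2 mat2_mult T.scale_mult_right T.scale_right_distrib)
  qed
  have inj: "inj (\<lambda>X :: 't^2^2. G' ** X)"
  proof (rule injI)
    fix X Y assume "G' ** X = G' ** Y"
    then have "G ** (G' ** X) = G ** (G' ** Y)" by simp
    then show "X = Y" by (simp add: matrix_mul_assoc GG' matrix_mul_lid)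
  qed
  have "surj (\<lambda>X :: 't^2^2. G' ** X)"
    by (rule finite_dimensional_vector_space.linear_inj_imp_surj[OF F.finite_dimensional_vector_space_axioms lin inj])
  then obtain X where X: "G' ** X = one_mat" by (metis surjD)
  have "X = G ** (G' ** X)" by (simp add: matrix_mul_assoc GG' matrix_mul_lid)
  then have "X = G" by (simp add: X matrix_mul_rid)
  then show ?thesis using X by simp
qed

end

section \<open>Conjugations normalizing SL(2,K)\<close>

lemma (in extended_involution) central_emb: "scT (emb c) 1 * x = x * scT (emb c) 1"
  by (simp add: T.scale_mult_left T.scale_mult_right)

context extended_involution
begin

abbreviation S :: "'t \<Rightarrow> 't^2^2" where "S x \<equiv> mat2 x 0 0 x"

abbreviation k :: "'k \<Rightarrow> 't" where "k c \<equiv> scT (emb c) 1"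

text \<open>The anti-involution of the matrix ring for which the defining equations of the group say that the
  adjoint is a right inverse.\<close>

definition adj :: "'t^2^2 \<Rightarrow> 't^2^2" where
  "adj M = mat2 (starT (vec_nth (vec_nth M 2) 2)) (- starT (vec_nth (vec_nth M 1) 2))
     (- starT (vec_nth (vec_nth M 2) 1)) (starT (vec_nth (vec_nth M 1) 1))"

lemma adj_mat2: "adj (mat2 a b c d) = mat2 (starT d) (- starT b) (- starT c) (starT a)"
  by (simp add: adj_def mat2_nth)

lemma adj_mult: "adj (M ** N) = adj N ** adj M"
proof -
  obtain a b c d where M: "M = mat2 a b c d" by (rule mat2_cases)
  obtain a' b' c' d' where N: "N = mat2 a' b' c' d'" by (rule mat2_cases)
  show ?thesis unfolding M N
    by (simp add: mat2_mult adj_mat2 mat2_eq_iff starT_add starT_mult add.commute)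
qed

lemma adj_adj: "adj (adj M) = M"
proof -
  obtain a b c d where M: "M = mat2 a b c d" by (rule mat2_cases)
  show ?thesis unfolding M by (simp add: adj_mat2 starT_starT starT_minus)
qed

lemma SL_star_inverse:
  assumes "M \<in> SL_star starT"
  shows "M ** adj M = one_mat" "adj M ** M = one_mat"
proof -
  obtain a b c d where M: "M = mat2 a b c d" by (rule mat2_cases)
  have e: "b * starT a = a * starT b" "d * starT c = c * starT d" "a * starT d - b * starT c = 1"
    using assms unfolding M mat2_SL_star by (simp_all add: starT_mult starT_starT)
  have "starT (a * starT d - b * starT c) = 1" unfolding e(3) by (rule starT_1)
  then have "d * starT a - c * starT b = 1" by (simp add: starT_diff starT_mult starT_starT)
  then show 1: "M ** adj M = one_mat"
    unfolding M adj_mat2 mat2_mult mat2_one mat2_eq_iff using e by simp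
  show "adj M ** M = one_mat" by (rule right_inverse_left_inverse[OF 1])
qed

lemma SL_star_matrix_inv: "M \<in> SL_star starT \<Longrightarrow> matrix_inv M = adj M"
  using SL_star_inverse by (intro matrix_inv_eqI)

end

text \<open>Only one inclusion between the groups of the two orders is assumed, so that the locale can be
  interpreted both for a matrix and for its inverse.\<close>

locale sl2_normalizer = extended_involution sc star scT emb incl starT
  for sc :: "'k::field_char_0 \<Rightarrow> 'h::ring_1 \<Rightarrow> 'h" and star :: "'h \<Rightarrow> 'h"
    and scT :: "'l::field \<Rightarrow> 't::ring_1 \<Rightarrow> 't" and emb :: "'k \<Rightarrow> 'l" and incl :: "'h \<Rightarrow> 't"
    and starT :: "'t \<Rightarrow> 't" +
  fixes G :: "'t^2^2" and O1 O2 :: "'h set"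
  assumes G_adj: "G ** adj G = one_mat" "adj G ** G = one_mat"
    and so: "star_order sc star O1" "star_order sc star O2"
    and orders: "\<And>M. M \<in> SL_star_over star O1 \<Longrightarrow>
      \<exists>N\<in>SL_star_over star O2. G ** map_matrix incl M ** adj G = map_matrix incl N"
    and sl2: "\<And>N. N \<in> SL2 \<Longrightarrow> \<exists>N'\<in>SL2. map_matrix k N = G ** map_matrix k N' ** adj G"
begin

definition cj :: "'t^2^2 \<Rightarrow> 't^2^2" where "cj M = G ** M ** adj G"

lemma cj_mult: "cj (M ** N) = cj M ** cj N"
proof -
  have "cj M ** cj N = G ** M ** (adj G ** G) ** N ** adj G" by (simp add: cj_def matrix_mul_assoc)
  then show ?thesis by (simp add: cj_def G_adj matrix_mul_rid matrix_mul_assoc)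
qed

lemma cj_add: "cj (M + N) = cj M + cj N"
  by (simp add: cj_def matrix_add_ldistrib mat2_add_rdistrib)

lemma cj_diff: "cj (M - N) = cj M - cj N"
  using cj_add[of "M - N" N] by (simp add: eq_diff_eq)

lemma cj_one: "cj (one_mat) = one_mat"
  by (simp add: cj_def matrix_mul_rid G_adj)

lemma cj_adj: "adj (cj M) = cj (adj M)"
  by (simp add: cj_def adj_mult adj_adj matrix_mul_assoc)

definition \<psi> :: "'t \<Rightarrow> 't" where "\<psi> x = vec_nth (vec_nth (cj (S x)) 1) 1"

text \<open>The scalar matrices are the matrices commuting with the two elementary unipotent matrices, and
  conjugation preserves the image of \<open>SL(2,K)\<close>, hence its centralizer.\<close>

lemma cj_S: "cj (S x) = S (\<psi> x)"
proof -
  obtain p q r s where X: "cj (S x) = mat2 p q r s" by (rule mat2_cases)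
  have comm: "cj (S x) ** map_matrix k N = map_matrix k N ** cj (S x)" if N: "N \<in> SL2" for N
  proof -
    obtain N' where N': "map_matrix k N = cj (map_matrix k N')" using sl2[OF N] unfolding cj_def by blast
    obtain a b c d where abcd: "N' = mat2 a b c d" by (rule mat2_cases)
    have "S x ** map_matrix k N' = map_matrix k N' ** S x"
      unfolding abcd by (simp add: mat2_map mat2_mult mat2_eq_iff central_emb)
    then show ?thesis unfolding N' cj_mult[symmetric] by simp
  qed
  have k01: "k 0 = 0" "k 1 = 1" by (simp_all add: emb_0 emb(1))
  have "mat2 1 1 0 (1::'k) \<in> SL2" "mat2 1 0 1 (1::'k) \<in> SL2" by (simp_all add: mat2_SL2)
  from comm[OF this(1)] comm[OF this(2)] have "r = 0" "q = 0" "p = s"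
    unfolding X by (simp_all add: mat2_map k01 mat2_mult mat2_eq_iff add.commute)
  then show ?thesis unfolding \<psi>_def X by (simp add: mat2_nth)
qed

lemma S_inj: "S x = S y \<Longrightarrow> x = y" by (simp add: mat2_eq_iff)

lemma \<psi>_add: "\<psi> (x + y) = \<psi> x + \<psi> y"
proof -
  have "S (\<psi> (x + y)) = cj (S x + S y)" unfolding cj_S[symmetric] by (simp add: mat2_add)
  also have "cj (S x + S y) = S (\<psi> x) + S (\<psi> y)" by (simp only: cj_add cj_S)
  finally show ?thesis by (simp add: mat2_add mat2_eq_iff)
qed

lemma \<psi>_mult: "\<psi> (x * y) = \<psi> x * \<psi> y"
proof -
  have "S (\<psi> (x * y)) = cj (S x ** S y)" unfolding cj_S[symmetric] by (simp add: mat2_mult)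
  also have "cj (S x ** S y) = S (\<psi> x) ** S (\<psi> y)" by (simp only: cj_mult cj_S)
  finally show ?thesis by (simp add: mat2_mult mat2_eq_iff)
qed

lemma \<psi>_1: "\<psi> 1 = 1"
  by (rule S_inj) (simp only: cj_S[symmetric] mat2_one[symmetric] cj_one)

lemma \<psi>_star: "\<psi> (starT x) = starT (\<psi> x)"
proof -
  have a: "adj (S y) = S (starT y)" for y by (simp add: adj_mat2 starT_0)
  have "adj (cj (S x)) = cj (S (starT x))" by (simp only: cj_adj a)
  then have "S (starT (\<psi> x)) = S (\<psi> (starT x))" by (simp only: cj_S a)
  then show ?thesis by (intro S_inj) (rule sym)
qed

lemma \<psi>_scale: "\<psi> (scT c x) = scT c (\<psi> x)"
proof -
  have c: "scT c 1 * y = y * scT c 1" for y by (simp add: T.scale_mult_left T.scale_mult_right)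
  obtain p q r s where G: "G = mat2 p q r s" by (rule mat2_cases)
  have "S (scT c 1) ** G = G ** S (scT c 1)" unfolding G by (simp add: mat2_mult mat2_eq_iff c)
  then have "cj (S (scT c 1)) = S (scT c 1) ** (G ** adj G)" by (simp add: cj_def matrix_mul_assoc)
  then have "\<psi> (scT c 1) = scT c 1" unfolding cj_S G_adj matrix_mul_rid by (rule S_inj)
  then show ?thesis using \<psi>_mult[of "scT c 1" x] by (simp add: T.scale_mult_left)
qed

text \<open>With the matrix units \<open>E\<close> and \<open>F\<close> at the off-diagonal places, multiplied
  by \<open>h\<close> and 1 respectively, \<open>h I = E F + F E\<close>. Both are differences of unipotent
  elements of the group of the first order, so their conjugates have entries in the second order.\<close>

lemma \<psi>_symmetric:
  assumes h: "h \<in> O1" "star h = h"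
  shows "\<exists>y\<in>O2. star y = y \<and> \<psi> (incl h) = incl y"
proof -
  interpret H: involution_algebra sc star "trd sc" "nrm sc"
  proof -
    obtain a b i j where B: "quaternion_basis sc a b i j" "star i = i" "star j = j"
      using H.ex_symmetric_basis by blast
    interpret Q: symmetric_coords sc star a b i j by unfold_locales (fact B)+
    show "involution_algebra sc star (trd sc) (nrm sc)" by (rule Q.involution_algebra)
  qed
  note O1D = H.star_orderD[OF so(1)] and O2D = H.star_orderD[OF so(2)]
  define IM where "IM = {M. \<exists>a\<in>O2. \<exists>b\<in>O2. \<exists>c\<in>O2. \<exists>d\<in>O2. M = mat2 (incl a) (incl b) (incl c) (incl d)}"
  have IMI: "mat2 (incl a) (incl b) (incl c) (incl d) \<in> IM" if "a \<in> O2" "b \<in> O2" "c \<in> O2" "d \<in> O2" for a b c d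
    using that unfolding IM_def by blast
  have IME: "\<exists>a b c d. a \<in> O2 \<and> b \<in> O2 \<and> c \<in> O2 \<and> d \<in> O2 \<and> M = mat2 (incl a) (incl b) (incl c) (incl d)"
    if "M \<in> IM" for M using that unfolding IM_def by blast
  have IM_ops: "M ** N \<in> IM \<and> M + N \<in> IM \<and> M - N \<in> IM" if MN: "M \<in> IM" "N \<in> IM" for M N
  proof -
    obtain a b c d where M: "a \<in> O2" "b \<in> O2" "c \<in> O2" "d \<in> O2" "M = mat2 (incl a) (incl b) (incl c) (incl d)"
      using IME[OF MN(1)] by (elim exE conjE)
    obtain a' b' c' d' where N: "a' \<in> O2" "b' \<in> O2" "c' \<in> O2" "d' \<in> O2" "N = mat2 (incl a') (incl b') (incl c') (incl d')"
      using IME[OF MN(2)] by (elim exE conjE)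
    have "M ** N \<in> IM" unfolding M(5) N(5) mat2_mult T.incl_mult[symmetric] T.incl_add[symmetric]
      by (intro IMI O2D M N)
    moreover have "M + N \<in> IM" unfolding M(5) N(5) mat2_add T.incl_add[symmetric] by (intro IMI O2D M N)
    moreover have "M - N \<in> IM" unfolding M(5) N(5) mat2_diff incl_diff[symmetric] by (intro IMI O2D M N)
    ultimately show ?thesis by blast
  qed
  have cj_IM: "cj (map_matrix incl M) \<in> IM" if M: "M \<in> SL_star_over star O1" for M
  proof -
    obtain N where N: "N \<in> SL_star_over star O2" "cj (map_matrix incl M) = map_matrix incl N"
      using orders[OF M] unfolding cj_def by blast
    obtain a b c d where abcd: "N = mat2 a b c d" by (rule mat2_cases)
    show ?thesis using N(1) unfolding N(2) abcd mat2_map mat2_SL_star_over by (intro IMI) simp_all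
  qed
  have U: "cj (mat2 0 (incl z) 0 0) \<in> IM \<and> cj (mat2 0 0 (incl z) 0) \<in> IM"
    if z: "z \<in> O1" "star z = z" for z
  proof -
    have "mat2 1 z 0 1 \<in> SL_star_over star O1" "mat2 1 0 z 1 \<in> SL_star_over star O1" "mat2 1 0 0 1 \<in> SL_star_over star O1"
      using z O1D by (simp_all add: mat2_SL_star_over mat2_SL_star H.star_1 H.star_0)
    from this[THEN cj_IM] have u: "cj (mat2 1 (incl z) 0 1) \<in> IM" "cj (mat2 1 0 (incl z) 1) \<in> IM" "cj (mat2 1 0 0 1) \<in> IM"
      by (simp_all add: mat2_map incl_0 T.incl_one)
    have "cj (mat2 1 (incl z) 0 1) - cj (mat2 1 0 0 1) \<in> IM" "cj (mat2 1 0 (incl z) 1) - cj (mat2 1 0 0 1) \<in> IM"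
      using IM_ops u by blast+
    then show ?thesis unfolding cj_diff[symmetric] mat2_diff by simp
  qed
  define E where "E = mat2 0 (incl h) 0 0"
  define F where "F = mat2 0 0 (incl 1) 0"
  have EF: "cj E \<in> IM" "cj F \<in> IM" using U[OF h] U[OF O1D(1) H.star_1] by (simp_all add: E_def F_def)
  have "cj E ** cj F + cj F ** cj E \<in> IM" using IM_ops EF by blast
  moreover have "cj E ** cj F + cj F ** cj E = S (\<psi> (incl h))"
    unfolding cj_mult[symmetric] cj_add[symmetric] cj_S[symmetric]
    by (simp add: E_def F_def mat2_mult mat2_add T.incl_one)
  ultimately have "S (\<psi> (incl h)) \<in> IM" by simp
  then obtain y where y: "y \<in> O2" "\<psi> (incl h) = incl y" by (auto simp: IM_def mat2_eq_iff)
  have "incl (star y) = starT (\<psi> (incl h))" by (simp add: y(2) starT_incl)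
  also have "\<dots> = incl y" unfolding \<psi>_star[symmetric] starT_incl h(2) by (rule y(2))
  finally have "star y = y" by (rule incl_inj)
  then show ?thesis using y by blast
qed

end

section \<open>The equivalence\<close>

context sl2_normalizer
begin

text \<open>The elements mapped into \<open>H\<close> form a \<open>K\<close>-subalgebra. It contains the
  symmetric elements, since these are combinations of \<open>x + star x\<close> with \<open>x\<close> in
  \<open>O1\<close>, and it is everything because a quaternion basis has symmetric generators.\<close>

lemma \<psi>_preserves_H: "\<exists>y. \<psi> (incl x) = incl y"
proof -
  obtain a b i j where B: "quaternion_basis sc a b i j" "star i = i" "star j = j"
    using H.ex_symmetric_basis by blast
  interpret Q: symmetric_coords sc star a b i j by unfold_locales (fact B)+
  have O1: "1 \<in> O1" "\<And>x y. x \<in> O1 \<Longrightarrow> y \<in> O1 \<Longrightarrow> x - y \<in> O1" "\<And>x. x \<in> O1 \<Longrightarrow> star x \<in> O1"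
    "H.span O1 = UNIV"
    using so(1) by (simp_all add: star_order_def is_order_def)
  define R where "R = {x. \<exists>y. \<psi> (incl x) = incl y}"
  have R_add: "x + y \<in> R" if "x \<in> R" "y \<in> R" for x y
    using that unfolding R_def by (auto simp: T.incl_add \<psi>_add) (metis T.incl_add)
  have R_scale: "sc c x \<in> R" if "x \<in> R" for c x
    using that unfolding R_def by (auto simp: incl_scale \<psi>_scale) (metis incl_scale)
  have R_mult: "x * y \<in> R" if "x \<in> R" "y \<in> R" for x y
    using that unfolding R_def by (auto simp: T.incl_mult \<psi>_mult) (metis T.incl_mult)
  have R_1: "1 \<in> R" unfolding R_def using T.incl_one \<psi>_1 by (intro CollectI exI[of _ 1]) simp
  have R_sum: "x + star x \<in> R" if "x \<in> H.span O1" for x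
    using that
  proof (induction rule: H.span_induct_alt)
    case base
    have "sc 0 1 \<in> R" by (rule R_scale[OF R_1])
    then show ?case by (simp add: H.st_0)
  next
    case (step c x y)
    have "0 \<in> O1" using O1(2)[OF O1(1,1)] by simp
    then have "- star x \<in> O1" using O1(2)[OF _ O1(3)[OF step(1)]] by (metis diff_0)
    then have "x + star x \<in> O1" using O1(2)[OF step(1)] by (metis diff_minus_eq_add)
    moreover have "star (x + star x) = x + star x" by (simp add: H.st_add H.st_star add.commute)
    ultimately have "x + star x \<in> R" using \<psi>_symmetric unfolding R_def by blast
    then have "sc c (x + star x) + (y + star y) \<in> R" by (intro R_add[OF R_scale step(2)])
    then show ?case by (simp add: H.st_add H.st_scale H.scale_right_distrib algebra_simps)
  qed
  have R_sym: "x \<in> R" if "star x = x" for x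
  proof -
    have "sc (1 / 2) (x + star x) \<in> R" by (intro R_scale R_sum) (simp add: O1)
    also have "sc (1 / 2) (x + star x) = x"
      by (simp add: that H.scale_right_distrib H.scale_left_distrib[symmetric])
    finally show ?thesis .
  qed
  obtain t u v w where "x = Q.q t u v w" by (rule Q.qE)
  then have "x = sc t 1 + sc u i + sc v j + sc w (i * j)" by (simp add: qcomb_def)
  also have "\<dots> \<in> R" by (intro R_add R_scale R_mult R_1 R_sym B)
  finally show ?thesis by (simp add: R_def)
qed

definition \<phi> :: "'h \<Rightarrow> 'h" where "\<phi> x = (SOME y. \<psi> (incl x) = incl y)"

lemma incl_\<phi>: "incl (\<phi> x) = \<psi> (incl x)"
  unfolding \<phi>_def using someI_ex[OF \<psi>_preserves_H[of x]] by simp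

lemma star_hom_\<phi>: "star_hom sc star \<phi>"
  unfolding star_hom_def
proof (intro conjI allI)
  fix x y :: 'h
  show "\<phi> (x + y) = \<phi> x + \<phi> y" by (rule incl_inj) (simp add: incl_\<phi> T.incl_add \<psi>_add)
  show "\<phi> (sc c x) = sc c (\<phi> x)" for c by (rule incl_inj) (simp add: incl_\<phi> incl_scale \<psi>_scale)
  show "\<phi> (x * y) = \<phi> x * \<phi> y" by (rule incl_inj) (simp add: incl_\<phi> T.incl_mult \<psi>_mult)
  show "\<phi> (star x) = star (\<phi> x)"
    by (rule incl_inj) (simp add: incl_\<phi> starT_incl[symmetric] \<psi>_star)
next
  show "\<phi> 1 = 1" by (rule incl_inj) (simp add: incl_\<phi> T.incl_one \<psi>_1)
qed

lemma \<phi>_symmetric: "h \<in> O1 \<Longrightarrow> star h = h \<Longrightarrow> \<phi> h \<in> O2 \<and> star (\<phi> h) = \<phi> h"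
  using \<psi>_symmetric[of h] incl_inj incl_\<phi> by metis

end

context extended_involution
begin

text \<open>The automorphism \<open>\<phi>\<close> defined by the conjugation maps \<open>O1\<close> to a
  maximal order with the same symmetric elements as \<open>O2\<close>, so
  \<open>maximal_star_order_unique\<close> applies.\<close>

theorem conjugate_imp_iso:
  assumes nf: "number_field TYPE('k)"
    and O1: "maximal_star_order sc star O1" and O2: "maximal_star_order sc star O2"
    and g: "g \<in> SL_star starT"
    and c1: "conj_set g (map_matrix incl ` SL_star_over star O1) = map_matrix incl ` SL_star_over star O2"
    and c2: "conj_set g (map_matrix k ` SL2) = map_matrix k ` SL2"
  shows "star_orders_iso sc star O1 O2"
proof -
  note inv = SL_star_inverse[OF g]
  have so: "star_order sc star O1" "star_order sc star O2"
    using O1 O2 by (simp_all add: maximal_star_order_def)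
  have cs: "conj_set g X = (\<lambda>M. g ** M ** adj g) ` X" for X
    by (simp add: conj_set_def SL_star_matrix_inv[OF g])
  have conj_back: "adj g ** (g ** M ** adj g) ** g = M" for M
  proof -
    have "adj g ** (g ** M ** adj g) ** g = (adj g ** g) ** M ** (adj g ** g)"
      by (simp only: matrix_mul_assoc)
    then show ?thesis by (simp only: inv matrix_mul_lid matrix_mul_rid)
  qed
  have conj_forth: "g ** (adj g ** M ** g) ** adj g = M" for M
  proof -
    have "g ** (adj g ** M ** g) ** adj g = (g ** adj g) ** M ** (g ** adj g)"
      by (simp only: matrix_mul_assoc)
    then show ?thesis by (simp only: inv matrix_mul_lid matrix_mul_rid)
  qed
  have o1: "\<exists>N\<in>SL_star_over star O2. g ** map_matrix incl M ** adj g = map_matrix incl N"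
    if "M \<in> SL_star_over star O1" for M
  proof -
    have "g ** map_matrix incl M ** adj g \<in> map_matrix incl ` SL_star_over star O2"
      unfolding c1[symmetric] cs using that by (intro imageI)
    then obtain N where "g ** map_matrix incl M ** adj g = map_matrix incl N" "N \<in> SL_star_over star O2"
      by (rule imageE)
    then show ?thesis by (rule bexI)
  qed
  have s1: "\<exists>N'\<in>SL2. map_matrix k N = g ** map_matrix k N' ** adj g" if "N \<in> SL2" for N
  proof -
    have "map_matrix k N \<in> conj_set g (map_matrix k ` SL2)" unfolding c2 using that by (intro imageI)
    then show ?thesis unfolding cs by blast
  qed
  have o2: "\<exists>N\<in>SL_star_over star O1. adj g ** map_matrix incl M ** adj (adj g) = map_matrix incl N"
    if "M \<in> SL_star_over star O2" for M
  proof -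
    have "map_matrix incl M \<in> conj_set g (map_matrix incl ` SL_star_over star O1)"
      unfolding c1 using that by (intro imageI)
    then obtain N where N: "N \<in> SL_star_over star O1" "map_matrix incl M = g ** map_matrix incl N ** adj g"
      unfolding cs by blast
    have "adj g ** map_matrix incl M ** adj (adj g) = map_matrix incl N"
      unfolding N(2) adj_adj by (rule conj_back)
    then show ?thesis using N(1) by (rule bexI)
  qed
  have s2: "\<exists>N'\<in>SL2. map_matrix k N = adj g ** map_matrix k N' ** adj (adj g)" if "N \<in> SL2" for N
  proof -
    have "g ** map_matrix k N ** adj g \<in> conj_set g (map_matrix k ` SL2)"
      unfolding cs using that by (intro imageI)
    then have "g ** map_matrix k N ** adj g \<in> map_matrix k ` SL2" by (simp only: c2)
    then obtain N' where N': "g ** map_matrix k N ** adj g = map_matrix k N'" "N' \<in> SL2" by (rule imageE)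
    have "map_matrix k N = adj g ** map_matrix k N' ** adj (adj g)"
      unfolding N'(1)[symmetric] adj_adj by (rule conj_back[symmetric])
    then show ?thesis using N'(2) by (rule bexI)
  qed
  interpret N1: sl2_normalizer sc star scT emb incl starT g O1 O2
  proof (unfold_locales, goal_cases)
    case 1 show ?case by (rule inv(1))
  next
    case 2 show ?case by (rule inv(2))
  next
    case 3 show ?case by (rule so(1))
  next
    case 4 show ?case by (rule so(2))
  next
    case (5 M) then show ?case by (rule o1)
  next
    case (6 N) then show ?case by (rule s1)
  qed
  interpret N2: sl2_normalizer sc star scT emb incl starT "adj g" O2 O1
  proof (unfold_locales, goal_cases)
    case 1 show ?case by (simp only: adj_adj inv(2))
  next
    case 2 show ?case by (simp only: adj_adj inv(1))
  next
    case 3 show ?case by (rule so(2))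
  next
    case 4 show ?case by (rule so(1))
  next
    case (5 M) then show ?case by (rule o2)
  next
    case (6 N) then show ?case by (rule s2)
  qed
  have "N2.\<psi> (N1.\<psi> x) = x" for x
    by (rule N1.S_inj) (simp only: N2.cj_S[symmetric] N1.cj_S[symmetric] N1.cj_def N2.cj_def adj_adj conj_back)
  moreover have "N1.\<psi> (N2.\<psi> x) = x" for x
    by (rule N1.S_inj) (simp only: N2.cj_S[symmetric] N1.cj_S[symmetric] N1.cj_def N2.cj_def adj_adj conj_forth)
  ultimately have inverse: "N2.\<phi> (N1.\<phi> x) = x" "N1.\<phi> (N2.\<phi> x) = x" for x
    by (rule_tac incl_inj, simp add: N1.incl_\<phi> N2.incl_\<phi>)+
  obtain a b i j where B: "quaternion_basis sc a b i j" "star i = i" "star j = j"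
    using H.ex_symmetric_basis by blast
  interpret Q: symmetric_coords sc star a b i j by unfold_locales (fact B)+
  interpret I: involution_algebra sc star "trd sc" "nrm sc" by (rule Q.involution_algebra)
  have "maximal_star_order sc star (N1.\<phi> ` O1)"
    by (rule I.maximal_star_order_image[OF N1.star_hom_\<phi> N2.star_hom_\<phi> inverse(2,1) O1])
  moreover have "{x \<in> N1.\<phi> ` O1. star x = x} = {x \<in> O2. star x = x}"
  proof
    show "{x \<in> N1.\<phi> ` O1. star x = x} \<subseteq> {x \<in> O2. star x = x}"
    proof
      fix y assume "y \<in> {x \<in> N1.\<phi> ` O1. star x = x}"
      then obtain x where x: "x \<in> O1" "y = N1.\<phi> x" "star y = y" by blast
      have "N1.\<phi> (star x) = N1.\<phi> x" using x(3) by (simp add: x(2) star_homD(5)[OF N1.star_hom_\<phi>])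
      then have "star x = x" by (metis inverse(1))
      then show "y \<in> {x \<in> O2. star x = x}" using N1.\<phi>_symmetric[OF x(1)] x(2) by simp
    qed
    show "{x \<in> O2. star x = x} \<subseteq> {x \<in> N1.\<phi> ` O1. star x = x}"
    proof
      fix y assume y: "y \<in> {x \<in> O2. star x = x}"
      then have "N2.\<phi> y \<in> O1" using N2.\<phi>_symmetric by simp
      then have "N1.\<phi> (N2.\<phi> y) \<in> N1.\<phi> ` O1" by (rule imageI)
      then show "y \<in> {x \<in> N1.\<phi> ` O1. star x = x}" using y by (simp add: inverse(2))
    qed
  qed
  ultimately have img: "N1.\<phi> ` O1 = O2" by (rule I.maximal_star_order_unique[OF nf _ O2])
  have inj: "inj_on N1.\<phi> O1" by (metis inj_onI inverse(1))
  note hom = star_homD[OF N1.star_hom_\<phi>]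
  show ?thesis unfolding star_orders_iso_def
    by (intro exI[of _ N1.\<phi>]) (simp add: bij_betw_def inj img hom)
qed

text \<open>The effect on matrices of applying \<open>f\<close> to the entries and then conjugating by
  \<open>diag(1, e)\<close> for a sign \<open>e\<close>.\<close>

definition twist :: "'h \<Rightarrow> ('h \<Rightarrow> 'h) \<Rightarrow> 'h^2^2 \<Rightarrow> 'h^2^2" where
  "twist e f M = mat2 (f (vec_nth (vec_nth M 1) 1)) (e * f (vec_nth (vec_nth M 1) 2))
     (e * f (vec_nth (vec_nth M 2) 1)) (f (vec_nth (vec_nth M 2) 2))"

lemma twist_mat2: "twist e f (mat2 a b c d) = mat2 (f a) (e * f b) (e * f c) (f d)"
  by (simp add: twist_def mat2_nth)

lemma twist_SL_star:
  assumes f: "star_hom sc star f" and fR: "f ` R \<subseteq> R'" and R': "star_order sc star R'"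
    and e: "e = 1 \<or> e = - 1" and M: "M \<in> SL_star_over star R"
  shows "twist e f M \<in> SL_star_over star R'"
proof -
  obtain a b c d where abcd: "M = mat2 a b c d" by (rule mat2_cases)
  note hom = star_homD[OF f]
  have R: "a \<in> R" "b \<in> R" "c \<in> R" "d \<in> R" and eq: "star (a * star b) = a * star b"
    "star (c * star d) = c * star d" "a * star d - b * star c = 1"
    using M unfolding abcd mat2_SL_star_over mat2_SL_star by auto
  have R'_minus: "- x \<in> R'" if "x \<in> R'" for x
  proof -
    have "1 - 1 - x \<in> R'" using R' that unfolding star_order_def is_order_def by blast
    then show ?thesis by simp
  qed
  have mem: "f x \<in> R'" if "x \<in> R" for x using fR that by blast
  have fe: "f (star (x * star y)) = star (f x * star (f y))" "f (x * star y) = f x * star (f y)" for x y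
    by (simp_all only: hom(3,5))
  have sym: "star (f x * star (f y)) = f x * star (f y)" if "star (x * star y) = x * star y" for x y
    using fe(1)[of x y] unfolding that fe(2) by (rule sym)
  from sym[OF eq(1)] sym[OF eq(2)]
  have "star (f a * star (f b)) = f a * star (f b)" "star (f c * star (f d)) = f c * star (f d)" .
  moreover have "f a * star (f d) - f b * star (f c) = 1"
    unfolding fe(2)[symmetric] hom(8)[symmetric] eq(3) by (rule hom(4))
  moreover note m = mem[OF R(1)] mem[OF R(2)] mem[OF R(3)] mem[OF R(4)]
  note m = m R'_minus[OF m(2)] R'_minus[OF m(3)]
  from e show ?thesis
  proof
    assume "e = 1"
    then show ?thesis unfolding abcd twist_mat2 mat2_SL_star_over mat2_SL_star
      using calculation m by (simp only: mult_1_left simp_thms)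
  next
    assume "e = - 1"
    then show ?thesis unfolding abcd twist_mat2 mat2_SL_star_over mat2_SL_star
      using calculation m by (simp only: mult_1_left mult_minus1 H.st_minus mult_minus_right mult_minus_left minus_minus simp_thms)
  qed
qed

text \<open>The sign \<open>r\<close> with \<open>v * star v = r * nrm v\<close> has to be repaired, since the
  larger field is known to contain square roots of norms but not of their negatives. The matrix
  \<open>diag(u, r u)\<close> with \<open>u = v / m\<close> does this, as \<open>u * star (r u) = r\<^sup>2
  = 1\<close>.\<close>

theorem iso_imp_conjugate:
  assumes nf: "number_field TYPE('k)"
    and so: "star_order sc star O1" "star_order sc star O2"
    and roots: "\<forall>x. splits (map_poly emb [:- nrm sc x, 0, 1:])"
    and iso: "star_orders_iso sc star O1 O2"
  shows "\<exists>g\<in>SL_star starT. conj_set g (map_matrix incl ` SL_star_over star O1) = map_matrix incl ` SL_star_over star O2 \<and>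
    conj_set g (map_matrix k ` SL2) = map_matrix k ` SL2"
proof -
  obtain a b i j where B: "quaternion_basis sc a b i j" "star i = i" "star j = j"
    using H.ex_symmetric_basis by blast
  interpret Q: symmetric_coords sc star a b i j by unfold_locales (fact B)+
  interpret I: involution_algebra sc star "trd sc" "nrm sc" by (rule Q.involution_algebra)
  obtain f where f: "star_hom sc star f" "f ` O1 = O2"
    using I.star_orders_iso_extends[OF nf so iso] by blast
  note hom = star_homD[OF f(1)]
  obtain v v' r where v: "nrm sc v \<noteq> 0" "v * v' = 1" "v' * v = 1" "r = 1 \<or> r = - 1"
    "v * star v = sc (r * nrm sc v) 1" "\<forall>x. f x = v * x * v'"
    using Q.star_automorphism_inner[OF hom(1-5)] by (elim exE conjE)
  define f' where "f' x = v' * x * v" for x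
  have ff': "f (f' x) = x" "f' (f x) = x" for x
  proof -
    have "f (f' x) = (v * v') * x * (v * v')" by (simp add: v(6) f'_def mult.assoc)
    then show "f (f' x) = x" by (simp add: v(2))
    have "f' (f x) = (v' * v) * x * (v' * v)" by (simp add: v(6) f'_def mult.assoc)
    then show "f' (f x) = x" by (simp add: v(3))
  qed
  have f_inj: "x = y" if "f x = f y" for x y using that ff'(2) by metis
  have f': "star_hom sc star f'"
    unfolding star_hom_def
    by (intro conjI allI; rule f_inj) (simp_all add: hom ff'(1))
  have f'O: "f' ` O2 \<subseteq> O1" using f(2) ff'(2) by auto
  obtain m where m: "m * m = emb (nrm sc v)"
  proof -
    have poly_eq: "map_poly emb [:- nrm sc v, 0, 1:] = [:- emb (nrm sc v), 0, 1:]"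
      by (simp add: map_poly_pCons emb_0 emb(1) emb_minus)
    obtain R where R: "[:- emb (nrm sc v), 0, 1:] =
        Polynomial.smult (lead_coeff [:- emb (nrm sc v), 0, 1:]) (\<Prod>r\<in>#R. [:- r, 1:])"
      using roots unfolding splits_def poly_eq[symmetric] by blast
    have "R \<noteq> {#}"
    proof
      assume "R = {#}"
      then have "[:- emb (nrm sc v), 0, 1:] = Polynomial.smult (lead_coeff [:- emb (nrm sc v), 0, 1:]) 1"
        using R by simp
      then show False by (simp add: one_pCons)
    qed
    then obtain x where x: "x \<in># R" by blast
    have "poly (\<Prod>r\<in>#R. [:- r, 1:]) x = 0"
    proof -
      obtain R0 where "R = add_mset x R0" using x by (metis mset_add)
      then show ?thesis by simp
    qed
    then have "poly [:- emb (nrm sc v), 0, 1:] x = 0" by (subst R) simp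
    then have "x * x = emb (nrm sc v)" by (simp add: algebra_simps)
    then show ?thesis by (rule that)
  qed
  have m0: "m \<noteq> 0" using m v(1) emb_eq_0 by auto
  define u where "u = scT (1 / m) (incl v)"
  define u' where "u' = scT m (incl v')"
  define e :: 'h where "e = sc r 1"
  have e1: "e = 1 \<or> e = - 1" using v(4) by (auto simp: e_def)
  then have ee: "e * e = 1" and ex: "e * x = x * e" for x by auto
  have ie: "incl e * incl e = 1" "incl e * x = x * incl e" "starT (incl e) = incl e" for x
    using e1 by (auto simp: T.incl_one incl_minus starT_1 starT_minus)
  have uu: "u * u' = 1" "u' * u = 1"
    using m0 by (simp_all add: u_def u'_def T.scale_mult_left T.scale_mult_right T.incl_mult[symmetric] v(2,3) T.incl_one)
  have us: "u * starT u = incl e"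
  proof -
    have "u * starT u = scT (1 / m * (1 / m)) (incl (v * star v))"
      by (simp add: u_def starT_scale starT_incl T.scale_mult_left T.scale_mult_right T.incl_mult)
    also have "\<dots> = scT (1 / m * (1 / m) * (emb r * (m * m))) 1"
      unfolding v(5) by (simp add: incl_scale T.incl_one emb(3) m)
    also have "1 / m * (1 / m) * (emb r * (m * m)) = emb r" using m0 by simp
    also have "scT (emb r) 1 = incl e" by (simp add: e_def incl_scalar)
    finally show ?thesis .
  qed
  have ux: "u * incl x * u' = incl (f x)" for x
    using m0 by (simp add: u_def u'_def T.scale_mult_left T.scale_mult_right T.incl_mult[symmetric] v(6))
  define g where "g = mat2 u 0 0 (incl e * u)"
  define g' where "g' = mat2 u' 0 0 (incl e * u')"
  have eu: "incl e * u * (incl e * u') = 1" "incl e * u' * (incl e * u) = 1"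
  proof -
    have "incl e * u * (incl e * u') = incl e * (u * incl e) * u'" by (simp only: mult.assoc)
    also have "u * incl e = incl e * u" by (rule ie(2)[symmetric])
    also have "incl e * (incl e * u) * u' = (incl e * incl e) * (u * u')" by (simp only: mult.assoc)
    finally show "incl e * u * (incl e * u') = 1" by (simp only: ie(1) uu mult_1_left)
    have "incl e * u' * (incl e * u) = incl e * (u' * incl e) * u" by (simp only: mult.assoc)
    also have "u' * incl e = incl e * u'" by (rule ie(2)[symmetric])
    also have "incl e * (incl e * u') * u = (incl e * incl e) * (u' * u)" by (simp only: mult.assoc)
    finally show "incl e * u' * (incl e * u) = 1" by (simp only: ie(1) uu mult_1_left)
  qed
  have inv: "matrix_inv g = g'"
    by (rule matrix_inv_eqI) (simp_all add: g_def g'_def mat2_mult mat2_one mat2_eq_iff uu eu)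
  have gSL: "g \<in> SL_star starT"
  proof -
    have "u * starT (incl e * u) = u * starT u * incl e" by (simp add: starT_mult ie(3) mult.assoc)
    then show ?thesis unfolding g_def mat2_SL_star by (simp add: us ie(1) starT_0)
  qed
  have conj: "g ** map_matrix incl M ** matrix_inv g = map_matrix incl (twist e f M)" for M
  proof -
    obtain a b c d where M: "M = mat2 a b c d" by (rule mat2_cases)
    have 1: "u * incl x * (incl e * u') = incl (e * f x)" for x
    proof -
      have "u * incl x * (incl e * u') = u * (incl x * incl e) * u'" by (simp only: mult.assoc)
      also have "incl x * incl e = incl (x * e)" by (simp add: T.incl_mult)
      also have "u * incl (x * e) * u' = incl (f (x * e))" by (rule ux)
      also have "f (x * e) = e * f x" using e1 by (auto simp: hom)
      finally show ?thesis .
    qed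
    have 2: "incl e * u * incl x * u' = incl (e * f x)" for x
      by (simp add: mult.assoc ux[unfolded mult.assoc] T.incl_mult)
    have 3: "incl e * u * incl x * (incl e * u') = incl (f x)" for x
    proof -
      have "incl e * u * incl x * (incl e * u') = incl e * (u * incl x * (incl e * u'))" by (simp only: mult.assoc)
      also have "\<dots> = incl e * incl e * incl (f x)" unfolding 1 by (simp add: T.incl_mult mult.assoc)
      finally show ?thesis by (simp only: ie(1) mult_1_left)
    qed
    show ?thesis unfolding inv unfolding g_def g'_def M twist_mat2 mat2_map
      by (simp add: mat2_mult mat2_eq_iff ux 1 2 3)
  qed
  have twist_inv: "twist e f (twist e f' M) = M" for M
  proof -
    obtain a b c d where M: "M = mat2 a b c d" by (rule mat2_cases)
    show ?thesis using e1 unfolding M twist_mat2 by (auto simp: hom ff'(1) star_homD[OF f'])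
  qed
  have "conj_set g (map_matrix incl ` SL_star_over star O1) = map_matrix incl ` SL_star_over star O2"
  proof -
    have "twist e f ` SL_star_over star O1 = SL_star_over star O2"
    proof
      show "twist e f ` SL_star_over star O1 \<subseteq> SL_star_over star O2"
        using twist_SL_star[OF f(1) _ so(2) e1] f(2) by blast
      show "SL_star_over star O2 \<subseteq> twist e f ` SL_star_over star O1"
      proof
        fix N assume "N \<in> SL_star_over star O2"
        then have "twist e f' N \<in> SL_star_over star O1" by (rule twist_SL_star[OF f' f'O so(1) e1])
        then show "N \<in> twist e f ` SL_star_over star O1" by (rule image_eqI[where f = "twist e f", OF twist_inv[symmetric, of N]])
      qed
    qed
    moreover have "conj_set g (map_matrix incl ` X) = map_matrix incl ` twist e f ` X" for X
      by (simp only: conj_set_def image_image conj)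
    ultimately show ?thesis by simp
  qed
  moreover have "conj_set g (map_matrix k ` SL2) = map_matrix k ` SL2"
  proof -
    define tw where "tw N = mat2 (vec_nth (vec_nth N 1) 1) (r * vec_nth (vec_nth N 1) 2)
      (r * vec_nth (vec_nth N 2) 1) (vec_nth (vec_nth N 2) 2)" for N :: "'k^2^2"
    have tw: "tw (mat2 a b c d) = mat2 a (r * b) (r * c) d" for a b c d by (simp add: tw_def mat2_nth)
    have rr: "r * r = 1" using v(4) by auto
    have kin: "map_matrix k N = map_matrix incl (map_matrix (\<lambda>c. sc c 1) N)" for N :: "'k^2^2"
    proof -
      obtain a b c d where N: "N = mat2 a b c d" by (rule mat2_cases)
      show ?thesis unfolding N by (simp add: mat2_map incl_scalar)
    qed
    have cj: "g ** map_matrix k N ** matrix_inv g = map_matrix k (tw N)" for N :: "'k^2^2"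
    proof -
      obtain a b c d where N: "N = mat2 a b c d" by (rule mat2_cases)
      have "f (sc c 1) = sc c 1" for c by (simp add: hom)
      then show ?thesis unfolding kin conj unfolding N tw mat2_map twist_mat2
        by (simp add: e_def H.scale_mult_left)
    qed
    have tw_tw: "tw (tw N) = N" for N
    proof -
      obtain a b c d where N: "N = mat2 a b c d" by (rule mat2_cases)
      show ?thesis unfolding N tw by (simp add: mult.assoc[symmetric] rr)
    qed
    have tw_SL2: "tw N \<in> SL2" if "N \<in> SL2" for N
    proof -
      obtain a b c d where N: "N = mat2 a b c d" by (rule mat2_cases)
      have rb: "r * b * (r * c) = b * c" using v(4) by auto
      show ?thesis using that unfolding N tw mat2_SL2 rb .
    qed
    have "tw ` SL2 = SL2"
    proof
      show "tw ` SL2 \<subseteq> SL2" using tw_SL2 by blast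
      show "SL2 \<subseteq> tw ` SL2"
      proof
        fix N :: "'k^2^2" assume "N \<in> SL2"
        then show "N \<in> tw ` SL2" by (intro image_eqI[where f = tw, OF tw_tw[symmetric, of N]] tw_SL2)
      qed
    qed
    moreover have "conj_set g (map_matrix k ` X) = map_matrix k ` tw ` X" for X
      by (simp only: conj_set_def image_image cj)
    ultimately show ?thesis by simp
  qed
  ultimately show ?thesis using gSL by blast
qed

end

theorem theorem7p2:
  fixes sc :: "'k::field_char_0 \<Rightarrow> 'h::ring_1 \<Rightarrow> 'h"
    and star :: "'h \<Rightarrow> 'h"
    and O1 O2 :: "'h set"
    and emb :: "'k \<Rightarrow> 'l::field"
    and scT :: "'l \<Rightarrow> 't::ring_1 \<Rightarrow> 't"
    and incl :: "'h \<Rightarrow> 't"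
    and starT :: "'t \<Rightarrow> 't"
  assumes "number_field TYPE('k)"
    and "quaternion_algebra sc"
    and "orthogonal_involution sc star"
    and "maximal_star_order sc star O1"
    and "maximal_star_order sc star O2"
    and "field_embedding emb"
    and "\<forall>x. splits (map_poly emb [:- nrm sc x, 0, 1:])"
    and "scalar_extension scT sc emb incl"
    and "linear_extension scT incl star starT"
  shows "(\<exists>\<gamma> \<in> SL_star starT.
            conj_set \<gamma> (map_matrix incl ` SL_star_over star O1) =
              map_matrix incl ` SL_star_over star O2 \<and>
            conj_set \<gamma> (map_matrix (\<lambda>c. scT (emb c) 1) ` SL2) =
              map_matrix (\<lambda>c. scT (emb c) 1) ` SL2)
         \<longleftrightarrow> star_orders_iso sc star O1 O2"
proof -
  interpret Q: quaternion_algebra sc by fact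
  interpret S: scalar_extension scT sc emb incl by fact
  interpret extended_involution sc star scT emb incl starT
    by unfold_locales (fact assms)+
  have so: "star_order sc star O1" "star_order sc star O2"
    using assms(4,5) by (simp_all add: maximal_star_order_def)
  show ?thesis
  proof
    assume "star_orders_iso sc star O1 O2"
    then show "\<exists>\<gamma> \<in> SL_star starT.
        conj_set \<gamma> (map_matrix incl ` SL_star_over star O1) = map_matrix incl ` SL_star_over star O2 \<and>
        conj_set \<gamma> (map_matrix (\<lambda>c. scT (emb c) 1) ` SL2) = map_matrix (\<lambda>c. scT (emb c) 1) ` SL2"
      by (rule iso_imp_conjugate[OF assms(1) so assms(7)])
  next
    assume "\<exists>\<gamma> \<in> SL_star starT.
        conj_set \<gamma> (map_matrix incl ` SL_star_over star O1) = map_matrix incl ` SL_star_over star O2 \<and>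
        conj_set \<gamma> (map_matrix (\<lambda>c. scT (emb c) 1) ` SL2) = map_matrix (\<lambda>c. scT (emb c) 1) ` SL2"
    then show "star_orders_iso sc star O1 O2"
      by (elim bexE conjE) (rule conjugate_imp_iso[OF assms(1,4,5)])
  qed
qed

end
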